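(* Given $p\in\mathbb R^+$, $n\in\mathbb Z^+$ and $k\in\mathbb Z^+$, let $$E_p:=\{(z,\xi)\in\mathbb C^n\times\mathbb C^k:|z|^2+|\xi|^{2p}<1\}.$$ Then the Bergman metric of $E_p$ is Kähler–Einstein if and only if $p=1$.
   Context: Here $|\cdot|$ is the Euclidean norm. The Bergman metric of a bounded domain is the Kähler metric with components $\frac{\partial^2\log K(w,w)}{\partial w_s\partial\overline{w_t}}$, where $K$ is the Bergman kernel of the domain (reproducing kernel of the space of square-integrable holomorphic functions). *)

theory Defs
  imports "HOL-Analysis.Analysis"
begin

section \<open>Holomorphic functions of several variables and the Bergman kernel\<close>

definition holomorphic_several :: "(complex^'m \<Rightarrow> complex) \<Rightarrow> (complex^'m::finite) set \<Rightarrow> bool"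
  where "holomorphic_several f D \<longleftrightarrow>
    (\<forall>w\<in>D. \<exists>f'. (f has_derivative f') (at w) \<and> (\<forall>c v. f' (c *s v) = c * f' v))"

definition bergman_space :: "(complex^'m::finite) set \<Rightarrow> (complex^'m \<Rightarrow> complex) set"
  where "bergman_space D =
    {f. holomorphic_several f D \<and> set_integrable lborel D (\<lambda>z. (cmod (f z))\<^sup>2)}"

text \<open>
  The reproducing property determines the kernel only on \<open>D \<times> D\<close>;
  it is extended by zero so that the description is unique.
\<close>

definition bergman_kernel :: "(complex^'m::finite) set \<Rightarrow> complex^'m \<Rightarrow> complex^'m \<Rightarrow> complex"
  where "bergman_kernel D = (THE K.
    (\<forall>w\<in>D. (\<lambda>z. K z w) \<in> bergman_space D) \<and>
    (\<forall>w\<in>D. \<forall>f\<in>bergman_space D. f w = (LINT z:D|lborel. f z * cnj (K z w))) \<and>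
    (\<forall>z w. z \<notin> D \<or> w \<notin> D \<longrightarrow> K z w = 0))"


section \<open>The Bergman metric\<close>

text \<open>
  The Wirtinger derivatives \<open>\<partial>/\<partial>w\<^sub>s\<close> and \<open>\<partial>/\<partial>w\<^sub>s\<close>-bar,
  with \<open>w\<^sub>s = x\<^sub>s + \<i> y\<^sub>s\<close>: the directions \<open>axis s 1\<close> and \<open>axis s \<i>\<close>
  are those of \<open>x\<^sub>s\<close> and \<open>y\<^sub>s\<close>.
\<close>

definition wirtinger :: "'m \<Rightarrow> (complex^'m::finite \<Rightarrow> complex) \<Rightarrow> complex^'m \<Rightarrow> complex"
  where "wirtinger s f w =
    (frechet_derivative f (at w) (axis s 1) - \<i> * frechet_derivative f (at w) (axis s \<i>)) / 2"

definition wirtinger_bar :: "'m \<Rightarrow> (complex^'m::finite \<Rightarrow> complex) \<Rightarrow> complex^'m \<Rightarrow> complex"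
  where "wirtinger_bar s f w =
    (frechet_derivative f (at w) (axis s 1) + \<i> * frechet_derivative f (at w) (axis s \<i>)) / 2"

definition complex_hessian ::
    "(complex^'m::finite \<Rightarrow> complex) \<Rightarrow> complex^'m \<Rightarrow> complex^'m^'m"
  where "complex_hessian f w = (\<chi> s t. wirtinger s (wirtinger_bar t f) w)"

text \<open>
  For a bounded domain \<open>K w w\<close> is a positive real, so that the principal branch \<open>ln\<close> is the
  real logarithm; likewise for the determinant of a Hermitian metric below.
\<close>

definition bergman_metric :: "(complex^'m::finite) set \<Rightarrow> complex^'m \<Rightarrow> complex^'m^'m"
  where "bergman_metric D = complex_hessian (\<lambda>w. ln (bergman_kernel D w w))"


section \<open>Kaehler--Einstein metrics\<close>

primrec Ck_on ::
    "nat \<Rightarrow> 'a::real_normed_vector set \<Rightarrow> ('a \<Rightarrow> 'b::real_normed_vector) \<Rightarrow> bool"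
  where
    "Ck_on 0 D f \<longleftrightarrow> continuous_on D f"
  | "Ck_on (Suc k) D f \<longleftrightarrow> (\<forall>w\<in>D. f differentiable at w) \<and>
       (\<forall>v. Ck_on k D (\<lambda>w. frechet_derivative f (at w) v))"

text \<open>
  A Hermitian metric on \<open>D\<close> is given by its matrix of components; the row index belongs to
  \<open>w\<^sub>s\<close>, the column index to \<open>w\<^sub>t\<close>-bar. The last condition says that the associated
  (1,1)-form is closed.
\<close>

definition kaehler_metric_on ::
    "(complex^'m::finite) set \<Rightarrow> (complex^'m \<Rightarrow> complex^'m^'m) \<Rightarrow> bool"
  where "kaehler_metric_on D g \<longleftrightarrow>
    (\<forall>s t k. Ck_on k D (\<lambda>w. g w $ s $ t)) \<and>
    (\<forall>w\<in>D. \<forall>s t. g w $ t $ s = cnj (g w $ s $ t)) \<and>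
    (\<forall>w\<in>D. \<forall>v. v \<noteq> 0 \<longrightarrow> 0 < Re (\<Sum>s\<in>UNIV. \<Sum>t\<in>UNIV. g w $ s $ t * v $ s * cnj (v $ t))) \<and>
    (\<forall>w\<in>D. \<forall>s t u. wirtinger u (\<lambda>w. g w $ s $ t) w = wirtinger s (\<lambda>w. g w $ u $ t) w)"

definition ricci ::
    "(complex^'m::finite \<Rightarrow> complex^'m^'m) \<Rightarrow> complex^'m \<Rightarrow> complex^'m^'m"
  where "ricci g w = - complex_hessian (\<lambda>w. ln (det (g w))) w"

definition kaehler_einstein_on ::
    "(complex^'m::finite) set \<Rightarrow> (complex^'m \<Rightarrow> complex^'m^'m) \<Rightarrow> bool"
  where "kaehler_einstein_on D g \<longleftrightarrow>
    kaehler_metric_on D g \<and> (\<exists>c::real. \<forall>w\<in>D. ricci g w = c *\<^sub>R g w)"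


section \<open>The domains\<close>

text \<open>\<open>\<complex>\<^sup>n \<times> \<complex>\<^sup>k\<close> is identified with \<open>\<complex>\<^sup>n\<^sup>+\<^sup>k\<close> by concatenating coordinates.\<close>

definition join :: "complex^'n \<Rightarrow> complex^'k \<Rightarrow> complex^('n::finite + 'k::finite)"
  where "join z \<xi> = (\<chi> i. case i of Inl a \<Rightarrow> z $ a | Inr b \<Rightarrow> \<xi> $ b)"

definition E :: "real \<Rightarrow> (complex^('n::finite + 'k::finite)) set"
  where "E p = {join z \<xi> | z \<xi>. (norm z)\<^sup>2 + norm \<xi> powr (2 * p) < 1}"

end

theory Submission
  imports Defs "HOL-Complex_Analysis.Complex_Analysis" "HOL-Real_Asymp.Real_Asymp"
begin

text \<open>
  Write \<open>s = 1/p\<close>, \<open>X = \<langle>z,w\<rangle>\<close>, \<open>Y = \<langle>\<xi>,\<eta>\<rangle>\<close> and \<open>A = n + 1 + ks\<close>. The Bergman kernel of \<open>E\<^sub>p\<close> is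
  \<open>(1 - X)\<^sup>-\<^sup>A \<Phi>(Y (1 - X)\<^sup>-\<^sup>s)\<close> with \<open>\<Phi>(x) = \<Sum>\<^sub>j a\<^sub>j x\<^sup>j\<close> and
  \<open>a\<^sub>j = \<kappa> (j + k)!/j! ((j + k)s + 1)\<^sub>n\<close>. A unitary change of coordinates reduces the reproducing property
  to points \<open>(\<rho> e\<^sub>a, \<tau> e\<^sub>b)\<close>; there averaging over coordinate rotations leaves only the moments
  of \<open>|z\<^sub>a|\<^sup>2\<^sup>i |\<xi>\<^sub>b|\<^sup>2\<^sup>j\<close>, which the weight \<open>exp (-|z|\<^sup>2 - |\<xi>|\<^sup>2\<^sup>p)\<close> turns into Gamma factors.

  For \<open>p = 1\<close> the kernel is a power of \<open>1 - |w|\<^sup>2\<close>, and \<open>det g\<close> is a constant multiple of the kernel.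

  For the converse let \<open>h = (log \<Phi>)'\<close>. On the complex coordinate lines through the origin \<open>g\<close> is diagonal. The
  Einstein equation at the origin in a \<open>z\<close>-direction forces the constant \<open>-1\<close>, and in a \<open>\<xi>\<close>-direction it then
  becomes \<open>n s h(0)/A + (k + 1) h'(0)/h(0) = h(0)\<close>. With \<open>q\<^sub>i = ((k + i)s + 1)\<^sub>n\<close> this says
  \<open>(k + 2) A q\<^sub>2 q\<^sub>0 = ((k + 2) A - n s) q\<^sub>1\<^sup>2\<close>, whereas for \<open>s \<noteq> 1\<close> the left side is strictly larger, by
  induction on \<open>n\<close>.
\<close>

text \<open>The exponential weight is removed by homogeneity in two ways: dilating (z, \<xi>) leaves
  an integral over \<open>E p\<close>, dilating \<xi> alone leaves one over the cylinder |\<xi>| <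
  1, which no longer involves p. So the case p = 1, where the weight splits over the coordinates,
  evaluates the cylinder and with it every \<open>E p\<close>. One unevaluated number goes into
  \<kappa> and vanishes when the logarithm is differentiated. The reproducing property is proved by
  termwise integration against the expanded kernel rather than through completeness of the
  monomials; hence the need for a bound on the argument of \<Phi> that is uniform in the first
  variable. In the converse, det g is computed on coordinate lines only: a diagonal entry of the
  complex Hessian at 0 sees just the restriction to one line, where log det g is a function of
  |\<zeta>|^2. The constant -1 reflects that det g divided by the kernel on the diagonal is
  invariant under the automorphisms of \<open>E p\<close>, which act transitively on the points (z,
  0).\<close>

no_notation fps_nth (infixl "$" 75)

section \<open>Lebesgue measure and rotations\<close>

text \<open>
  The integral of \<open>1\<^sub>A(x) 1\<^sub>B(x + y)\<close> against \<open>M\<close> in \<open>x\<close> and Lebesgue measure \<open>\<lambda>\<close> in \<open>y\<close> is both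
  \<open>M(A) \<lambda>(B)\<close> and \<open>\<lambda>(A) M(B)\<close>.
\<close>

lemma lborel_translation_invariant_eq:
  fixes M :: "'a::euclidean_space measure"
  assumes sets_M: "sets M = sets borel" and sf: "sigma_finite_measure M"
    and transl: "\<And>c. distr M borel ((+) c) = M"
    and B: "B \<in> sets borel" "emeasure M B = emeasure lborel B"
      "emeasure lborel B \<noteq> 0" "emeasure lborel B \<noteq> \<infinity>"
  shows "M = lborel"
proof (rule measure_eqI)
  have [measurable_cong]: "sets M = sets borel" by (fact sets_M)
  interpret M: sigma_finite_measure M by (fact sf)
  interpret P: pair_sigma_finite M lborel ..
  have reflect: "distr lborel borel uminus = (lborel :: 'a measure)"
    by (subst lborel_affine[of "-1" 0])
       (auto simp: density_1 one_ennreal_def[symmetric] scaleR_minus_left)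
  have int_transl: "(\<integral>\<^sup>+x. f (c + x) \<partial>N) = (\<integral>\<^sup>+x. f x \<partial>N)"
    if "distr N borel ((+) c) = N" "sets N = sets borel" "f \<in> borel_measurable borel"
    for f :: "'a \<Rightarrow> ennreal" and c N
  proof -
    have [measurable_cong]: "sets N = sets borel" by fact
    have [measurable]: "f \<in> borel_measurable borel" by fact
    have "(\<integral>\<^sup>+x. f x \<partial>N) = (\<integral>\<^sup>+x. f x \<partial>distr N borel ((+) c))"
      using that by simp
    also have "\<dots> = (\<integral>\<^sup>+x. f (c + x) \<partial>N)"
      by (rule nn_integral_distr) measurable
    finally show ?thesis by simp
  qed
  fix A assume "A \<in> sets M"
  then have A: "A \<in> sets borel" by (simp add: sets_M)
  note [measurable] = A B(1)
  let ?f = "indicator A :: 'a \<Rightarrow> ennreal" and ?g = "indicator B :: 'a \<Rightarrow> ennreal"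
  have "emeasure M A * emeasure lborel B = (\<integral>\<^sup>+x. ?f x * (\<integral>\<^sup>+y. ?g y \<partial>lborel) \<partial>M)"
    using A B by (simp add: nn_integral_multc sets_M)
  also have "\<dots> = (\<integral>\<^sup>+x. (\<integral>\<^sup>+y. ?f x * ?g (x + y) \<partial>lborel) \<partial>M)"
  proof (rule nn_integral_cong)
    fix x
    have "(\<integral>\<^sup>+y. ?g y \<partial>lborel) = (\<integral>\<^sup>+y. ?g (x + y) \<partial>lborel)"
      by (rule int_transl[OF lborel_distr_plus, symmetric]) auto
    then show "?f x * (\<integral>\<^sup>+y. ?g y \<partial>lborel) = (\<integral>\<^sup>+y. ?f x * ?g (x + y) \<partial>lborel)"
      by (simp only: nn_integral_cmult measurable_lborel1) (subst nn_integral_cmult, auto)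
  qed
  also have "\<dots> = (\<integral>\<^sup>+y. (\<integral>\<^sup>+x. ?f x * ?g (x + y) \<partial>M) \<partial>lborel)"
    by (rule P.Fubini'[symmetric]) measurable
  also have "\<dots> = (\<integral>\<^sup>+y. (\<integral>\<^sup>+x. ?f (x - y) * ?g x \<partial>M) \<partial>lborel)"
  proof (rule nn_integral_cong)
    fix y
    show "(\<integral>\<^sup>+x. ?f x * ?g (x + y) \<partial>M) = (\<integral>\<^sup>+x. ?f (x - y) * ?g x \<partial>M)"
      using int_transl[OF transl sets_M, of "\<lambda>x. ?f (x - y) * ?g x" y]
      by (simp add: add.commute)
  qed
  also have "\<dots> = (\<integral>\<^sup>+x. (\<integral>\<^sup>+y. ?f (x - y) * ?g x \<partial>lborel) \<partial>M)"
    by (rule P.Fubini') measurable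
  also have "\<dots> = (\<integral>\<^sup>+x. (\<integral>\<^sup>+y. ?f y \<partial>lborel) * ?g x \<partial>M)"
  proof (rule nn_integral_cong)
    fix x
    have "(\<integral>\<^sup>+y. ?f (x - y) * ?g x \<partial>lborel) = (\<integral>\<^sup>+y. ?f (x - y) \<partial>lborel) * ?g x"
      by (rule nn_integral_multc) measurable
    also have "(\<integral>\<^sup>+y. ?f (x - y) \<partial>lborel) = (\<integral>\<^sup>+y. ?f (x + y) \<partial>distr lborel borel uminus)"
      by (subst nn_integral_distr) auto
    also have "\<dots> = (\<integral>\<^sup>+y. ?f y \<partial>lborel)"
      unfolding reflect by (rule int_transl[OF lborel_distr_plus]) auto
    finally show "(\<integral>\<^sup>+y. ?f (x - y) * ?g x \<partial>lborel) = (\<integral>\<^sup>+y. ?f y \<partial>lborel) * ?g x" .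
  qed
  also have "\<dots> = emeasure lborel A * emeasure M B"
    using A B by (simp add: nn_integral_cmult sets_M)
  finally have "emeasure M A * emeasure lborel B = emeasure lborel A * emeasure lborel B"
    using B by simp
  then show "emeasure M A = emeasure lborel A"
    using B(3,4) ennreal_mult_cancel_left[of "emeasure lborel B" "emeasure M A" "emeasure lborel A"]
    by (auto simp: mult.commute)
qed (simp add: sets_M)

text \<open>The image measure is again translation invariant, because translating by c after T is
  translating by \<open>inv T c\<close> before T, and it agrees with Lebesgue measure on the unit
  ball, which T maps onto itself.\<close>

lemma lborel_distr_orthogonal:
  fixes T :: "'a::euclidean_space \<Rightarrow> 'a"
  assumes T: "orthogonal_transformation T"
  shows "distr lborel borel T = lborel"
proof (rule lborel_translation_invariant_eq)
  note lin = orthogonal_transformation_linear[OF T]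
  have [measurable]: "T \<in> borel_measurable borel"
    using lin by (intro borel_measurable_continuous_onI linear_continuous_on)
       (simp add: linear_conv_bounded_linear)
  have inv: "orthogonal_transformation (inv T)"
    by (rule orthogonal_transformation_inv[OF T])
  have bij: "bij T" by (rule orthogonal_transformation_bij[OF T])
  have vim: "T -` ball 0 r = ball 0 r" for r
    by (auto simp: orthogonal_transformation_norm[OF T])
  show "sets (distr lborel borel T) = sets borel" by simp
  show "sigma_finite_measure (distr lborel borel T)"
  proof
    show "\<exists>A::'a set set. countable A \<and> A \<subseteq> sets (distr lborel borel T) \<and>
        \<Union> A = space (distr lborel borel T) \<and> (\<forall>a\<in>A. emeasure (distr lborel borel T) a \<noteq> \<infinity>)"
    proof (intro exI[of _ "range (\<lambda>n::nat. ball 0 (real n))"] conjI ballI)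
      show "\<Union> (range (\<lambda>n::nat. ball (0::'a) (real n))) = space (distr lborel borel T)"
        using reals_Archimedean2 by auto
      fix a assume "a \<in> range (\<lambda>n::nat. ball (0::'a) (real n))"
      then show "emeasure (distr lborel borel T) a \<noteq> \<infinity>"
        using emeasure_lborel_ball_finite by (auto simp: emeasure_distr vim less_top)
    qed auto
  qed
  fix c
  have "distr (distr lborel borel T) borel ((+) c) = distr lborel borel (\<lambda>x. c + T x)"
    by (subst distr_distr) (auto simp: o_def)
  also have "(\<lambda>x. c + T x) = (\<lambda>x. T (inv T c + x))"
    using bij lin by (auto simp: linear_add bij_is_surj surj_f_inv_f)
  also have "distr lborel borel \<dots> = distr (distr lborel borel ((+) (inv T c))) borel T"
    by (subst distr_distr) (auto simp: o_def)
  also have "\<dots> = distr lborel borel T"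
    by (simp add: lborel_distr_plus)
  finally show "distr (distr lborel borel T) borel ((+) c) = distr lborel borel T" .
next
  have [measurable]: "T \<in> borel_measurable borel"
    using orthogonal_transformation_linear[OF T]
    by (intro borel_measurable_continuous_onI linear_continuous_on)
       (simp add: linear_conv_bounded_linear)
  show "emeasure (distr lborel borel T) (ball 0 1) = emeasure lborel (ball (0::'a) 1)"
    by (auto simp: emeasure_distr vimage_def orthogonal_transformation_norm[OF T] ball_def)
  show "emeasure lborel (ball (0::'a) 1) \<noteq> 0"
    using emeasure_lborel_ball_finite[of "0::'a" 1] 
    by (metis content_ball_pos emeasure_eq_ennreal_measure ennreal_eq_0_iff infinity_ennreal_def 
       less_top not_le zero_less_one)
  show "emeasure lborel (ball (0::'a) 1) \<noteq> \<infinity>"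
    using emeasure_lborel_ball_finite[of "0::'a" 1] by simp
qed simp

lemma orthogonal_transformation_measurable:
  fixes T :: "'a::euclidean_space \<Rightarrow> 'a"
  shows "orthogonal_transformation T \<Longrightarrow> T \<in> borel_measurable borel"
  using orthogonal_transformation_linear[of T]
  by (intro borel_measurable_continuous_onI linear_continuous_on)
     (simp add: linear_conv_bounded_linear)

text \<open>Continuity on the open set D makes the zero extension of F Borel measurable, and
  invariance of D lets the indicator follow T.\<close>

lemma set_integral_orthogonal:
  fixes F :: "'a::euclidean_space \<Rightarrow> 'b::{banach, second_countable_topology}"
  assumes D: "open D" and T: "orthogonal_transformation T" "\<And>x. T x \<in> D \<longleftrightarrow> x \<in> D"
    and F: "continuous_on D F"
  shows "set_integrable lborel D (\<lambda>x. F (T x)) \<longleftrightarrow> set_integrable lborel D F"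
    "(LINT x:D|lborel. F (T x)) = (LINT x:D|lborel. F x)"
proof -
  note [measurable] = orthogonal_transformation_measurable[OF T(1)]
  have [measurable]: "(\<lambda>x. indicator D x *\<^sub>R F x) \<in> borel_measurable borel"
    using D F by (intro borel_measurable_continuous_on_indicator) auto
  have eq: "indicator D x *\<^sub>R F (T x) = indicator D (T x) *\<^sub>R F (T x)" for x
    using T(2) by (simp add: indicator_def)
  note * = lborel_distr_orthogonal[OF T(1)]
  show "set_integrable lborel D (\<lambda>x. F (T x)) \<longleftrightarrow> set_integrable lborel D F"
    unfolding set_integrable_def eq by (subst (2) *[symmetric], subst integrable_distr_eq) auto
  show "(LINT x:D|lborel. F (T x)) = (LINT x:D|lborel. F x)"
    unfolding set_lebesgue_integral_def eq by (subst (2) *[symmetric], subst integral_distr) auto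
qed

text \<open>Fubini on [0, 2 pi] times D: every rotation preserves the integral of F, so the double
  integral is 2 pi times it, while integrating over t first produces 2 pi G. Integrability of G is
  part of the conclusion so that the result can be averaged again.\<close>

lemma average_over_rotations:
  fixes D :: "'a::euclidean_space set" and F G :: "'a \<Rightarrow> complex" and R :: "real \<Rightarrow> 'a \<Rightarrow> 'a"
  assumes D: "open D"
    and R: "\<And>t. orthogonal_transformation (R t)" "continuous_on UNIV (\<lambda>(t, x). R t x)"
      "\<And>t x. R t x \<in> D \<longleftrightarrow> x \<in> D"
    and F: "continuous_on D F" "set_integrable lborel D F"
    and G: "\<And>x. x \<in> D \<Longrightarrow> ((\<lambda>t. F (R t x)) has_integral 2 * pi * G x) {0..2 * pi}"
  shows "set_integrable lborel D G" "(LINT x:D|lborel. F x) = (LINT x:D|lborel. G x)"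
proof -
  let ?I = "{0..2 * pi}"
  define H :: "real \<times> 'a \<Rightarrow> complex"
    where "H = (\<lambda>(t, x). indicator (?I \<times> D) (t, x) *\<^sub>R F (R t x))"
  have contR: "continuous_on S (\<lambda>t. R t x)" for S x
    using continuous_on_compose2[OF R(2), of S "\<lambda>t. (t, x)"] by (auto simp: continuous_on_Pair)
  have "continuous_on (?I \<times> D) (F \<circ> (\<lambda>(t, x). R t x))"
    by (rule continuous_on_compose[OF continuous_on_subset[OF R(2)] continuous_on_subset[OF F(1)]])
       (use R(3) in auto)
  then have "continuous_on (?I \<times> D) (\<lambda>y. F (case y of (t, x) \<Rightarrow> R t x))"
    by (simp add: o_def)
  moreover have "?I \<times> D \<in> sets (borel :: (real \<times> 'a) measure)"
    using D by (intro borel_Times) auto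
  ultimately have "H \<in> borel_measurable borel"
    unfolding H_def
    by (auto dest!: borel_measurable_continuous_on_indicator simp: case_prod_beta' split_def)
  then have [measurable]: "H \<in> borel_measurable (lborel \<Otimes>\<^sub>M lborel)"
    unfolding lborel_prod by simp
  \<comment> \<open>Invariance of D allows the indicator to be taken at the rotated point, so that
    for fixed t the integrand is the zero extension of F composed with an orthogonal map.\<close>
  have H_eq: "H (t, x) = indicator ?I t *\<^sub>R (indicator D (R t x) *\<^sub>R F (R t x))" for t x
    using R(3) by (auto simp: H_def indicator_def)
  have F0: "integrable lborel (\<lambda>x. indicator D x *\<^sub>R F x)"
    using F(2) by (simp add: set_integrable_def)
  have ind_R: "indicator D (R t x) = (indicator D x :: real)" for t x
    using R(3) by (simp add: indicator_def)
  have FR: "integrable lborel (\<lambda>x. indicator D (R t x) *\<^sub>R F (R t x))"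
    "(\<integral>x. indicator D (R t x) *\<^sub>R F (R t x) \<partial>lborel) = (\<integral>x. indicator D x *\<^sub>R F x \<partial>lborel)"
    "(\<integral>x. norm (indicator D (R t x) *\<^sub>R F (R t x)) \<partial>lborel) = (\<integral>x. norm (indicator D x *\<^sub>R F x) \<partial>lborel)"
    for t
    using set_integral_orthogonal[OF D R(1,3) F(1), of t] F(2)
      set_integral_orthogonal(2)[OF D R(1,3) continuous_on_norm[OF F(1)], of t]
    by (simp_all add: set_integrable_def set_lebesgue_integral_def ind_R)
  have inner: "((\<integral>t. H (t, x) \<partial>lborel) = 2 * pi * (indicator D x *\<^sub>R G x))" for x
  proof (cases "x \<in> D")
    case True
    then have "continuous_on ?I (\<lambda>t. F (R t x))"
      using R(3) by (intro continuous_on_compose2[OF F(1) contR]) auto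
    then have "set_integrable lborel ?I (\<lambda>t. F (R t x))"
      unfolding set_integrable_def by (intro borel_integrable_compact) auto
    from set_borel_integral_eq_integral(2)[OF this] G[OF True] True
    have "(LINT t:?I|lborel. F (R t x)) = 2 * pi * G x"
      by (metis integral_unique)
    moreover have "H (t, x) = indicator ?I t *\<^sub>R F (R t x)" for t
      using True by (auto simp: H_def indicator_def)
    ultimately show ?thesis
      using True by (simp add: set_lebesgue_integral_def)
  qed (simp add: H_def)
  have int: "integrable (lborel \<Otimes>\<^sub>M lborel) H"
  proof (rule lborel_pair.Fubini_integrable)
    have "(\<integral>x. norm (H (t, x)) \<partial>lborel) = indicator ?I t * (\<integral>x. norm (indicator D x *\<^sub>R F x) \<partial>lborel)" for t
      unfolding H_eq using FR(3)[of t] by (auto simp: indicator_def)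
    then show "integrable lborel (\<lambda>t. \<integral>x. norm (H (t, x)) \<partial>lborel)"
      by (auto intro!: integrable_mult_left simp: less_top[symmetric])
    have "integrable lborel (\<lambda>x. H (t, x))" for t
      unfolding H_eq by (intro integrable_scaleR_right FR(1))
    then show "AE t in lborel. integrable lborel (\<lambda>x. H (t, x))"
      by simp
  qed measurable
  then have int': "integrable (lborel \<Otimes>\<^sub>M lborel) (\<lambda>(t, x). H (t, x))" by simp
  have "integrable lborel (\<lambda>x. \<integral>t. H (t, x) \<partial>lborel)"
    using lborel_pair.integrable_snd[OF int'] by simp
  then have "integrable lborel (\<lambda>x. (1 / (2 * pi)) *\<^sub>R (2 * pi * (indicator D x *\<^sub>R G x)))"
    unfolding inner by (rule integrable_scaleR_right)
  also have "(\<lambda>x. (1 / (2 * pi)) *\<^sub>R (2 * pi * (indicator D x *\<^sub>R G x))) = (\<lambda>x. indicator D x *\<^sub>R G x)"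
    by (auto simp: scaleR_conv_of_real)
  finally show "set_integrable lborel D G"
    by (simp add: set_integrable_def)
  have "2 * pi * (LINT x:D|lborel. G x) = (\<integral>x. (\<integral>t. H (t, x) \<partial>lborel) \<partial>lborel)"
    unfolding inner set_lebesgue_integral_def by (rule integral_mult_right_zero[symmetric])
  also have "\<dots> = (\<integral>t. (\<integral>x. H (t, x) \<partial>lborel) \<partial>lborel)"
    using lborel_pair.Fubini_integral[OF int'] by simp
  also have "\<dots> = (\<integral>t. indicator ?I t *\<^sub>R (LINT x:D|lborel. F x) \<partial>lborel)"
    unfolding H_eq set_lebesgue_integral_def using FR(2)
    by (intro Bochner_Integration.integral_cong) (auto simp: indicator_def)
  also have "\<dots> = 2 * pi * (LINT x:D|lborel. F x)"
    by (subst integral_scaleR_left) (auto simp: scaleR_conv_of_real less_top[symmetric])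
  finally show "(LINT x:D|lborel. F x) = (LINT x:D|lborel. G x)"
    by simp
qed

section \<open>The domains and their moments\<close>

definition nsq1 :: "complex^('n::finite + 'k::finite) \<Rightarrow> real"
  where "nsq1 w = (\<Sum>a\<in>UNIV. (cmod (w $ Inl a))\<^sup>2)"

definition nsq2 :: "complex^('n::finite + 'k::finite) \<Rightarrow> real"
  where "nsq2 w = (\<Sum>b\<in>UNIV. (cmod (w $ Inr b))\<^sup>2)"

lemma nsq_nonneg [simp]: "nsq1 w \<ge> 0" "nsq2 w \<ge> 0"
  by (simp_all add: nsq1_def nsq2_def sum_nonneg)

lemma continuous_nsq [continuous_intros]: "continuous_on S nsq1" "continuous_on S nsq2"
  unfolding nsq1_def[abs_def] nsq2_def[abs_def] by (intro continuous_intros)+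

lemma measurable_nsq [measurable]: "nsq1 \<in> borel_measurable borel" "nsq2 \<in> borel_measurable borel"
  by (intro borel_measurable_continuous_onI continuous_intros)+

lemma sum_UNIV_Plus:
  "(\<Sum>i\<in>(UNIV :: ('n::finite + 'k::finite) set). f i) = (\<Sum>a\<in>UNIV. f (Inl a)) + (\<Sum>b\<in>UNIV. f (Inr b))"
  by (subst UNIV_Plus_UNIV[symmetric], subst sum.Plus) auto

lemma prod_UNIV_Plus:
  "(\<Prod>i\<in>(UNIV :: ('n::finite + 'k::finite) set). f i) = (\<Prod>a\<in>UNIV. f (Inl a)) * (\<Prod>b\<in>UNIV. f (Inr b))"
  by (subst UNIV_Plus_UNIV[symmetric], subst prod.Plus) auto

lemma norm_vec_square: "(norm (w :: complex^'m::finite))\<^sup>2 = (\<Sum>i\<in>UNIV. (cmod (w $ i))\<^sup>2)"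
  by (simp add: norm_vec_def L2_set_def sum_nonneg)

lemma norm_square_eq_nsq: "(norm w)\<^sup>2 = nsq1 w + nsq2 w"
  by (simp add: norm_vec_square sum_UNIV_Plus nsq1_def nsq2_def)

text \<open>Passing to squared norms replaces the exponent 2 p by p and makes both blocks plain sums
  over the coordinates.\<close>

lemma E_iff: "w \<in> E p \<longleftrightarrow> nsq1 w + nsq2 w powr p < 1"
proof -
  have norms: "(norm z)\<^sup>2 + norm \<xi> powr (2 * p) = nsq1 (join z \<xi>) + nsq2 (join z \<xi>) powr p" for z \<xi>
  proof -
    have "norm \<xi> powr (2 * p) = (norm \<xi>)\<^sup>2 powr p"
      by (cases "\<xi> = 0") (simp_all add: powr_powr[symmetric] powr_numeral)
    then show ?thesis
      by (simp add: norm_vec_square nsq1_def nsq2_def join_def)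
  qed
  show ?thesis
  proof
    assume "w \<in> E p"
    then show "nsq1 w + nsq2 w powr p < 1" by (auto simp: E_def norms)
  next
    assume *: "nsq1 w + nsq2 w powr p < 1"
    have "w = join (\<chi> a. w $ Inl a) (\<chi> b. w $ Inr b)"
      by (simp add: vec_eq_iff join_def split: sum.split)
    with * show "w \<in> E p" unfolding E_def using norms by (metis (mono_tags, lifting) mem_Collect_eq)
  qed
qed

lemma continuous_on_nsq2_powr [continuous_intros]:
  assumes "p > 0" shows "continuous_on S (\<lambda>w. nsq2 w powr p)"
  using assms by (intro continuous_on_powr' continuous_intros) auto

lemma open_E: assumes "p > 0" shows "open (E p :: (complex^('n::finite + 'k::finite)) set)"
proof -
  have "E p = {w :: complex^('n + 'k). nsq1 w + nsq2 w powr p < 1}" by (auto simp: E_iff)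
  also have "open \<dots>" by (intro open_Collect_less continuous_intros assms)
  finally show ?thesis .
qed

lemma E_bounds:
  assumes "p > 0" "w \<in> E p"
  shows "nsq1 w < 1" "nsq2 w < 1" "cmod (w $ i) < 1"
proof -
  have 1: "nsq1 w + nsq2 w powr p < 1" using assms by (simp add: E_iff)
  show n1: "nsq1 w < 1" using 1 by (smt (verit) powr_ge_zero)
  have "nsq2 w powr p < 1" using 1 nsq_nonneg(1)[of w] by linarith
  then show n2: "nsq2 w < 1"
    using assms by (metis nsq_nonneg(2) ge_one_powr_ge_zero less_imp_le not_le)
  have "(cmod (w $ i))\<^sup>2 < 1"
  proof (cases i)
    case (Inl a)
    have "(cmod (w $ i))\<^sup>2 \<le> nsq1 w"
      unfolding Inl nsq1_def by (rule member_le_sum) auto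
    with n1 show ?thesis by simp
  next
    case (Inr b)
    have "(cmod (w $ i))\<^sup>2 \<le> nsq2 w"
      unfolding Inr nsq2_def by (rule member_le_sum) auto
    with n2 show ?thesis by simp
  qed
  then show "cmod (w $ i) < 1" by (simp add: power_less_one_iff abs_square_less_1)
qed

lemma bounded_E: assumes "p > 0" shows "bounded (E p :: (complex^('n::finite + 'k::finite)) set)"
proof -
  have "norm w < 2" if "w \<in> E p" for w :: "complex^('n + 'k)"
  proof -
    have "(norm w)\<^sup>2 < 2\<^sup>2"
      using E_bounds(1,2)[OF assms that] by (simp add: norm_square_eq_nsq)
    then show ?thesis by (rule power2_less_imp_less) simp
  qed
  then show ?thesis unfolding bounded_iff by (meson less_imp_le)
qed

lemma zero_in_E: "p > 0 \<Longrightarrow> 0 \<in> E p"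
  by (simp add: E_iff nsq1_def nsq2_def)

section \<open>Dilations, exponential weights and Gamma factors\<close>

definition coord_scale :: "('m::finite \<Rightarrow> real) \<Rightarrow> complex^'m \<Rightarrow> complex^'m"
  where "coord_scale r w = (\<chi> i. r i *\<^sub>R w $ i)"

lemma coord_scale_nth [simp]: "coord_scale r w $ i = r i *\<^sub>R w $ i"
  by (simp add: coord_scale_def)

lemma coord_scale_measurable [measurable]: "coord_scale r \<in> borel_measurable borel"
  unfolding coord_scale_def
  by (intro borel_measurable_continuous_onI continuous_intros)

text \<open>A real factor on a complex coordinate acts on two real coordinates, hence the squares in
  the Jacobian.\<close>

lemma nn_integral_coord_scale:
  fixes f :: "complex^'m::finite \<Rightarrow> ennreal"
  assumes f [measurable]: "f \<in> borel_measurable borel" and r: "\<And>i. r i > 0"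
  shows "(\<integral>\<^sup>+w. f w \<partial>lborel) = ennreal (\<Prod>i\<in>UNIV. (r i)\<^sup>2) * (\<integral>\<^sup>+w. f (coord_scale r w) \<partial>lborel)"
proof -
  \<comment> \<open>On a real basis vector \<open>axis i u\<close> the l-th entry has norm 1 for l =
    i and 0 otherwise, so c assigns \<open>r i\<close> to both real directions of coordinate
    i.\<close>
  define c where "c = (\<lambda>j::complex^'m. \<Sum>i\<in>UNIV. r i * norm (j $ i))"
  have c_axis: "c (axis i u) = r i" if "u \<in> Basis" for i u
  proof -
    have "c (axis i u) = (\<Sum>l\<in>UNIV. if l = i then r i else 0)"
      unfolding c_def using that by (intro sum.cong) (auto simp: axis_def norm_Basis)
    then show ?thesis by simp
  qed
  have T: "(\<Sum>j\<in>Basis. (c j * (x \<bullet> j)) *\<^sub>R j) = coord_scale r x" for x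
  proof (rule euclidean_eqI)
    fix b :: "complex^'m" assume b: "b \<in> Basis"
    then obtain i u where iu: "b = axis i u" "u \<in> Basis" by (auto simp: Basis_vec_def)
    have "(\<Sum>j\<in>Basis. (c j * (x \<bullet> j)) *\<^sub>R j) \<bullet> b = c b * (x \<bullet> b)"
      using b by (simp add: inner_sum_left inner_Basis if_distrib cong: if_cong)
    also have "\<dots> = coord_scale r x \<bullet> b"
      using iu by (simp add: c_axis inner_axis)
    finally show "(\<Sum>j\<in>Basis. (c j * (x \<bullet> j)) *\<^sub>R j) \<bullet> b = coord_scale r x \<bullet> b" .
  qed
  have basis: "Basis = (\<lambda>(i, u). axis i u :: complex^'m) ` (UNIV \<times> Basis)"
    by (auto simp: Basis_vec_def)
  have inj: "inj_on (\<lambda>(i, u). axis i u :: complex^'m) (UNIV \<times> Basis)"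
    by (auto simp: inj_on_def axis_eq_axis)
  have prod: "(\<Prod>j\<in>Basis. \<bar>c j\<bar>) = (\<Prod>i\<in>UNIV. (r i)\<^sup>2)"
  proof -
    have "(\<Prod>j\<in>Basis. \<bar>c j\<bar>) = (\<Prod>(i, u)\<in>UNIV \<times> (Basis :: complex set). r i)"
      unfolding basis prod.reindex[OF inj] 
      by (intro prod.cong) (auto simp: c_axis less_imp_le[OF r])
    also have "\<dots> = (\<Prod>i\<in>UNIV. (r i)\<^sup>2)"
      by (subst prod.cartesian_product[symmetric]) (simp add: )
    finally show ?thesis .
  qed
  have "c j \<noteq> 0" if "j \<in> Basis" for j
    using that c_axis r by (auto simp: Basis_vec_def) (metis less_irrefl)
  from lborel_affine_euclidean[of c 0, OF this]
  have *: "lborel = density (distr lborel borel (coord_scale r)) (\<lambda>_. ennreal (\<Prod>i\<in>UNIV. (r i)\<^sup>2))"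
    by (simp add: T prod)
  show ?thesis
    by (subst *) (simp add: nn_integral_density nn_integral_distr nn_integral_cmult)
qed

lemma nn_integral_exp_greaterThan:
  "(\<integral>\<^sup>+t. ennreal (exp (- t)) * indicator {x<..} t \<partial>lborel) = ennreal (exp (- x))"
proof -
  have "(\<integral>\<^sup>+t. ennreal (exp (- t)) * indicator {x<..} t \<partial>lborel)
      = (\<integral>\<^sup>+t. ennreal (exp (- t)) * indicator {x..} t \<partial>lborel)"
  proof (rule nn_integral_cong_AE)
    have "AE t in lborel. t \<noteq> x" by (rule AE_lborel_singleton)
    then show "AE t in lborel. ennreal (exp (- t)) * indicator {x<..} t
        = ennreal (exp (- t)) * indicator {x..} t"
      by eventually_elim (auto simp: indicator_def)
  qed
  also have "\<dots> = ennreal (0 - (- exp (- x)))"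
    by (rule nn_integral_FTC_atLeast)
       (auto intro!: derivative_eq_intros, real_asymp)
  finally show ?thesis by simp
qed

text \<open>The number exp (-u) is the integral of exp (-t) over t > u; Tonelli turns the weighted
  integral into a superposition of integrals over the sublevel sets of u.\<close>

lemma nn_integral_exp_layer_cake:
  fixes u :: "'a::euclidean_space \<Rightarrow> real"
  assumes [measurable]: "m \<in> borel_measurable borel" "u \<in> borel_measurable borel"
    and u: "\<And>w. u w \<ge> 0"
  shows "(\<integral>\<^sup>+w. m w * ennreal (exp (- u w)) \<partial>lborel) =
    (\<integral>\<^sup>+t. ennreal (exp (- t)) * indicator {0<..} t * (\<integral>\<^sup>+w. m w * indicator {w. u w < t} w \<partial>lborel) \<partial>lborel)"
proof -
  have "(\<integral>\<^sup>+w. m w * ennreal (exp (- u w)) \<partial>lborel)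
      = (\<integral>\<^sup>+w. (\<integral>\<^sup>+t. m w * (ennreal (exp (- t)) * indicator {u w<..} t) \<partial>lborel) \<partial>lborel)"
    by (subst nn_integral_cmult) (auto simp: nn_integral_exp_greaterThan)
  also have "\<dots> = (\<integral>\<^sup>+w. (\<integral>\<^sup>+t. ennreal (exp (- t)) * indicator {0<..} t * (m w * indicator {w. u w < t} w) \<partial>lborel) \<partial>lborel)"
    using u by (intro nn_integral_cong) (auto simp: indicator_def mult_ac not_less dest: le_less_trans)
  also have "\<dots> = (\<integral>\<^sup>+t. (\<integral>\<^sup>+w. ennreal (exp (- t)) * indicator {0<..} t * (m w * indicator {w. u w < t} w) \<partial>lborel) \<partial>lborel)"
    by (rule lborel_pair.Fubini') measurable
  also have "\<dots> = (\<integral>\<^sup>+t. ennreal (exp (- t)) * indicator {0<..} t * (\<integral>\<^sup>+w. m w * indicator {w. u w < t} w \<partial>lborel) \<partial>lborel)"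
    by (intro nn_integral_cong nn_integral_cmult) measurable
  finally show ?thesis .
qed

text \<open>The dilation \<open>r t\<close> carries {u < 1} onto {u < t}, so the integral of m over
  {u < t} is t^(a + b) times the one over {u < 1}. Superposing these with density exp (-t) is
  Euler's integral for Gamma (a + b + 1).\<close>

lemma nn_integral_homogeneous_exp:
  fixes u :: "complex^'m::finite \<Rightarrow> real" and r :: "real \<Rightarrow> 'm \<Rightarrow> real"
  assumes m [measurable]: "m \<in> borel_measurable borel" and u [measurable]: "u \<in> borel_measurable borel"
    and u0: "\<And>w. u w \<ge> 0"
    and r: "\<And>t i. t > 0 \<Longrightarrow> r t i > 0"
    and m_scale: "\<And>t w. t > 0 \<Longrightarrow> m (coord_scale (r t) w) = ennreal (t powr a) * m w"
    and u_scale: "\<And>t w. t > 0 \<Longrightarrow> u (coord_scale (r t) w) = t * u w"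
    and jac: "\<And>t. t > 0 \<Longrightarrow> (\<Prod>i\<in>UNIV. (r t i)\<^sup>2) = t powr b"
    and ab: "a + b + 1 > 0"
  shows "(\<integral>\<^sup>+w. m w * ennreal (exp (- u w)) \<partial>lborel) =
    ennreal (Gamma (a + b + 1)) * (\<integral>\<^sup>+w. m w * indicator {w. u w < 1} w \<partial>lborel)"
proof -
  let ?V = "\<integral>\<^sup>+w. m w * indicator {w. u w < 1} w \<partial>lborel"
  have V: "(\<integral>\<^sup>+w. m w * indicator {w. u w < t} w \<partial>lborel) = ennreal (t powr (a + b)) * ?V"
    if t: "t > 0" for t
  proof -
    have "(\<integral>\<^sup>+w. m w * indicator {w. u w < t} w \<partial>lborel) = ennreal (t powr b) *
        (\<integral>\<^sup>+w. m (coord_scale (r t) w) * indicator {w. u w < t} (coord_scale (r t) w) \<partial>lborel)"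
      unfolding jac[OF t, symmetric] by (rule nn_integral_coord_scale) (auto simp: r t)
    also have "\<dots> = ennreal (t powr b) * (\<integral>\<^sup>+w. ennreal (t powr a) * (m w * indicator {w. u w < 1} w) \<partial>lborel)"
      using t by (simp add: m_scale u_scale indicator_def mult.assoc)
    also have "\<dots> = ennreal (t powr b) * ennreal (t powr a) * ?V"
      by (subst nn_integral_cmult) (auto simp: mult.assoc)
    also have "ennreal (t powr b) * ennreal (t powr a) = ennreal (t powr (a + b))"
      by (simp add: ennreal_mult'[symmetric] powr_add mult.commute)
    finally show ?thesis .
  qed
  have "(\<integral>\<^sup>+w. m w * ennreal (exp (- u w)) \<partial>lborel) =
    (\<integral>\<^sup>+t. ennreal (exp (- t)) * indicator {0<..} t * (\<integral>\<^sup>+w. m w * indicator {w. u w < t} w \<partial>lborel) \<partial>lborel)"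
    by (rule nn_integral_exp_layer_cake) (auto simp: u0)
  also have "\<dots> = (\<integral>\<^sup>+t. ennreal (indicator {0..} t * t powr (a + b + 1 - 1) / exp t) * ?V \<partial>lborel)"
  proof (rule nn_integral_cong_AE)
    have "AE t in lborel. t \<noteq> (0::real)" by (rule AE_lborel_singleton)
    then show "AE t in lborel. ennreal (exp (- t)) * indicator {0<..} t * (\<integral>\<^sup>+w. m w * indicator {w. u w < t} w \<partial>lborel)
       = ennreal (indicator {0..} t * t powr (a + b + 1 - 1) / exp t) * ?V"
    proof eventually_elim
      case (elim t)
      show ?case
      proof (cases "t > 0")
        case True
        have "ennreal (exp (- t)) * ennreal (t powr (a + b)) = ennreal (t powr (a + b) / exp t)"
          by (simp add: ennreal_mult'[symmetric] exp_minus field_simps)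
        then show ?thesis using True by (simp add: V[OF True] mult.assoc[symmetric])
      qed (use elim in \<open>auto simp: indicator_def\<close>)
    qed
  qed
  also have "\<dots> = ennreal (Gamma (a + b + 1)) * ?V"
    by (subst nn_integral_multc) (auto simp: Gamma_conv_nn_integral_real[OF ab])
  finally show ?thesis .
qed

text \<open>
  Integrating \<open>|w\<^sub>e|\<^sup>2 exp (-c |w\<^sub>e|\<^sup>2)\<close> over \<open>c \<ge> 1\<close> gives \<open>exp (-|w\<^sub>e|\<^sup>2)\<close>, while rescaling
  \<open>w\<^sub>e\<close> turns the dependence on \<open>c\<close> into the factor \<open>c\<^sup>-\<^sup>i\<^sup>-\<^sup>2\<close>.
\<close>

lemma nn_integral_cmod_power_Gaussian_Suc:
  fixes \<psi> :: "complex^'m::finite \<Rightarrow> ennreal"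
  assumes psi [measurable]: "\<psi> \<in> borel_measurable borel"
    and indep: "\<And>r w. (\<And>i. i \<noteq> e \<Longrightarrow> r i = 1) \<Longrightarrow> \<psi> (coord_scale r w) = \<psi> w"
  shows "(\<integral>\<^sup>+w. ennreal (cmod (w $ e) ^ (2 * Suc i) * exp (- (cmod (w $ e))\<^sup>2)) * \<psi> w \<partial>lborel) =
    ennreal (real (Suc i)) * (\<integral>\<^sup>+w. ennreal (cmod (w $ e) ^ (2 * i) * exp (- (cmod (w $ e))\<^sup>2)) * \<psi> w \<partial>lborel)"
proof -
  define f where "f c w = ennreal (cmod (w $ e) ^ (2 * Suc i) * exp (- c * (cmod (w $ e))\<^sup>2)) * \<psi> w"
    for c :: real and w :: "complex^'m"
  have [measurable]: "(\<lambda>w::complex^'m. w $ e) \<in> borel_measurable borel"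
    by (intro borel_measurable_continuous_onI continuous_intros)
  have f_meas [measurable]: "f c \<in> borel_measurable borel" for c
    unfolding f_def by measurable
  have scale: "(\<integral>\<^sup>+w. f c w \<partial>lborel) = ennreal (c powr - (2 + real i)) * (\<integral>\<^sup>+w. f 1 w \<partial>lborel)"
    if c: "c \<ge> 1" for c
  proof -
    define r where "r l = (if l = e then c powr (- 1 / 2) else 1)" for l
    have r2: "(c powr (- 1 / 2))\<^sup>2 = 1 / c"
      using c by (simp add: power2_eq_square powr_add[symmetric] powr_minus_divide)
    have "(\<Prod>l\<in>UNIV. (r l)\<^sup>2) = (\<Prod>l\<in>UNIV. if l = e then (c powr (- 1 / 2))\<^sup>2 else 1)"
      by (intro prod.cong) (auto simp: r_def)
    then have jac: "(\<Prod>l\<in>UNIV. (r l)\<^sup>2) = 1 / c"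
      using r2 by simp
    have fr: "f c (coord_scale r w) = ennreal ((1 / c) ^ Suc i) * f 1 w" for w
    proof -
      have sq: "(cmod (coord_scale r w $ e))\<^sup>2 = (cmod (w $ e))\<^sup>2 / c"
        using r2 by (simp add: r_def power_mult_distrib)
      have pow: "cmod (coord_scale r w $ e) ^ (2 * Suc i) = (1 / c) ^ Suc i * cmod (w $ e) ^ (2 * Suc i)"
        unfolding power_mult sq by (simp add: power_divide)
      have psi_eq: "\<psi> (coord_scale r w) = \<psi> w"
        by (rule indep) (simp add: r_def)
      have "f c (coord_scale r w) = ennreal ((1 / c) ^ Suc i *
          (cmod (w $ e) ^ (2 * Suc i) * exp (- 1 * (cmod (w $ e))\<^sup>2))) * \<psi> w"
        using c unfolding f_def pow sq psi_eq by (simp only: mult.assoc) simp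
      also have "\<dots> = ennreal ((1 / c) ^ Suc i) * f 1 w"
        using c unfolding f_def by (subst ennreal_mult') (auto simp only: mult.assoc zero_le_power zero_le_divide_1_iff)
      finally show ?thesis .
    qed
    have "(\<integral>\<^sup>+w. f c w \<partial>lborel) = ennreal (1 / c) * (\<integral>\<^sup>+w. f c (coord_scale r w) \<partial>lborel)"
      unfolding jac[symmetric] by (rule nn_integral_coord_scale) (use c in \<open>auto simp: r_def\<close>)
    also have "\<dots> = ennreal (1 / c) * ennreal ((1 / c) ^ Suc i) * (\<integral>\<^sup>+w. f 1 w \<partial>lborel)"
      unfolding fr by (subst nn_integral_cmult) (auto simp: mult.assoc)
    also have "ennreal (1 / c) * ennreal ((1 / c) ^ Suc i) = ennreal (c powr - (2 + real i))"
    proof -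
      have "(1 / c) * (1 / c) ^ Suc i = c powr - (2 + real i)"
proof -
  have "c powr - (2 + real i) = 1 / c powr (2 + real i)" by (rule powr_minus_divide)
  also have "1 / c powr (2 + real i) = 1 / c powr real (i + 2)" by (simp add: add.commute)
  also have "\<dots> = 1 / c ^ (i+2)" using c by (subst powr_realpow) auto
  finally show ?thesis by (simp add: power_divide)
qed
      then show ?thesis using c by (metis ennreal_mult' divide_nonneg_nonneg zero_le_one order_trans)
    qed
    finally show ?thesis .
  qed
  have exp_int: "(\<integral>\<^sup>+c. ennreal (q * exp (- c * q)) * indicator {1..} c \<partial>lborel) = ennreal (exp (- q))"
    if q: "q > 0" for q
  proof -
    have "(\<integral>\<^sup>+c. ennreal (q * exp (- c * q)) * indicator {1..} c \<partial>lborel) = ennreal (0 - (- exp (- 1 * q)))"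
    proof (rule nn_integral_FTC_atLeast)
      show "((\<lambda>c. - exp (- c * q)) \<longlongrightarrow> 0) at_top"
        using q by real_asymp
    qed (use q in \<open>auto intro!: derivative_eq_intros\<close>)
    then show ?thesis by simp
  qed
  \<comment> \<open>The value 1 / (i + 1) is the reciprocal of the factor in the claim.\<close>
  have powr_int: "(\<integral>\<^sup>+c. ennreal (c powr - (2 + real i)) * indicator {1..} c \<partial>lborel) = ennreal (1 / real (Suc i))"
  proof -
    have "(\<integral>\<^sup>+c. ennreal (c powr - (2 + real i)) * indicator {1..} c \<partial>lborel)
      = ennreal (0 - (- (1 powr - (1 + real i)) / (1 + real i)))"
    proof (rule nn_integral_FTC_atLeast[where F = "\<lambda>c. - (c powr - (1 + real i)) / (1 + real i)"])
      show "((\<lambda>c. - (c powr - (1 + real i)) / (1 + real i)) \<longlongrightarrow> 0) at_top"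
        using tendsto_divide[OF tendsto_minus[OF tendsto_neg_powr[of "-(1+real i)" "\<lambda>x. x" at_top]] tendsto_const, of "1 + real i"]
        by (simp add: filterlim_ident)
      show "DERIV (\<lambda>c. - (c powr - (1 + real i)) / (1 + real i)) x :> x powr - (2 + real i)" if "1 \<le> x" for x
proof -
  have "DERIV (\<lambda>c. - (c powr - (1 + real i)) / (1 + real i)) x :> - (- (1 + real i) * x powr (- (1 + real i) - 1)) / (1 + real i)"
    using that by (intro DERIV_cdivide DERIV_minus has_real_derivative_powr) auto
  moreover have "- (- (1 + real i) * x powr (- (1 + real i) - 1)) / (1 + real i) = x powr - (2 + real i)"
  proof -
    have "- (1 + real i) - 1 = - (2 + real i)" "1 + real i \<noteq> 0" by auto
    then show ?thesis by (metis minus_mult_left minus_minus nonzero_mult_div_cancel_left)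
  qed
  ultimately show ?thesis by simp
qed
    qed auto
    then show ?thesis by simp
  qed
  have "(\<integral>\<^sup>+w. ennreal (cmod (w $ e) ^ (2 * i) * exp (- (cmod (w $ e))\<^sup>2)) * \<psi> w \<partial>lborel) =
    (\<integral>\<^sup>+w. (\<integral>\<^sup>+c. f c w * indicator {1..} c \<partial>lborel) \<partial>lborel)"
  proof (rule nn_integral_cong_AE)
    \<comment> \<open>At \<open>w $ e = 0\<close> the integral over c is 0 and the identity can
      fail. This set lies in the real hyperplane where the entry has real part 0, hence is
      null.\<close>
    have "{w::complex^'m. w $ e = 0} \<subseteq> {w. w \<bullet> axis e 1 = 0}"
      by (auto simp: inner_axis)
    moreover have "negligible {w::complex^'m. w \<bullet> axis e 1 = 0}"
      by (rule negligible_standard_hyperplane) (auto simp: Basis_vec_def Basis_complex_def)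
    ultimately have "negligible {w::complex^'m. w $ e = 0}"
      by (rule negligible_subset[rotated])
    then have "AE w in lebesgue. w \<notin> {w::complex^'m. w $ e = 0}"
      unfolding negligible_iff_null_sets by (rule AE_not_in)
    then have "AE w::complex^'m in lborel. w $ e \<noteq> 0"
      by (subst (asm) AE_completion_iff) auto
    then show "AE w::complex^'m in lborel. ennreal (cmod (w $ e) ^ (2 * i) * exp (- (cmod (w $ e))\<^sup>2)) * \<psi> w
        = (\<integral>\<^sup>+c. f c w * indicator {1..} c \<partial>lborel)"
    proof eventually_elim
      case (elim w)
      let ?q = "(cmod (w $ e))\<^sup>2"
      have "(\<integral>\<^sup>+c. f c w * indicator {1..} c \<partial>lborel)
        = (\<integral>\<^sup>+c. ennreal (cmod (w $ e) ^ (2 * i)) * \<psi> w * (ennreal (?q * exp (- c * ?q)) * indicator {1..} c) \<partial>lborel)"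
        unfolding f_def by (intro nn_integral_cong)
          (simp add: ennreal_mult[symmetric] mult_ac power_add power2_eq_square)
      also have "\<dots> = ennreal (cmod (w $ e) ^ (2 * i)) * \<psi> w * ennreal (exp (- ?q))"
        using elim exp_int[of ?q] by (subst nn_integral_cmult) auto
      finally show ?case
        by (simp add: ennreal_mult mult_ac)
    qed
  qed
  also have "\<dots> = (\<integral>\<^sup>+c. (\<integral>\<^sup>+w. f c w * indicator {1..} c \<partial>lborel) \<partial>lborel)"
    unfolding f_def by (rule lborel_pair.Fubini') measurable
  also have "\<dots> = (\<integral>\<^sup>+c. (ennreal (c powr - (2 + real i)) * indicator {1..} c) * (\<integral>\<^sup>+w. f 1 w \<partial>lborel) \<partial>lborel)"
  proof (rule nn_integral_cong)
    fix c :: real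
    show "(\<integral>\<^sup>+w. f c w * indicator {1..} c \<partial>lborel)
      = (ennreal (c powr - (2 + real i)) * indicator {1..} c) * (\<integral>\<^sup>+w. f 1 w \<partial>lborel)"
      using scale[of c] by (auto simp: indicator_def)
  qed
  also have "\<dots> = ennreal (1 / real (Suc i)) * (\<integral>\<^sup>+w. f 1 w \<partial>lborel)"
    using powr_int by (subst nn_integral_multc) auto
  finally have "ennreal (real (Suc i)) * (\<integral>\<^sup>+w. ennreal (cmod (w $ e) ^ (2 * i) * exp (- (cmod (w $ e))\<^sup>2)) * \<psi> w \<partial>lborel)
     = ennreal (real (Suc i)) * ennreal (1 / real (Suc i)) * (\<integral>\<^sup>+w. f 1 w \<partial>lborel)"
    by (simp only: mult.assoc)
  also have "ennreal (real (Suc i)) * ennreal (1 / real (Suc i)) = 1"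
    by (subst ennreal_mult'[symmetric]) auto
  finally show ?thesis by (simp add: f_def)
qed

section \<open>Moments by anisotropic dilations\<close>

definition block_scale :: "real \<Rightarrow> real \<Rightarrow> 'n::finite + 'k::finite \<Rightarrow> real"
  where "block_scale x y i = (case i of Inl a \<Rightarrow> x | Inr b \<Rightarrow> y)"

lemma block_scale_simps [simp]: "block_scale x y (Inl a) = x" "block_scale x y (Inr b) = y"
  by (simp_all add: block_scale_def)

lemma nsq_coord_scale:
  "nsq1 (coord_scale (block_scale x y) w) = x\<^sup>2 * nsq1 w"
  "nsq2 (coord_scale (block_scale x y) w) = y\<^sup>2 * nsq2 w"
  by (simp_all add: nsq1_def nsq2_def power_mult_distrib sum_distrib_left)

lemma prod_block_scale:
  "(\<Prod>i\<in>(UNIV :: ('n::finite + 'k::finite) set). (block_scale x y i)\<^sup>2) = (x\<^sup>2) ^ CARD('n) * (y\<^sup>2) ^ CARD('k)"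
  by (simp add: prod_UNIV_Plus)

definition mono2 :: "'n::finite \<Rightarrow> 'k::finite \<Rightarrow> nat \<Rightarrow> nat \<Rightarrow> complex^('n + 'k) \<Rightarrow> real"
  where "mono2 a b i j w = cmod (w $ Inl a) ^ (2 * i) * cmod (w $ Inr b) ^ (2 * j)"

lemma mono2_nonneg [simp]: "mono2 a b i j w \<ge> 0"
  by (simp add: mono2_def)

lemma continuous_mono2 [continuous_intros]: "continuous_on S (mono2 a b i j)"
  unfolding mono2_def[abs_def] by (intro continuous_intros)

lemma measurable_mono2 [measurable]: "mono2 a b i j \<in> borel_measurable borel"
  by (intro borel_measurable_continuous_onI continuous_intros)

lemma mono2_coord_scale:
  "x \<ge> 0 \<Longrightarrow> y \<ge> 0 \<Longrightarrow>
    mono2 a b i j (coord_scale (block_scale x y) w) = (x\<^sup>2) ^ i * (y\<^sup>2) ^ j * mono2 a b i j w"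
  by (simp add: mono2_def power_mult_distrib power_mult)

lemma power_mult_powr_power:
  "t > 0 \<Longrightarrow> t ^ i * (t powr (1 / p)) ^ j = t powr (real i + real j / p)" for t :: real
  by (simp add: powr_add powr_realpow powr_power)

text \<open>Scaling z by t^(1/2) and \<xi> by t^(1/(2 p)) multiplies |z|^2 + |\<xi>|^(2 p) by t. The
  moment has degree i + j/p and the Jacobian n + k/p, which together give the argument of
  Gamma.\<close>

lemma nn_moment_domain:
  fixes a :: "'n::finite" and b :: "'k::finite" and p :: real
  assumes p: "p > 0"
  shows "(\<integral>\<^sup>+w. ennreal (mono2 a b i j w) * ennreal (exp (- (nsq1 w + nsq2 w powr p))) \<partial>lborel) =
    ennreal (Gamma (real i + real CARD('n) + (real j + real CARD('k)) / p + 1)) *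
    (\<integral>\<^sup>+w. ennreal (mono2 a b i j w) * indicator {w. nsq1 w + nsq2 w powr p < 1} w \<partial>lborel)"
proof -
  let ?r = "\<lambda>t. block_scale (sqrt t) (sqrt (t powr (1 / p))) :: 'n + 'k \<Rightarrow> real"
  let ?a = "real i + real j / p" and ?b = "real CARD('n) + real CARD('k) / p"
  have "(\<integral>\<^sup>+w. ennreal (mono2 a b i j w) * ennreal (exp (- (nsq1 w + nsq2 w powr p))) \<partial>lborel) =
    ennreal (Gamma (?a + ?b + 1)) *
    (\<integral>\<^sup>+w. ennreal (mono2 a b i j w) * indicator {w. nsq1 w + nsq2 w powr p < 1} w \<partial>lborel)"
  proof (rule nn_integral_homogeneous_exp[where r = ?r])
    fix t :: real assume t: "t > 0"
    show "?r t l > 0" for l :: "'n + 'k"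
      using t by (cases l) auto
    show "(\<Prod>l\<in>UNIV. (?r t l)\<^sup>2) = t powr ?b"
      using t by (simp add: prod_block_scale power_mult_powr_power)
    show "ennreal (mono2 a b i j (coord_scale (?r t) w)) = ennreal (t powr ?a) * ennreal (mono2 a b i j w)" for w
      using t by (simp add: mono2_coord_scale power_mult_powr_power ennreal_mult'[symmetric])
    show "nsq1 (coord_scale (?r t) w) + nsq2 (coord_scale (?r t) w) powr p = t * (nsq1 w + nsq2 w powr p)" for w
      using t p by (simp add: nsq_coord_scale powr_mult powr_powr distrib_left)
  next
    show "?a + ?b + 1 > 0" using p by (auto intro!: add_nonneg_pos add_nonneg_nonneg)
  qed (auto)
  also have "?a + ?b + 1 = real i + real CARD('n) + (real j + real CARD('k)) / p + 1"
    by (simp add: add_divide_distrib)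
  finally show ?thesis .
qed

text \<open>Here exp (-|z|^2) counts as part of the integrand and only \<xi> is scaled. The region
  left on the right is |\<xi>| < 1 for every p, so this integral can be evaluated with p =
  1.\<close>

lemma nn_moment_cylinder:
  fixes a :: "'n::finite" and b :: "'k::finite" and p :: real
  assumes p: "p > 0"
  shows "(\<integral>\<^sup>+w. ennreal (mono2 a b i j w) * ennreal (exp (- (nsq1 w + nsq2 w powr p))) \<partial>lborel) =
    ennreal (Gamma ((real j + real CARD('k)) / p + 1)) *
    (\<integral>\<^sup>+w. ennreal (mono2 a b i j w * exp (- nsq1 w)) * indicator {w. nsq2 w < 1} w \<partial>lborel)"
proof -
  let ?r = "\<lambda>t. block_scale 1 (sqrt (t powr (1 / p))) :: 'n + 'k \<Rightarrow> real"
  let ?a = "real j / p" and ?b = "real CARD('k) / p"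
  have "(\<integral>\<^sup>+w. ennreal (mono2 a b i j w) * ennreal (exp (- (nsq1 w + nsq2 w powr p))) \<partial>lborel)
    = (\<integral>\<^sup>+w. ennreal (mono2 a b i j w * exp (- nsq1 w)) * ennreal (exp (- (nsq2 w powr p))) \<partial>lborel)"
    by (intro nn_integral_cong) (simp add: ennreal_mult'[symmetric] exp_diff exp_minus divide_inverse mult_ac)
  also have "\<dots> = ennreal (Gamma (?a + ?b + 1)) *
    (\<integral>\<^sup>+w. ennreal (mono2 a b i j w * exp (- nsq1 w)) * indicator {w. nsq2 w powr p < 1} w \<partial>lborel)"
  proof (rule nn_integral_homogeneous_exp[where r = ?r])
    fix t :: real assume t: "t > 0"
    show "?r t l > 0" for l :: "'n + 'k"
      using t by (cases l) auto
    show "(\<Prod>l\<in>UNIV. (?r t l)\<^sup>2) = t powr ?b"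
      using t power_mult_powr_power[of t 0 p "CARD('k)"] by (simp add: prod_block_scale)
    show "ennreal (mono2 a b i j (coord_scale (?r t) w) * exp (- nsq1 (coord_scale (?r t) w))) =
        ennreal (t powr ?a) * ennreal (mono2 a b i j w * exp (- nsq1 w))" for w
      using t power_mult_powr_power[of t 0 p j]
      by (simp add: mono2_coord_scale nsq_coord_scale ennreal_mult'[symmetric] mult.assoc)
    show "nsq2 (coord_scale (?r t) w) powr p = t * nsq2 w powr p" for w
      using t p by (simp add: nsq_coord_scale powr_mult powr_powr)
  next
    show "?a + ?b + 1 > 0" using p by (auto intro!: add_nonneg_pos add_nonneg_nonneg)
  qed (auto)
  also have "?a + ?b + 1 = (real j + real CARD('k)) / p + 1"
    by (simp add: add_divide_distrib)
  also have "{w :: complex^('n + 'k). nsq2 w powr p < 1} = {w. nsq2 w < 1}"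
    using p powr_less_mono2[OF p nsq_nonneg(2), of _ 1] 
    by (auto simp: not_less[symmetric]) (metis ge_one_powr_ge_zero less_imp_le not_le)
  finally show ?thesis .
qed

text \<open>The Gaussian weight is a product over the coordinates, so each exponent can be raised
  separately, at the cost of a factor i + 1 or j + 1.\<close>

lemma nn_moment_Gaussian:
  fixes a :: "'n::finite" and b :: "'k::finite"
  shows "(\<integral>\<^sup>+w. ennreal (mono2 a b i j w) * ennreal (exp (- (nsq1 w + nsq2 w))) \<partial>lborel) =
    ennreal (fact i * fact j) * (\<integral>\<^sup>+w. ennreal (mono2 a b 0 0 w) * ennreal (exp (- (nsq1 w + nsq2 w))) \<partial>lborel)"
    (is "?G i j = _ * ?G 0 0")
proof -
  define rest where "rest e w = (\<Sum>l\<in>UNIV-{e}. (cmod (w $ l))\<^sup>2)" for e and w :: "complex^('n + 'k)"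
  have sum_eq: "nsq1 w + nsq2 w = (cmod (w $ e))\<^sup>2 + rest e w" for e and w :: "complex^('n + 'k)"
    unfolding rest_def norm_square_eq_nsq[symmetric] norm_vec_square by (simp add: sum.remove[of _ e])
  have [measurable]: "(\<lambda>w::complex^('n + 'k). w $ e) \<in> borel_measurable borel" for e
    by (intro borel_measurable_continuous_onI continuous_intros)
  have [measurable]: "rest e \<in> borel_measurable borel" for e
    unfolding rest_def by (intro borel_measurable_continuous_onI continuous_intros)
  have rest_indep: "rest e (coord_scale r w) = rest e w" if "\<And>l. l \<noteq> e \<Longrightarrow> r l = 1" for e r w
    unfolding rest_def by (intro sum.cong) (auto simp: that)
  have i_step: "?G (Suc i) j = ennreal (real (Suc i)) * ?G i j" for i j
  proof -
    let ?psi = "\<lambda>w. ennreal (cmod (w $ Inr b) ^ (2 * j) * exp (- rest (Inl a) w))"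
    have G: "?G i j = (\<integral>\<^sup>+w. ennreal (cmod (w $ Inl a) ^ (2 * i) * exp (- (cmod (w $ Inl a))\<^sup>2)) * ?psi w \<partial>lborel)" for i
      unfolding sum_eq[of _ "Inl a"]
      by (intro nn_integral_cong) (simp add: mono2_def ennreal_mult'[symmetric] exp_diff exp_minus field_simps)
    show ?thesis unfolding G
      by (rule nn_integral_cmod_power_Gaussian_Suc) (auto simp: rest_indep)
  qed
  have j_step: "?G i (Suc j) = ennreal (real (Suc j)) * ?G i j" for i j
  proof -
    let ?psi = "\<lambda>w. ennreal (cmod (w $ Inl a) ^ (2 * i) * exp (- rest (Inr b) w))"
    have G: "?G i j = (\<integral>\<^sup>+w. ennreal (cmod (w $ Inr b) ^ (2 * j) * exp (- (cmod (w $ Inr b))\<^sup>2)) * ?psi w \<partial>lborel)" for j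
      unfolding sum_eq[of _ "Inr b"]
      by (intro nn_integral_cong) (simp add: mono2_def ennreal_mult'[symmetric] exp_diff exp_minus field_simps)
    show ?thesis unfolding G
      by (rule nn_integral_cmod_power_Gaussian_Suc) (auto simp: rest_indep)
  qed
  have A: "?G 0 j = ennreal (fact j) * ?G 0 0"
  proof (induction j)
    case (Suc j)
    show ?case unfolding j_step Suc.IH by (simp add: mult.assoc[symmetric] ennreal_mult'[symmetric] del: of_nat_Suc)
  qed simp
  have B: "?G i j = ennreal (fact i) * ?G 0 j"
  proof (induction i)
    case (Suc i)
    show ?case unfolding i_step Suc.IH by (simp add: mult.assoc[symmetric] ennreal_mult'[symmetric] del: of_nat_Suc)
  qed simp
  show ?thesis unfolding B A
    by (simp add: mult.assoc[symmetric] ennreal_mult'[symmetric])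
qed

text \<open>The domain is compared with the cylinder at the given p, the cylinder with the Gaussian
  at p = 1. All dependence on i and j is then in Gamma factors and factorials; the single constant
  left is the integral h of exp (-|z|^2) over |\<xi>| < 1.\<close>

lemma moments_E:
  fixes p :: real
  assumes p: "p > 0"
  obtains \<kappa> :: real where "\<kappa> > 0"
    "\<And>(a::'n::finite) (b::'k::finite) i j. (LINT w:E p|lborel. mono2 a b i j w) =
       fact i * fact j * Gamma ((real j + real CARD('k)) / p + 1) /
       (\<kappa> * fact (j + CARD('k)) * Gamma (real i + real CARD('n) + (real j + real CARD('k)) / p + 1))"
proof -
  let ?n = "real CARD('n)" and ?k = "real CARD('k)"
  define N where "N a b i j = (\<integral>\<^sup>+w. ennreal (mono2 a b i j w) * indicator (E p) w \<partial>lborel)" for a :: 'n and b :: 'k and i j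
  define H where "H a b i j = (\<integral>\<^sup>+w. ennreal (mono2 a b i j w * exp (- nsq1 w)) * indicator {w. nsq2 w < 1} w \<partial>lborel)"
    for a :: 'n and b :: 'k and i j
  define h where "h = (\<integral>\<^sup>+w. ennreal (exp (- nsq1 w)) * indicator {w :: complex^('n + 'k). nsq2 w < 1} w \<partial>lborel)"
  have h: "H a b 0 0 = h" for a b by (simp add: h_def H_def mono2_def)
  have E: "{w. nsq1 w + nsq2 w powr p < 1} = (E p :: (complex^('n + 'k)) set)" by (auto simp: E_iff)
  have Gpos: "Gamma (real i + ?n + (real j + ?k) / p + 1) > 0" "Gamma ((real j + ?k) / p + 1) > 0" for i j
    using p by (auto intro!: Gamma_real_pos add_nonneg_pos divide_nonneg_pos)
  have NH: "ennreal (Gamma (real i + ?n + (real j + ?k) / p + 1)) * N a b i j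
      = ennreal (Gamma ((real j + ?k) / p + 1)) * H a b i j" for a b i j
    using nn_moment_domain[OF p, of a b i j] nn_moment_cylinder[OF p, of a b i j]
    by (simp add: N_def H_def E)
  have HG: "ennreal (fact (j + CARD('k))) * H a b i j = ennreal (fact i * fact j * fact CARD('k)) * h" for a b i j
  proof -
    have G: "(\<integral>\<^sup>+w. ennreal (mono2 a b i j w) * ennreal (exp (- (nsq1 w + nsq2 w))) \<partial>lborel)
      = ennreal (fact (j + CARD('k))) * H a b i j" for i j
      using nn_moment_cylinder[of 1 a b i j] Gamma_fact[where 'a = real and n = "j + CARD('k)"]
      by (simp add: H_def add_ac)
    show ?thesis
      using nn_moment_Gaussian[of a b i j] unfolding G h[of a b, symmetric]
      by (simp add: mult.assoc[symmetric] ennreal_mult'[symmetric])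
  qed
  have opn: "open (E p :: (complex^('n + 'k)) set)" by (rule open_E[OF p])
  have fin: "emeasure lborel (E p :: (complex^('n + 'k)) set) < \<infinity>"
    using emeasure_bounded_finite[OF bounded_E[OF p, where 'n='n and 'k='k]] by simp
  have Nle: "N a b i j \<le> emeasure lborel (E p :: (complex^('n + 'k)) set)" for a b i j
  proof -
    have "N a b i j \<le> (\<integral>\<^sup>+w. indicator (E p :: (complex^('n + 'k)) set) w \<partial>lborel)"
      unfolding N_def
    proof (intro nn_integral_mono)
      fix w :: "complex^('n + 'k)"
      show "ennreal (mono2 a b i j w) * indicator (E p) w \<le> indicator (E p) w"
      proof (cases "w \<in> E p")
        case True
        then have "mono2 a b i j w \<le> 1"
          unfolding mono2_def using E_bounds(3)[OF p True]
          by (intro mult_le_one power_le_one) (auto simp: less_imp_le)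
        then show ?thesis using True by simp
      qed simp
    qed
    also have "\<dots> = emeasure lborel (E p :: (complex^('n + 'k)) set)" using opn by simp
    finally show ?thesis .
  qed
  have N00: "N a b 0 0 = emeasure lborel (E p :: (complex^('n + 'k)) set)" for a b
    using opn by (simp add: N_def mono2_def)
  have pos: "emeasure lborel (E p :: (complex^('n + 'k)) set) > 0"
  proof -
    obtain e where e: "e > 0" "ball (0 :: complex^('n + 'k)) e \<subseteq> E p"
      using opn zero_in_E[OF p] by (meson open_contains_ball)
    have "0 < emeasure lborel (ball (0 :: complex^('n + 'k)) e)"
      using content_ball_pos[OF e(1), of "0 :: complex^('n + 'k)"]
      by (simp add: measure_def enn2real_positive_iff)
    also have "\<dots> \<le> emeasure lborel (E p :: (complex^('n + 'k)) set)"
      using e(2) opn by (intro emeasure_mono) auto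
    finally show ?thesis .
  qed
  \<comment> \<open>For i = j = 0 the comparison expresses h through the volume of
    \<open>E p\<close>, which is finite since \<open>E p\<close> is bounded and positive since it is
    open and contains 0.\<close>
  have hfin: "h < \<infinity>" "h > 0"
  proof -
    fix a b
    have *: "ennreal (Gamma (?n + ?k / p + 1)) * emeasure lborel (E p :: (complex^('n + 'k)) set)
      = ennreal (Gamma (?k / p + 1)) * h"
      using NH[of 0 0 a b] by (simp add: N00 h)
    show "h > 0"
    proof (rule ccontr)
      assume "\<not> h > 0"
      then have "h = 0" by simp
      with * pos Gpos(1)[of 0 0] show False by (simp add: not_le[symmetric])
    qed
    have "ennreal (Gamma (?k / p + 1)) * h < \<infinity>"
      unfolding *[symmetric] using fin by (simp add: ennreal_mult_less_top)
    then show "h < \<infinity>"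
      using Gpos(2)[of 0] by (auto simp: ennreal_mult_less_top)
  qed
  \<comment> \<open>By the cylinder comparison at p = 1 with i = j = 0, h times k! is the full
    Gaussian integral; \<kappa> is its reciprocal.\<close>
  define \<kappa> where "\<kappa> = 1 / (enn2real h * fact CARD('k))"
  have hreal: "h = ennreal (enn2real h)" "enn2real h > 0"
    using hfin by (auto simp: enn2real_positive_iff less_top)
  show thesis
  proof (rule that[of \<kappa>])
    show "\<kappa> > 0" using hreal by (simp add: \<kappa>_def)
    fix a :: 'n and b :: 'k and i j
    define x where "x = enn2real (N a b i j)"
    have Nx: "N a b i j = ennreal x" "x \<ge> 0"
      using le_less_trans[OF Nle[of a b i j] fin] by (simp_all add: x_def)
    have x: "(LINT w:E p|lborel. mono2 a b i j w) = x"
    proof -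
      have [measurable]: "E p \<in> sets (borel :: (complex^('n + 'k)) measure)" using opn by simp
      have "(\<integral>w. indicator (E p) w *\<^sub>R mono2 a b i j w \<partial>lborel)
        = enn2real (\<integral>\<^sup>+w. ennreal (indicator (E p) w *\<^sub>R mono2 a b i j w) \<partial>lborel)"
        by (rule integral_eq_nn_integral) auto
      also have "(\<integral>\<^sup>+w. ennreal (indicator (E p) w *\<^sub>R mono2 a b i j w) \<partial>lborel) = N a b i j"
        unfolding N_def by (intro nn_integral_cong) (auto simp: indicator_def)
      finally show ?thesis by (simp add: x_def set_lebesgue_integral_def)
    qed
    define F G1 G2 hr where "F = (fact (j + CARD('k)) :: real)"
      and "G1 = Gamma (real i + ?n + (real j + ?k) / p + 1)"
      and "G2 = Gamma ((real j + ?k) / p + 1)" and "hr = enn2real h"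
    have pos': "F > 0" "G1 > 0" "G2 > 0" "hr > 0"
      using Gpos(1)[of i j] Gpos(2)[of j] hreal(2) by (simp_all add: F_def G1_def G2_def hr_def)
    have h_hr: "h = ennreal hr" using hreal(1) by (simp add: hr_def)
    have eq1: "ennreal G1 * ennreal x = ennreal G2 * H a b i j"
      using NH[of i j a b] by (simp only: Nx(1) G1_def G2_def)
    have eq2: "ennreal F * H a b i j = ennreal (fact i * fact j * fact CARD('k)) * ennreal hr"
      using HG[of j a b i] by (simp only: F_def h_hr)
    have "ennreal (F * (G1 * x)) = ennreal F * (ennreal G1 * ennreal x)"
      using pos' Nx(2) by (simp add: ennreal_mult)
    also have "\<dots> = ennreal G2 * (ennreal F * H a b i j)"
      unfolding eq1 by (rule mult.left_commute)
    also have "\<dots> = ennreal (G2 * (fact i * fact j * fact CARD('k) * hr))"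
      unfolding eq2 using pos' by (simp add: ennreal_mult)
    finally have *: "F * (G1 * x) = G2 * (fact i * fact j * fact CARD('k) * hr)"
      using pos' Nx(2) by (subst (asm) ennreal_inj) auto
    have "x = fact i * fact j * G2 / (\<kappa> * F * G1)"
      using * pos' by (simp add: \<kappa>_def hr_def[symmetric] field_simps)
    then show "(LINT w:E p|lborel. mono2 a b i j w) =
       fact i * fact j * Gamma ((real j + real CARD('k)) / p + 1) /
       (\<kappa> * fact (j + CARD('k)) * Gamma (real i + real CARD('n) + (real j + real CARD('k)) / p + 1))"
      unfolding x F_def G1_def G2_def .
  qed
qed

section \<open>Taylor coefficients\<close>

definition taylor_coeff :: "(complex \<Rightarrow> complex) \<Rightarrow> nat \<Rightarrow> complex"
  where "taylor_coeff g j = (deriv ^^ j) g 0 / fact j"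

lemma taylor_coeff_sums:
  assumes "g holomorphic_on ball 0 R" "z \<in> ball 0 R"
  shows "(\<lambda>j. taylor_coeff g j * z ^ j) sums g z"
  using holomorphic_power_series[OF assms] by (simp add: taylor_coeff_def)

lemma taylor_coeff_contour:
  assumes "g holomorphic_on ball 0 R" "0 < r" "r < R"
  shows "((\<lambda>u. g u / u ^ Suc j) has_contour_integral 2 * pi * \<i> * taylor_coeff g j) (circlepath 0 r)"
proof -
  have "((\<lambda>u. g u / (u - 0) ^ Suc j) has_contour_integral (2 * pi * \<i>) / fact j * (deriv ^^ j) g 0) (circlepath 0 r)"
  proof (rule Cauchy_has_contour_integral_higher_derivative_circlepath)
    have "cball 0 r \<subseteq> ball (0::complex) R" using assms by auto
    then show "continuous_on (cball 0 r) g"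
      using assms(1) holomorphic_on_imp_continuous_on continuous_on_subset by blast
    show "g holomorphic_on ball 0 r"
      using assms by (auto intro: holomorphic_on_subset)
  qed (use assms in auto)
  then show ?thesis by (simp add: taylor_coeff_def)
qed

text \<open>Cauchy's formula on the unit circle for u \<mapsto> g (z u), whose j-th coefficient is
  that of g times z^j; on this circle the conjugate of \<open>cis t\<close> is its inverse.\<close>

lemma taylor_coeff_average:
  assumes g: "g holomorphic_on ball 0 R" and z: "z \<in> ball 0 R"
  shows "((\<lambda>t. g (cis t * z) * cnj (cis t) ^ j) has_integral 2 * pi * (taylor_coeff g j * z ^ j)) {0..2 * pi}"
proof -
  \<comment> \<open>Q is the radius of the u-disc on which z u stays in the domain of g; for z = 0
    any number above 1 serves, and 2 is taken.\<close>
  define Q :: real where "Q = (if z = 0 then 2 else R / norm z)"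
  have R: "R > 0" using z le_less_trans[OF norm_ge_zero] by auto
  have Q: "Q > 1" using z by (auto simp: Q_def)
  have sub: "z * u \<in> ball 0 R" if "u \<in> ball 0 Q" for u
    using that R by (auto simp: Q_def norm_mult field_simps split: if_splits)
  have hol: "(\<lambda>u. g (z * u)) holomorphic_on ball 0 Q"
    using sub by (intro holomorphic_on_compose_gen[OF _ g, of "\<lambda>u. z * u", unfolded o_def])
      (auto intro!: holomorphic_intros)
  have coeff: "taylor_coeff (\<lambda>u. g (z * u)) j = taylor_coeff g j * z ^ j"
    using higher_deriv_compose_linear[OF g, where S = "ball 0 Q" and u = z and z = 0 and n = j] sub Q
    by (simp add: taylor_coeff_def)
  have "((\<lambda>u. g (z * u) / u ^ Suc j) has_contour_integral 2 * pi * \<i> * (taylor_coeff g j * z ^ j)) (circlepath 0 1)"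
    using taylor_coeff_contour[OF hol, of 1 j] Q by (simp add: coeff)
  then have "((\<lambda>t. g (z * cis t) / cis t ^ Suc j * \<i> * cis t) has_integral
      2 * pi * \<i> * (taylor_coeff g j * z ^ j)) {0..2 * pi}"
    unfolding circlepath_def by (subst (asm) has_contour_integral_part_circlepath_iff) auto
  then have "((\<lambda>t. inverse \<i> * (g (z * cis t) / cis t ^ Suc j * \<i> * cis t)) has_integral
      inverse \<i> * (2 * pi * \<i> * (taylor_coeff g j * z ^ j))) {0..2 * pi}"
    by (rule has_integral_mult_right)
  moreover have "inverse \<i> * (g (z * cis t) / cis t ^ Suc j * \<i> * cis t) = g (cis t * z) * cnj (cis t) ^ j" for t
  proof -
    have "cnj (cis t) ^ j = inverse (cis t ^ j)" by (simp add: cis_cnj power_inverse flip: cis_inverse)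
    then show ?thesis by (simp only:) (simp add: field_simps)
  qed
  moreover have "inverse \<i> * (2 * pi * \<i> * (taylor_coeff g j * z ^ j)) = 2 * pi * (taylor_coeff g j * z ^ j)"
    by (simp add: field_simps)
  ultimately show ?thesis by (simp only:)
qed

text \<open>Continuous, separately holomorphic functions on a Hartogs domain. Since r is antitone,
  the fibre over the rim of a disc |z| \<le> \<rho> is contained in every fibre over that disc, so
  one circle in \<xi> works for all these z.\<close>

locale two_variable_holomorphic =
  fixes \<phi> :: "complex \<Rightarrow> complex \<Rightarrow> complex" and r :: "real \<Rightarrow> real"
  assumes r_pos: "\<And>x. 0 \<le> x \<Longrightarrow> x < 1 \<Longrightarrow> 0 < r x"
    and r_antimono: "\<And>x y. 0 \<le> x \<Longrightarrow> x \<le> y \<Longrightarrow> y < 1 \<Longrightarrow> r y \<le> r x"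
    and cont: "continuous_on {(z, \<xi>). norm z < 1 \<and> norm \<xi> < r (norm z)} (\<lambda>(z, \<xi>). \<phi> z \<xi>)"
    and hol_fst: "\<And>z \<xi>. norm z < 1 \<Longrightarrow> norm \<xi> < r (norm z) \<Longrightarrow> (\<lambda>z. \<phi> z \<xi>) field_differentiable at z"
    and hol_snd: "\<And>z. norm z < 1 \<Longrightarrow> \<phi> z holomorphic_on ball 0 (r (norm z))"
begin

lemma cont_compose:
  assumes "continuous_on S f" "continuous_on S g"
    "\<And>x. x \<in> S \<Longrightarrow> norm (f x) < 1" "\<And>x. x \<in> S \<Longrightarrow> norm (g x) < r (norm (f x))"
  shows "continuous_on S (\<lambda>x. \<phi> (f x) (g x))"
  using continuous_on_compose2[OF cont, of S "\<lambda>x. (f x, g x)"] assms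
  by (auto simp: continuous_on_Pair)

text \<open>Near a given point the coefficient is a contour integral in \<xi> over a circle
  independent of z. Exchanging it with the Cauchy integral in z shows that the coefficient itself
  satisfies Cauchy's formula, and a Cauchy integral with continuous density is
  differentiable.\<close>

lemma coeff_holomorphic: "(\<lambda>z. taylor_coeff (\<phi> z) j) holomorphic_on ball 0 1"
proof -
  define c where "c z = taylor_coeff (\<phi> z) j" for z
  have "c field_differentiable at z0" if z0: "z0 \<in> ball 0 1" for z0
  proof -
    \<comment> \<open>\<rho> lies halfway between |z0| and 1, and t is below r \<rho>, so the circle
      |\<xi>| = t lies in the fibre over each |z| \<le> \<rho>.\<close>
    define \<rho> where "\<rho> = (1 + norm z0) / 2"
    define t where "t = r \<rho> / 2"
    have \<rho>: "norm z0 < \<rho>" "0 < \<rho>" "\<rho> < 1" using z0 norm_ge_zero[of z0] unfolding \<rho>_def by (auto simp del: norm_ge_zero)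
    have t: "0 < t" using r_pos[of \<rho>] \<rho> by (simp add: t_def)
    have t_less: "t < r (norm z)" if "norm z \<le> \<rho>" for z :: complex
      using r_antimono[of "norm z" \<rho>] that \<rho> t by (simp add: t_def)
    have c_int: "((\<lambda>\<xi>. \<phi> z \<xi> / \<xi> ^ Suc j) has_contour_integral 2 * pi * \<i> * c z) (circlepath 0 t)"
      if "norm z \<le> \<rho>" for z
      unfolding c_def using that \<rho> t t_less by (intro taylor_coeff_contour[OF hol_snd]) auto
    \<comment> \<open>Continuity in z comes from the averaged form of the coefficient, an ordinary
      integral depending continuously on a parameter.\<close>
    have c_cont: "continuous_on (cball 0 \<rho>) c"
    proof -
      have "continuous_on (cball 0 \<rho>) (\<lambda>z. integral (cbox 0 (2 * pi)) (\<lambda>s. \<phi> z (cis s * t) * cnj (cis s) ^ j))"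
        using \<rho> t t_less
        by (intro integral_continuous_on_param) (auto simp: split_beta norm_mult intro!: cont_compose continuous_intros)
      moreover have "integral (cbox 0 (2 * pi)) (\<lambda>s. \<phi> z (cis s * t) * cnj (cis s) ^ j) = 2 * pi * (c z * of_real t ^ j)"
        if "z \<in> cball 0 \<rho>" for z
        using that \<rho> t t_less taylor_coeff_average[OF hol_snd[of z], of "of_real t" j]
        by (intro integral_unique) (auto simp: c_def)
      ultimately have "continuous_on (cball 0 \<rho>) (\<lambda>z. 2 * pi * (c z * of_real t ^ j))"
        by (rule continuous_on_eq)
      then have "continuous_on (cball 0 \<rho>) (\<lambda>z. inverse (2 * pi * of_real t ^ j) * (2 * pi * (c z * of_real t ^ j)))"
        by (rule continuous_on_mult_left)
      also have "(\<lambda>z. inverse (2 * pi * of_real t ^ j) * (2 * pi * (c z * of_real t ^ j))) = c"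
        using t by (auto simp: fun_eq_iff field_simps)
      finally show ?thesis .
    qed
    \<comment> \<open>The exponent 1 is kept because
      \<open>Cauchy_next_derivative_circlepath\<close> passes from one power of the denominator to
      the next.\<close>
    have z_int: "((\<lambda>u. c u / (u - z) ^ 1) has_contour_integral 2 * pi * \<i> * c z) (circlepath 0 \<rho>)"
      if z: "z \<in> ball 0 \<rho>" for z
    proof -
      define F where "F u \<xi> = \<phi> u \<xi> / \<xi> ^ Suc j / (u - z)" for u \<xi>
      have ne: "u \<noteq> z" if "norm u = \<rho>" for u using that z by auto
      have F_cont: "continuous_on (path_image (circlepath 0 \<rho>) \<times> path_image (circlepath 0 t)) (\<lambda>(u, \<xi>). F u \<xi>)"
        unfolding F_def split_beta using \<rho> t t_less ne
        by (intro continuous_intros cont_compose) (auto simp: dist_norm)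
      have inner1: "contour_integral (circlepath 0 t) (F u) = 2 * pi * \<i> * c u / (u - z)" if "norm u = \<rho>" for u
        unfolding F_def using c_int[of u] that
        by (intro contour_integral_unique has_contour_integral_div) auto
      have inner2: "contour_integral (circlepath 0 \<rho>) (\<lambda>u. F u \<xi>) = 2 * pi * \<i> * (\<phi> z \<xi> / \<xi> ^ Suc j)" if "norm \<xi> = t" for \<xi>
      proof -
        have fd: "(\<lambda>u. \<phi> u \<xi>) field_differentiable at u" if "norm u \<le> \<rho>" for u
          using that \<rho> t_less[of u] \<open>norm \<xi> = t\<close> by (intro hol_fst) auto
        have "((\<lambda>u. \<phi> u \<xi> / (u - z)) has_contour_integral (2 * pi * \<i> * \<phi> z \<xi>)) (circlepath 0 \<rho>)"
          unfolding of_real_mult of_real_numeral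
        proof (rule Cauchy_integral_circlepath)
          show "continuous_on (cball 0 \<rho>) (\<lambda>u. \<phi> u \<xi>)"
            using fd by (intro continuous_at_imp_continuous_on ballI field_differentiable_imp_continuous_at) auto
          show "(\<lambda>u. \<phi> u \<xi>) holomorphic_on ball 0 \<rho>"
            using fd by (auto simp: holomorphic_on_def intro: field_differentiable_at_within)
          show "cmod (z - 0) < \<rho>" using z by simp
        qed
        then have "((\<lambda>u. \<phi> u \<xi> / (u - z) / \<xi> ^ Suc j) has_contour_integral (2 * pi * \<i> * \<phi> z \<xi>) / \<xi> ^ Suc j) (circlepath 0 \<rho>)"
          by (rule has_contour_integral_div)
        then show ?thesis
          unfolding F_def by (intro contour_integral_unique) (simp add: divide_divide_eq_left mult.commute mult.left_commute)
      qed
      have "contour_integral (circlepath 0 \<rho>) (\<lambda>u. contour_integral (circlepath 0 t) (F u))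
        = contour_integral (circlepath 0 t) (\<lambda>\<xi>. contour_integral (circlepath 0 \<rho>) (\<lambda>u. F u \<xi>))"
        by (rule contour_integral_swap[OF F_cont])
           (auto simp: vector_derivative_circlepath intro!: continuous_intros)
      also have "\<dots> = contour_integral (circlepath 0 t) (\<lambda>\<xi>. 2 * pi * \<i> * (\<phi> z \<xi> / \<xi> ^ Suc j))"
        using t by (intro contour_integral_eq) (auto simp: inner2)
      also have "\<dots> = 2 * pi * \<i> * (2 * pi * \<i> * c z)"
        using c_int[of z] z by (intro contour_integral_unique has_contour_integral_lmul) auto
      also have "contour_integral (circlepath 0 \<rho>) (\<lambda>u. contour_integral (circlepath 0 t) (F u))
        = contour_integral (circlepath 0 \<rho>) (\<lambda>u. 2 * pi * \<i> * (c u / (u - z)))"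
        using \<rho> by (intro contour_integral_eq) (auto simp: inner1)
      finally have eq: "contour_integral (circlepath 0 \<rho>) (\<lambda>u. 2 * pi * \<i> * (c u / (u - z))) = 2 * pi * \<i> * (2 * pi * \<i> * c z)" .
      have "continuous_on (path_image (circlepath 0 \<rho>)) (\<lambda>u. c u / (u - z))"
        using \<rho> ne by (intro continuous_intros continuous_on_subset[OF c_cont]) auto
      then have "(\<lambda>u. c u / (u - z)) contour_integrable_on circlepath 0 \<rho>"
        by (rule contour_integrable_continuous_circlepath)
      then obtain L where L: "((\<lambda>u. c u / (u - z)) has_contour_integral L) (circlepath 0 \<rho>)"
        by (auto simp: contour_integrable_on_def)
      have "2 * pi * \<i> * L = 2 * pi * \<i> * (2 * pi * \<i> * c z)"
        using contour_integral_unique[OF has_contour_integral_lmul[OF L, of "2 * pi * \<i>"]] eq by simp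
      then have "L = 2 * pi * \<i> * c z" by simp
      with L show ?thesis by simp
    qed
    have "((\<lambda>z. 2 * pi * \<i> * c z) has_field_derivative
        (of_nat 1 * contour_integral (circlepath 0 \<rho>) (\<lambda>u. c u / (u - z0) ^ Suc 1))) (at z0)"
      using \<rho> z_int by (intro Cauchy_next_derivative_circlepath continuous_on_subset[OF c_cont]) auto
    then have "((\<lambda>z. inverse (2 * pi * \<i>) * (2 * pi * \<i> * c z)) has_field_derivative
        inverse (2 * pi * \<i>) * (of_nat 1 * contour_integral (circlepath 0 \<rho>) (\<lambda>u. c u / (u - z0) ^ Suc 1))) (at z0)"
      by (rule DERIV_cmult)
    then show ?thesis unfolding field_differentiable_def by (auto simp: field_simps)
  qed
  then show ?thesis
    unfolding holomorphic_on_def c_def by (auto intro: field_differentiable_at_within)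
qed

definition coeff2 :: "nat \<Rightarrow> nat \<Rightarrow> complex"
  where "coeff2 i j = taylor_coeff (\<lambda>z. taylor_coeff (\<phi> z) j) i"

end

section \<open>The kernel series\<close>

definition hprod :: "complex^'m::finite \<Rightarrow> complex^'m \<Rightarrow> complex"
  where "hprod z w = (\<Sum>i\<in>UNIV. z $ i * cnj (w $ i))"

lemma hprod_add_left: "hprod (x + y) w = hprod x w + hprod y w"
  by (simp add: hprod_def sum.distrib distrib_right)

lemma hprod_scale_left: "hprod (c *s x) w = c * hprod x w"
  by (simp add: hprod_def sum_distrib_left mult.assoc)

lemma hprod_cnj: "cnj (hprod x y) = hprod y x"
  by (simp add: hprod_def mult.commute)

lemma hprod_diff_left: "hprod (x - y) w = hprod x w - hprod y w"
  by (simp add: hprod_def sum_subtractf left_diff_distrib)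

lemma hprod_diff_right: "hprod w (x - y) = hprod w x - hprod w y"
  by (simp add: hprod_def sum_subtractf right_diff_distrib)

lemma hprod_scale_right: "hprod x (c *s y) = cnj c * hprod x y"
  by (simp add: hprod_def sum_distrib_left mult_ac)

lemma hprod_self: "hprod x x = of_real ((norm x)\<^sup>2)"
  by (simp add: hprod_def norm_vec_square flip: complex_norm_square)

lemma hprod_axis: "hprod x (axis a c) = x $ a * cnj c"
proof -
  have "hprod x (axis a c) = (\<Sum>i\<in>UNIV. if i = a then x $ a * cnj c else 0)"
    unfolding hprod_def by (intro sum.cong) (auto simp: axis_def)
  then show ?thesis by simp
qed

lemma norm_hprod_le: "norm (hprod x y) \<le> norm x * norm y"
proof -
  have "norm (hprod x y) \<le> (\<Sum>i\<in>UNIV. norm (x $ i) * norm (y $ i))"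
    unfolding hprod_def by (rule order.trans[OF norm_sum]) (simp add: norm_mult)
  also have "\<dots> \<le> norm x * norm y"
    using L2_set_mult_ineq[of "\<lambda>i. norm (x $ i)" "\<lambda>i. norm (y $ i)" UNIV]
    by (simp add: norm_vec_def)
  finally show ?thesis .
qed

text \<open>The complex Householder reflection in the hyperplane orthogonal to x, a unitary
  involution; for x = 0 it is the identity.\<close>

definition reflect :: "complex^'m::finite \<Rightarrow> complex^'m \<Rightarrow> complex^'m"
  where "reflect x z = z - (2 * hprod z x / hprod x x) *s x"

lemma reflect_add: "reflect x (y + z) = reflect x y + reflect x z"
  by (simp add: reflect_def hprod_add_left vec_eq_iff add_divide_distrib algebra_simps)

lemma reflect_scale: "reflect x (c *s z) = c *s reflect x z"
  by (simp add: reflect_def hprod_scale_left vec_eq_iff algebra_simps)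

lemma hprod_reflect: "hprod (reflect x y) (reflect x z) = hprod y z"
proof (cases "x = 0")
  case False
  define s where "s = hprod x x"
  have s: "s \<noteq> 0" "cnj s = s" using False by (auto simp: s_def hprod_self)
  have "hprod (reflect x y) (reflect x z) = hprod y z - cnj (2 * hprod z x / s) * hprod y x
      - 2 * hprod y x / s * hprod x z + (2 * hprod y x / s) * cnj (2 * hprod z x / s) * s"
    by (simp add: reflect_def hprod_diff_left hprod_diff_right hprod_scale_left hprod_scale_right
        s_def[symmetric] algebra_simps)
  also have "\<dots> = hprod y z"
    using s by (simp add: hprod_cnj field_simps)
  finally show ?thesis .
qed (simp add: reflect_def)

lemma reflect_reflect: "reflect x (reflect x z) = z"
proof (cases "x = 0")
  case False
  then have s: "hprod x x \<noteq> 0" by (simp add: hprod_self)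
  then have "hprod (reflect x z) x = - hprod z x"
    by (simp add: reflect_def hprod_diff_left hprod_scale_left)
  then show ?thesis
    by (simp add: reflect_def[of x "reflect x z"]) (simp add: reflect_def)
qed (simp add: reflect_def)

text \<open>Reflecting along u - v exchanges u and v when both have the same norm and their
  Hermitian product is real. The target v on the a-axis is given the phase of the a-th entry of u,
  which makes that product real.\<close>

lemma reflect_to_axis:
  fixes u :: "complex^'m::finite"
  obtains x where "\<And>i. i \<noteq> a \<Longrightarrow> reflect x u $ i = 0"
proof -
  \<comment> \<open>If the a-th entry vanishes, the product of u with v is 0 in any case, and the
    phase is set to 1.\<close>
  define \<omega> where "\<omega> = (if u $ a = 0 then 1 else u $ a / of_real (norm (u $ a)))"
  define v where "v = axis a (\<omega> * of_real (norm u))"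
  define x where "x = u - v"
  have \<omega>: "norm \<omega> = 1" by (simp add: \<omega>_def norm_divide)
  have vv: "hprod v v = of_real ((norm u)\<^sup>2)"
  proof -
    have "hprod v v = \<omega> * cnj \<omega> * (of_real (norm u) * of_real (norm u))"
      by (simp add: v_def hprod_axis)
    also have "\<omega> * cnj \<omega> = 1" using \<omega> by (metis complex_norm_square of_real_1 one_power2)
    finally show ?thesis by (simp add: power2_eq_square)
  qed
  have uv: "hprod u v = of_real (norm (u $ a) * norm u)"
    by (auto simp: v_def hprod_axis \<omega>_def complex_norm_square[symmetric] power2_eq_square)
  have vu: "hprod v u = of_real (norm (u $ a) * norm u)"
    using arg_cong[OF uv, of cnj] by (simp add: hprod_cnj)
  \<comment> \<open>As u and v have equal norms and a real product, the product of u with x is half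
    that of x with itself, so the coefficient in the reflection is 1.\<close>
  define t where "t = (norm u)\<^sup>2 - norm (u $ a) * norm u"
  have ux: "hprod u x = of_real t"
    unfolding x_def by (simp add: hprod_diff_right uv hprod_self t_def)
  have xx: "hprod x x = of_real (2 * t)"
  proof -
    have "hprod x x = (hprod u u - hprod v u) - (hprod u v - hprod v v)"
      unfolding x_def by (simp only: hprod_diff_left hprod_diff_right)
    then show ?thesis unfolding uv vu vv hprod_self[of u] by (simp add: t_def)
  qed
  have "reflect x u = v"
  proof (cases "x = 0")
    case True
    then show ?thesis by (simp add: reflect_def x_def)
  next
    case False
    then have "hprod x x \<noteq> 0" by (simp add: hprod_self)
    then have "2 * hprod u x / hprod x x = 1" unfolding ux xx by simp
    then show ?thesis by (simp add: reflect_def x_def)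
  qed
  then have "reflect x u $ i = 0" if "i \<noteq> a" for i
    using that by (simp add: v_def axis_def)
  then show thesis by (rule that)
qed

definition lpart :: "complex^('n::finite + 'k::finite) \<Rightarrow> complex^'n"
  where "lpart w = (\<chi> a. w $ Inl a)"

definition rpart :: "complex^('n::finite + 'k::finite) \<Rightarrow> complex^'k"
  where "rpart w = (\<chi> b. w $ Inr b)"

lemma lpart_nth [simp]: "lpart w $ a = w $ Inl a" by (simp add: lpart_def)
lemma rpart_nth [simp]: "rpart w $ b = w $ Inr b" by (simp add: rpart_def)
lemma join_nth [simp]: "join z \<xi> $ Inl a = z $ a" "join z \<xi> $ Inr b = \<xi> $ b"
  by (simp_all add: join_def)
lemma lpart_join [simp]: "lpart (join z \<xi>) = z" by (simp add: vec_eq_iff)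
lemma rpart_join [simp]: "rpart (join z \<xi>) = \<xi>" by (simp add: vec_eq_iff)

lemma join_parts [simp]: "join (lpart w) (rpart w) = w"
  by (simp add: vec_eq_iff join_def split: sum.split)

lemma nsq_eq_norm: "nsq1 w = (norm (lpart w))\<^sup>2" "nsq2 w = (norm (rpart w))\<^sup>2"
  by (simp_all add: nsq1_def nsq2_def norm_vec_square)

definition herm1 :: "complex^('n::finite + 'k::finite) \<Rightarrow> complex^('n + 'k) \<Rightarrow> complex"
  where "herm1 z w = hprod (lpart z) (lpart w)"

definition herm2 :: "complex^('n::finite + 'k::finite) \<Rightarrow> complex^('n + 'k) \<Rightarrow> complex"
  where "herm2 z w = hprod (rpart z) (rpart w)"

lemma herm_self: "herm1 w w = of_real (nsq1 w)" "herm2 w w = of_real (nsq2 w)"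
  by (simp_all add: herm1_def herm2_def hprod_self nsq_eq_norm)

lemma norm_herm_le: "norm (herm1 z w) \<le> sqrt (nsq1 z * nsq1 w)" "norm (herm2 z w) \<le> sqrt (nsq2 z * nsq2 w)"
  using norm_hprod_le[of "lpart z" "lpart w"] norm_hprod_le[of "rpart z" "rpart w"]
  by (simp_all add: herm1_def herm2_def nsq_eq_norm real_sqrt_mult)

section \<open>Convergence of the kernel series on the product of the domain with itself\<close>

lemma one_minus_sqrt_mult_square_ge:
  assumes "0 \<le> x" "x \<le> 1" "0 \<le> y" "y \<le> (1::real)"
  shows "(1 - x) * (1 - y) \<le> (1 - sqrt (x * y))\<^sup>2"
proof -
  have "0 \<le> (sqrt x - sqrt y)\<^sup>2" by simp
  also have "\<dots> = x + y - 2 * sqrt (x * y)"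
    using assms by (simp add: power2_diff real_sqrt_mult)
  finally show ?thesis
    using assms by (simp add: power2_diff algebra_simps)
qed

text \<open>A point with |z| < 1 lies in \<open>E p\<close> exactly when this number is below 1. It
  serves as a bound for the argument of the kernel series, uniform in the other variable.\<close>

definition contraction :: "real \<Rightarrow> complex^('n::finite + 'k::finite) \<Rightarrow> real"
  where "contraction p w = sqrt (nsq2 w / (1 - nsq1 w) powr (1 / p))"

lemma contraction_bounds:
  assumes p: "p > 0" and w: "w \<in> E p"
  shows "0 \<le> contraction p w" "contraction p w < 1"
proof -
  have w1: "nsq1 w < 1" using E_bounds[OF p w] by simp
  have "nsq2 w powr p < 1 - nsq1 w" using w by (simp add: E_iff)
  then have "(nsq2 w powr p) powr (1 / p) < (1 - nsq1 w) powr (1 / p)"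
    using p by (intro powr_less_mono2) auto
  then have "nsq2 w < (1 - nsq1 w) powr (1 / p)"
    using p by (simp add: powr_powr)
  then show "contraction p w < 1" "0 \<le> contraction p w"
    using w1 by (simp_all add: contraction_def divide_less_eq)
qed

text \<open>Cauchy-Schwarz in each block together with \<open>one_minus_sqrt_mult_square_ge\<close>
  splits the squared argument into one factor per point. The factor of z is at most 1, which leaves
  a bound depending on w alone.\<close>

lemma kernel_argument_bound:
  assumes p: "p > 0" and z: "z \<in> E p" and w: "w \<in> E p"
  shows "norm (herm1 z w) \<le> sqrt (nsq1 w)" "sqrt (nsq1 w) < 1"
    "norm (herm2 z w) * norm (1 - herm1 z w) powr (- (1 / p)) \<le> contraction p w"
proof -
  have z1: "nsq1 z < 1" and w1: "nsq1 w < 1" using E_bounds[OF p] z w by auto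
  have 0: "nsq1 z * nsq1 w \<le> 1 * nsq1 w" using z1 by (intro mult_right_mono) auto
  then show 1: "norm (herm1 z w) \<le> sqrt (nsq1 w)"
    using order_trans[OF norm_herm_le(1)[of z w] real_sqrt_le_mono[OF 0]] by simp
  show "sqrt (nsq1 w) < 1" using w1 by simp
  have lt1: "sqrt (nsq1 z * nsq1 w) < 1"
    using 0 w1 by simp
  have "1 - sqrt (nsq1 z * nsq1 w) \<le> norm (1 - herm1 z w)"
    using norm_herm_le(1)[of z w] norm_triangle_ineq2[of 1 "herm1 z w"] by simp
  then have "(1 - sqrt (nsq1 z * nsq1 w))\<^sup>2 \<le> (norm (1 - herm1 z w))\<^sup>2"
    using lt1 by (intro power_mono) auto
  with one_minus_sqrt_mult_square_ge[of "nsq1 z" "nsq1 w"] z1 w1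
  have den: "(1 - nsq1 z) * (1 - nsq1 w) \<le> (norm (1 - herm1 z w))\<^sup>2" by simp
  have den_pos: "0 < (1 - nsq1 z) * (1 - nsq1 w)" using z1 w1 by simp
  have n_pos: "norm (1 - herm1 z w) > 0"
    using den den_pos by (metis less_le_trans norm_ge_zero not_le order_le_less power_zero_numeral)
  have zz: "nsq2 z \<le> (1 - nsq1 z) powr (1 / p)"
  proof -
    have "nsq2 z powr p \<le> 1 - nsq1 z" using z by (simp add: E_iff)
    then have "(nsq2 z powr p) powr (1 / p) \<le> (1 - nsq1 z) powr (1 / p)"
      using p by (intro powr_mono2) auto
    then show ?thesis using p by (simp add: powr_powr)
  qed
  have "(norm (herm2 z w) * norm (1 - herm1 z w) powr (- (1 / p)))\<^sup>2
    = (norm (herm2 z w))\<^sup>2 * ((norm (1 - herm1 z w))\<^sup>2 powr (- (1 / p)))"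
    using n_pos by (simp add: power_mult_distrib power2_eq_square powr_mult)
  also have "\<dots> \<le> (nsq2 z * nsq2 w) * (((1 - nsq1 z) * (1 - nsq1 w)) powr (- (1 / p)))"
  proof (intro mult_mono)
    have "(norm (herm2 z w))\<^sup>2 \<le> (sqrt (nsq2 z * nsq2 w))\<^sup>2"
      using norm_herm_le(2)[of z w] by (intro power_mono) auto
    then show "(norm (herm2 z w))\<^sup>2 \<le> nsq2 z * nsq2 w" by simp
    show "(norm (1 - herm1 z w))\<^sup>2 powr - (1 / p) \<le> ((1 - nsq1 z) * (1 - nsq1 w)) powr - (1 / p)"
      using den den_pos p by (intro powr_mono2') auto
  qed auto
  also have "\<dots> = (nsq2 z / (1 - nsq1 z) powr (1 / p)) * (nsq2 w / (1 - nsq1 w) powr (1 / p))"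
    using z1 w1 by (simp add: powr_mult powr_minus divide_inverse mult_ac)
  also have "\<dots> \<le> 1 * (nsq2 w / (1 - nsq1 w) powr (1 / p))"
    using zz z1 by (intro mult_right_mono) (auto simp: divide_le_eq)
  also have "\<dots> = (contraction p w)\<^sup>2"
    by (simp add: contraction_def)
  finally show "norm (herm2 z w) * norm (1 - herm1 z w) powr (- (1 / p)) \<le> contraction p w"
    by (rule power2_le_imp_le) (rule contraction_bounds[OF p w])
qed

definition ecoeff :: "real \<Rightarrow> nat \<Rightarrow> nat \<Rightarrow> nat \<Rightarrow> real"
  where "ecoeff p n k j = fact (j + k) / fact j * pochhammer ((real j + real k) / p + 1) n"

lemma ecoeff_pos: "p > 0 \<Longrightarrow> ecoeff p n k j > 0"
  unfolding ecoeff_def by (intro mult_pos_pos divide_pos_pos pochhammer_pos) (auto intro!: add_nonneg_pos)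

text \<open>The ratio of consecutive coefficients is a product of n + 1 factors, each tending to
  1.\<close>

lemma ecoeff_conv_radius:
  assumes p: "p > 0"
  shows "conv_radius (\<lambda>j. of_real (ecoeff p n k j) :: complex) = 1"
proof (rule conv_radius_ratio_limit_nonzero)
  define F where "F i j = ((real j + real k) / p + 1 + real i) / ((real (Suc j) + real k) / p + 1 + real i)" for i j
  have "((\<lambda>j. (real j + 1) / (real j + 1 + real k) * (\<Prod>i<n. F i j)) \<longlongrightarrow> 1 * (\<Prod>i<n. 1)) sequentially"
  proof (intro tendsto_mult tendsto_prod)
    show "(\<lambda>j. (real j + 1) / (real j + 1 + real k)) \<longlonglongrightarrow> 1" by real_asymp
    show "F i \<longlonglongrightarrow> 1" for i
      unfolding F_def using p by real_asymp
  qed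
  moreover have "norm (of_real (ecoeff p n k j) :: complex) / norm (of_real (ecoeff p n k (Suc j)) :: complex)
      = (real j + 1) / (real j + 1 + real k) * (\<Prod>i<n. F i j)" for j
  proof -
    have "pochhammer ((real j + real k) / p + 1) n / pochhammer ((real (Suc j) + real k) / p + 1) n = (\<Prod>i<n. F i j)"
      by (simp add: pochhammer_prod F_def prod_dividef atLeast0LessThan)
    moreover have "(fact (j + k) / fact j) / (fact (Suc j + k) / fact (Suc j)) = (real j + 1) / (real j + 1 + real k)"
    proof -
      have "fact (Suc j) = (real j + 1) * fact j" "fact (Suc j + k) = (real j + 1 + real k) * fact (j + k)"
        by (simp_all add: algebra_simps)
      then show ?thesis by (simp only:) (simp add: divide_simps)
    qed
    ultimately have "ecoeff p n k j / ecoeff p n k (Suc j) = (real j + 1) / (real j + 1 + real k) * (\<Prod>i<n. F i j)"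
      unfolding ecoeff_def by (metis times_divide_times_eq)
    then show ?thesis using ecoeff_pos[OF p] by (simp add: less_imp_le abs_of_pos)
  qed
  ultimately show "(\<lambda>j. norm (of_real (ecoeff p n k j) :: complex) / norm (of_real (ecoeff p n k (Suc j)) :: complex)) \<longlonglongrightarrow> 1"
    by simp
qed (auto simp: one_ereal_def)

definition eseries :: "real \<Rightarrow> nat \<Rightarrow> nat \<Rightarrow> complex \<Rightarrow> complex"
  where "eseries p n k x = (\<Sum>j. of_real (ecoeff p n k j) * x ^ j)"

lemma eseries_sums:
  assumes "p > 0" "norm x < 1"
  shows "(\<lambda>j. of_real (ecoeff p n k j) * x ^ j) sums eseries p n k x"
  unfolding eseries_def using ecoeff_conv_radius[OF assms(1), of n k] assms(2)
  by (intro summable_sums summable_in_conv_radius) (simp add: one_ereal_def)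

lemma ecoeff_summable:
  assumes "p > 0" "0 \<le> q" "q < 1"
  shows "summable (\<lambda>j. ecoeff p n k j * q ^ j)"
proof -
  have "summable (\<lambda>j. of_real (ecoeff p n k j) * (of_real q :: complex) ^ j)"
    using eseries_sums[of p "of_real q" n k] assms by (auto simp: sums_iff)
  then show ?thesis
    by (simp flip: of_real_power of_real_mult add: summable_complex_of_real)
qed

lemma eseries_holomorphic: "p > 0 \<Longrightarrow> eseries p n k holomorphic_on ball 0 1"
  by (rule power_series_holomorphic[where a = "\<lambda>j. of_real (ecoeff p n k j)"])
     (use eseries_sums in auto)

definition ekernel :: "real \<Rightarrow> real \<Rightarrow> complex^('n::finite + 'k::finite) \<Rightarrow> complex^('n + 'k) \<Rightarrow> complex"
  where "ekernel \<kappa> p z w = of_real \<kappa> *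
    (1 - herm1 z w) powr (- of_real (real CARD('n) + 1 + real CARD('k) / p)) *
    eseries p CARD('n) CARD('k) (herm2 z w * (1 - herm1 z w) powr (- of_real (1 / p)))"

text \<open>Since \<open>herm1 z w\<close> has norm below 1, its difference from 1 lies in the right
  half plane, where the principal powers in the kernel are holomorphic.\<close>

lemma one_minus_herm1_not_nonpos:
  assumes "p > 0" "z \<in> E p" "w \<in> E p"
  shows "1 - herm1 z w \<notin> \<real>\<^sub>\<le>\<^sub>0" "1 - herm1 z w \<noteq> 0" "Re (1 - herm1 z w) > 0"
proof -
  have "norm (herm1 z w) < 1"
    using kernel_argument_bound(1,2)[OF assms] by linarith
  then have "Re (herm1 z w) < 1" using complex_Re_le_cmod le_less_trans by blast
  then show "Re (1 - herm1 z w) > 0" by simp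
  then show "1 - herm1 z w \<notin> \<real>\<^sub>\<le>\<^sub>0" "1 - herm1 z w \<noteq> 0"
    by (auto simp: complex_nonpos_Reals_iff)
qed

lemma ekernel_argument_less_1:
  assumes "p > 0" "z \<in> E p" "w \<in> E p"
  shows "norm (herm2 z w * (1 - herm1 z w) powr (- of_real (1 / p))) \<le> contraction p w"
proof -
  have "norm ((1 - herm1 z w) powr (- of_real (1 / p))) = norm (1 - herm1 z w) powr (- (1 / p))"
    by (subst norm_powr_real_powr') auto
  then show ?thesis using kernel_argument_bound(3)[OF assms] by (simp only: norm_mult)
qed

text \<open>With X = \<open>herm1 z w\<close>, the j-th power of the argument shifts the exponent of
  1 - X to -(n + 1 + (j + k)/p). In this form each term expands into a binomial series in X.\<close>

lemma ekernel_sums: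
  fixes z w :: "complex^('n::finite + 'k::finite)"
  assumes "p > 0" "z \<in> E p" "w \<in> E p"
  shows "(\<lambda>j. of_real (\<kappa> * ecoeff p CARD('n) CARD('k) j) *
    ((1 - herm1 z w) powr (- of_real (real CARD('n) + 1 + (real j + real CARD('k)) / p)) * herm2 z w ^ j)) sums ekernel \<kappa> p z w"
proof -
  let ?x = "1 - herm1 z w" and ?A = "real CARD('n) + 1 + real CARD('k) / p"
  have "(\<lambda>j. of_real \<kappa> * ?x powr (- of_real ?A) * (of_real (ecoeff p CARD('n) CARD('k) j) *
      (herm2 z w * ?x powr (- of_real (1 / p))) ^ j)) sums ekernel \<kappa> p z w"
    unfolding ekernel_def
    using ekernel_argument_less_1[OF assms] contraction_bounds[OF assms(1,3)]
    by (intro sums_mult eseries_sums assms) auto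
  moreover have "?x powr (- of_real ?A) * (?x powr (- of_real (1 / p))) ^ j
      = ?x powr (- of_real (real CARD('n) + 1 + (real j + real CARD('k)) / p))" for j
  proof -
    have "?x powr (- of_real ?A) * (?x powr (- of_real (1 / p))) ^ j = exp (- of_real ?A * Ln ?x + of_nat j * (- of_real (1 / p) * Ln ?x))"
      using one_minus_herm1_not_nonpos(2)[OF assms] by (simp only: powr_def if_False exp_add exp_of_nat_mult)
    also have "- of_real ?A * Ln ?x + of_nat j * (- of_real (1 / p) * Ln ?x)
      = - of_real (real CARD('n) + 1 + (real j + real CARD('k)) / p) * Ln ?x"
      by (simp add: algebra_simps add_divide_distrib)
    finally show ?thesis
      using one_minus_herm1_not_nonpos(2)[OF assms] by (simp only: powr_def if_False)
  qed
  ultimately show ?thesis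
    by (simp only: power_mult_distrib of_real_mult mult_ac)
qed

section \<open>The reproducing property\<close>

lemma set_integrable_bounded_mult:
  fixes f g :: "'a::euclidean_space \<Rightarrow> complex"
  assumes "open D" "continuous_on D f" "set_integrable lborel D f"
    "continuous_on D g" "\<And>x. x \<in> D \<Longrightarrow> norm (g x) \<le> B"
  shows "set_integrable lborel D (\<lambda>x. f x * g x)"
proof -
  have int: "integrable lborel (\<lambda>x. indicator D x *\<^sub>R f x)"
    using assms(3) by (simp add: set_integrable_def)
  have "integrable lborel (\<lambda>x. B *\<^sub>R (indicator D x *\<^sub>R f x))"
    by (rule integrable_scaleR_right[OF int])
  then have "integrable lborel (\<lambda>x. indicator D x *\<^sub>R (f x * g x))"
  proof (rule Bochner_Integration.integrable_bound)
    show "(\<lambda>x. indicator D x *\<^sub>R (f x * g x)) \<in> borel_measurable lborel"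
      using assms(1,2,4) by (auto intro!: borel_measurable_continuous_on_indicator continuous_on_mult)
    have "norm (indicator D x *\<^sub>R (f x * g x)) \<le> norm (B *\<^sub>R (indicator D x *\<^sub>R f x))" for x
    proof (cases "x \<in> D")
      case True
      then have "norm (f x) * norm (g x) \<le> norm (f x) * \<bar>B\<bar>"
        using assms(5)[OF True] by (intro mult_left_mono) auto
      then show ?thesis using True by (simp add: norm_mult mult.commute)
    qed simp
    then show "AE x in lborel. norm (indicator D x *\<^sub>R (f x * g x)) \<le> norm (B *\<^sub>R (indicator D x *\<^sub>R f x))"
      by simp
  qed
  then show ?thesis by (simp add: set_integrable_def)
qed

text \<open>Termwise integration: the \<open>u j\<close> are bounded by a summable sequence of
  constants, so the series of norms is dominated by a multiple of one integrable function.\<close>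

lemma set_integral_sums_bounded:
  fixes f :: "'a::euclidean_space \<Rightarrow> complex" and u :: "nat \<Rightarrow> 'a \<Rightarrow> complex"
  assumes D: "open D" and f: "continuous_on D f" "set_integrable lborel D f"
    and u: "\<And>j. continuous_on D (u j)" "\<And>j x. x \<in> D \<Longrightarrow> norm (u j x) \<le> M j" "summable M"
    and U: "\<And>x. x \<in> D \<Longrightarrow> (\<lambda>j. u j x) sums U x"
  shows "(\<lambda>j. LINT x:D|lborel. f x * u j x) sums (LINT x:D|lborel. f x * U x)"
proof -
  let ?h = "\<lambda>j x. indicator D x *\<^sub>R (f x * u j x)"
  have int: "integrable lborel (?h j)" for j
    using set_integrable_bounded_mult[OF D f u(1) u(2)] by (simp add: set_integrable_def)
  have intf: "integrable lborel (\<lambda>x. norm (indicator D x *\<^sub>R f x))"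
    using f(2) by (intro integrable_norm) (simp add: set_integrable_def)
  have bound: "norm (?h j x) \<le> M j * norm (indicator D x *\<^sub>R f x)" for j x
    using mult_left_mono[OF u(2)[of x j], of "norm (f x)"]
    by (cases "x \<in> D") (auto simp: norm_mult mult.commute)
  have "(\<lambda>j. integral\<^sup>L lborel (?h j)) sums (\<integral>x. (\<Sum>j. ?h j x) \<partial>lborel)"
  proof (rule sums_integral[OF int])
    show "AE x in lborel. summable (\<lambda>j. norm (?h j x))"
      by (rule AE_I2, rule summable_comparison_test'[OF summable_mult2[OF u(3)]]) (use bound in auto)
    show "summable (\<lambda>j. \<integral>x. norm (?h j x) \<partial>lborel)"
    proof (rule summable_comparison_test'[OF summable_mult2[OF u(3)]])
      fix j
      have "(\<integral>x. norm (?h j x) \<partial>lborel) \<le> (\<integral>x. M j * norm (indicator D x *\<^sub>R f x) \<partial>lborel)"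
        by (intro integral_mono integrable_norm int integrable_mult_right intf bound)
      then show "norm (\<integral>x. norm (?h j x) \<partial>lborel) \<le> M j * (\<integral>x. norm (indicator D x *\<^sub>R f x) \<partial>lborel)"
        by (simp add: abs_of_nonneg integral_nonneg_AE)
    qed
  qed
  moreover have "(\<Sum>j. ?h j x) = indicator D x *\<^sub>R (f x * U x)" for x
    using sums_mult[OF U, of x "f x"] by (cases "x \<in> D") (auto simp: sums_iff)
  ultimately show ?thesis by (simp add: set_lebesgue_integral_def)
qed

section \<open>Averaging over coordinate rotations\<close>

definition rotate_coords :: "'m set \<Rightarrow> real \<Rightarrow> complex^'m::finite \<Rightarrow> complex^'m"
  where "rotate_coords S t w = (\<chi> i. if i \<in> S then cis t * w $ i else w $ i)"

lemma rotate_coords_nth [simp]: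
  "rotate_coords S t w $ i = (if i \<in> S then cis t * w $ i else w $ i)"
  by (simp add: rotate_coords_def)

lemma norm_eq_if_coords_norm_eq:
  fixes x y :: "complex^'m::finite"
  shows "(\<And>i. norm (x $ i) = norm (y $ i)) \<Longrightarrow> norm x = norm y"
  by (simp add: norm_vec_def)

lemma rotate_coords_orthogonal: "orthogonal_transformation (rotate_coords S t)"
  unfolding orthogonal_transformation
proof (intro conjI allI linearI)
  show "norm (rotate_coords S t v) = norm v" for v
    by (rule norm_eq_if_coords_norm_eq) (simp add: norm_mult)
qed (auto simp: vec_eq_iff algebra_simps)

lemma rotate_coords_continuous:
  fixes S :: "'m::finite set"
  shows "continuous_on UNIV (\<lambda>(t, x). rotate_coords S t x)"
proof -
  have "continuous_on UNIV (\<lambda>y::real \<times> (complex^'m::finite). if i \<in> S then cis (fst y) * snd y $ i else snd y $ i)" for i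
    by (cases "i \<in> S") (auto intro!: continuous_intros)
  then show ?thesis
    unfolding split_beta rotate_coords_def by (intro continuous_on_vec_lambda)
qed

lemma E_mono:
  assumes "p > 0" "w \<in> E p" "\<And>i. norm (z $ i) \<le> norm (w $ i)"
  shows "z \<in> E p"
proof -
  have "nsq1 z \<le> nsq1 w" "nsq2 z \<le> nsq2 w"
    unfolding nsq1_def nsq2_def by (intro sum_mono power_mono assms norm_ge_zero)+
  then have "nsq1 z + nsq2 z powr p \<le> nsq1 w + nsq2 w powr p"
    using assms(1) by (intro add_mono powr_mono2) auto
  then show ?thesis using assms(2) by (simp add: E_iff)
qed

lemma rotate_coords_E: assumes "p > 0" shows "rotate_coords S t w \<in> E p \<longleftrightarrow> w \<in> E p"
proof
  assume "rotate_coords S t w \<in> E p"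
  then show "w \<in> E p" by (rule E_mono[OF assms]) (simp add: norm_mult)
next
  assume "w \<in> E p"
  then show "rotate_coords S t w \<in> E p" by (rule E_mono[OF assms]) (simp add: norm_mult)
qed

definition embed2 :: "'n::finite \<Rightarrow> 'k::finite \<Rightarrow> complex \<Rightarrow> complex \<Rightarrow> complex^('n + 'k)"
  where "embed2 a b z \<xi> = join (axis a z) (axis b \<xi>)"

lemma embed2_nth:
  "embed2 a b z \<xi> $ i = (if i = Inl a then z else if i = Inr b then \<xi> else 0)"
  by (cases i) (auto simp: embed2_def join_def axis_def)

lemma nsq_embed2: "nsq1 (embed2 a b z \<xi>) = (norm z)\<^sup>2" "nsq2 (embed2 a b z \<xi>) = (norm \<xi>)\<^sup>2"
proof -
  have "nsq1 (embed2 a b z \<xi>) = (\<Sum>x\<in>UNIV. if x = a then (norm z)\<^sup>2 else 0)"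
    unfolding nsq1_def by (intro sum.cong) (auto simp: embed2_nth)
  moreover have "nsq2 (embed2 a b z \<xi>) = (\<Sum>x\<in>UNIV. if x = b then (norm \<xi>)\<^sup>2 else 0)"
    unfolding nsq2_def by (intro sum.cong) (auto simp: embed2_nth)
  ultimately show "nsq1 (embed2 a b z \<xi>) = (norm z)\<^sup>2" "nsq2 (embed2 a b z \<xi>) = (norm \<xi>)\<^sup>2"
    by simp_all
qed

definition fibre_radius :: "real \<Rightarrow> real \<Rightarrow> real"
  where "fibre_radius p x = sqrt ((1 - x\<^sup>2) powr (1 / p))"

lemma embed2_in_E:
  assumes p: "p > 0"
  shows "embed2 a b z \<xi> \<in> E p \<longleftrightarrow> norm z < 1 \<and> norm \<xi> < fibre_radius p (norm z)"
proof -
  have "embed2 a b z \<xi> \<in> E p \<longleftrightarrow> (norm z)\<^sup>2 + (norm \<xi>)\<^sup>2 powr p < 1"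
    by (simp add: E_iff nsq_embed2)
  also have "\<dots> \<longleftrightarrow> norm z < 1 \<and> (norm \<xi>)\<^sup>2 < (1 - (norm z)\<^sup>2) powr (1 / p)"
  proof (cases "norm z < 1")
    case True
    then have z: "0 < 1 - (norm z)\<^sup>2" by (simp add: power_less_one_iff)
    have "(norm \<xi>)\<^sup>2 powr p < 1 - (norm z)\<^sup>2 \<longleftrightarrow> (norm \<xi>)\<^sup>2 < (1 - (norm z)\<^sup>2) powr (1 / p)" (is "?l \<longleftrightarrow> ?r")
    proof
      assume ?l
      then have "((norm \<xi>)\<^sup>2 powr p) powr (1 / p) < (1 - (norm z)\<^sup>2) powr (1 / p)"
        using p by (intro powr_less_mono2) auto
      then show ?r using p by (simp add: powr_powr)
    next
      assume ?r
      then have "(norm \<xi>)\<^sup>2 powr p < ((1 - (norm z)\<^sup>2) powr (1 / p)) powr p"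
        using p by (intro powr_less_mono2) auto
      then show ?l using p z by (simp add: powr_powr)
    qed
    with True show ?thesis by auto
  next
    case False
    then have "1 \<le> (norm z)\<^sup>2" by simp
    moreover have "0 \<le> (norm \<xi>)\<^sup>2 powr p" by simp
    ultimately show ?thesis using False by linarith
  qed
  also have "\<dots> \<longleftrightarrow> norm z < 1 \<and> norm \<xi> < fibre_radius p (norm z)"
    unfolding fibre_radius_def by (metis real_less_rsqrt real_sqrt_less_iff real_sqrt_abs abs_norm_cancel)
  finally show ?thesis .
qed

lemma continuous_embed2 [continuous_intros]:
  assumes "continuous_on S f" "continuous_on S g"
  shows "continuous_on S (\<lambda>x. embed2 a b (f x) (g x))"
proof -
  have "continuous_on S (\<lambda>x. if i = Inl a then f x else if i = Inr b then g x else 0)" for i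
    using assms by (cases "i = Inl a"; cases "i = Inr b") auto
  then have "continuous_on S (\<lambda>x. \<chi> i. if i = Inl a then f x else if i = Inr b then g x else 0)"
    by (rule continuous_on_vec_lambda)
  also have "(\<lambda>x. \<chi> i. if i = Inl a then f x else if i = Inr b then g x else 0) = (\<lambda>x. embed2 a b (f x) (g x))"
    by (simp add: fun_eq_iff vec_eq_iff embed2_nth)
  finally show ?thesis .
qed

lemma holomorphic_several_continuous:
  assumes "holomorphic_several f D" shows "continuous_on D f"
  using assms unfolding holomorphic_several_def
  by (meson continuous_at_imp_continuous_on has_derivative_continuous)

lemma holomorphic_several_line:
  assumes f: "holomorphic_several f D" and w: "u + x *s v \<in> D"
  shows "(\<lambda>x. f (u + x *s v)) field_differentiable at x"
proof -
  obtain f' where f': "(f has_derivative f') (at (u + x *s v))" "\<And>c y. f' (c *s y) = c * f' y"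
    using f w unfolding holomorphic_several_def by blast
  have "bounded_linear (\<lambda>x. x *s v)"
  proof (rule bounded_linear_intro)
    show "norm (x *s v) \<le> norm x * norm v" for x
    proof -
      have "norm (x *s v) = L2_set (\<lambda>i. norm x * norm (v $ i)) UNIV"
        by (simp add: norm_vec_def norm_mult)
      then show ?thesis by (simp add: L2_set_right_distrib norm_vec_def)
    qed
  qed (auto simp: vec_eq_iff algebra_simps)
  then have "((\<lambda>x. u + x *s v) has_derivative (\<lambda>x. x *s v)) (at x)"
    by (intro has_derivative_eq_rhs[OF has_derivative_add[OF has_derivative_const bounded_linear.has_derivative[OF _ has_derivative_ident]]]) auto
  from has_derivative_compose[OF this f'(1)]
  have "((\<lambda>x. f (u + x *s v)) has_derivative (\<lambda>x. f' v * x)) (at x)"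
    by (simp add: f'(2) mult.commute)
  then show ?thesis
    unfolding field_differentiable_def has_field_derivative_def by blast
qed

text \<open>\<open>E p\<close> has finite volume, so square integrability implies integrability,
  through x \<le> 1 + x^2.\<close>

lemma bergman_space_integrable:
  fixes f :: "complex^('n::finite + 'k::finite) \<Rightarrow> complex"
  assumes p: "p > 0" and f: "f \<in> bergman_space (E p)"
  shows "set_integrable lborel (E p) f"
proof -
  have cont: "continuous_on (E p) f"
    using f by (auto simp: bergman_space_def intro: holomorphic_several_continuous)
  have "integrable lborel (\<lambda>w. indicator (E p) w *\<^sub>R (cmod (f w))\<^sup>2)"
    using f by (simp add: bergman_space_def set_integrable_def)
  moreover have "integrable lborel (indicator (E p) :: complex^('n + 'k) \<Rightarrow> real)"
    using borel_open[OF open_E[OF p]] emeasure_bounded_finite[OF bounded_E[OF p]]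
    by (intro integrable_real_indicator) auto
  ultimately have "integrable lborel (\<lambda>w. indicator (E p) w + indicator (E p) w *\<^sub>R (cmod (f w))\<^sup>2)"
    by (rule Bochner_Integration.integrable_add[rotated])
  then have "integrable lborel (\<lambda>w. indicator (E p) w *\<^sub>R f w)"
  proof (rule Bochner_Integration.integrable_bound)
    show "(\<lambda>w. indicator (E p) w *\<^sub>R f w) \<in> borel_measurable lborel"
      using cont by (auto intro!: borel_measurable_continuous_on_indicator borel_open open_E p)
    have "x \<le> 1 + x\<^sup>2" for x :: real
    proof -
      have "0 \<le> (x - 1 / 2)\<^sup>2" by simp
      then show ?thesis by (simp add: power2_diff power_divide)
    qed
    then show "AE w in lborel. norm (indicator (E p) w *\<^sub>R f w) \<le> norm (indicator (E p) w + indicator (E p) w *\<^sub>R (cmod (f w))\<^sup>2)"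
      by (auto simp: indicator_def)
  qed
  then show ?thesis by (simp add: set_integrable_def)
qed

lemma fibre_radius_pos: "0 \<le> x \<Longrightarrow> x < 1 \<Longrightarrow> 0 < fibre_radius p x"
  using abs_square_less_1[of x] by (simp add: fibre_radius_def)

lemma fibre_radius_antimono:
  assumes "p > 0" "0 \<le> x" "x \<le> y" "y < 1"
  shows "fibre_radius p y \<le> fibre_radius p x"
proof -
  have "x\<^sup>2 \<le> y\<^sup>2" using assms by (intro power_mono) auto
  moreover have "y\<^sup>2 \<le> 1" using assms by (simp add: power_le_one)
  ultimately show ?thesis unfolding fibre_radius_def using assms
    by (intro real_sqrt_le_mono powr_mono2) auto
qed

text \<open>The slice of \<open>E p\<close> by the plane of the coordinates a and b is the Hartogs
  domain with radius function \<open>fibre_radius p\<close>.\<close>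

lemma E_two_variable_holomorphic:
  assumes p: "p > 0" and f: "holomorphic_several f (E p)"
  shows "two_variable_holomorphic (\<lambda>z \<xi>. f (embed2 a b z \<xi>)) (fibre_radius p)"
proof
  have mem: "embed2 a b z \<xi> \<in> E p" if "norm z < 1" "norm \<xi> < fibre_radius p (norm z)" for z \<xi>
    using that p by (simp add: embed2_in_E)
  show "0 < fibre_radius p x" if "0 \<le> x" "x < 1" for x
    using that by (rule fibre_radius_pos)
  show "fibre_radius p y \<le> fibre_radius p x" if "0 \<le> x" "x \<le> y" "y < 1" for x y
    using p that by (rule fibre_radius_antimono)
  show "continuous_on {(z, \<xi>). norm z < 1 \<and> norm \<xi> < fibre_radius p (norm z)} (\<lambda>(z, \<xi>). f (embed2 a b z \<xi>))"
    unfolding split_beta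
    by (rule continuous_on_compose2[OF holomorphic_several_continuous[OF f]])
       (auto intro!: continuous_intros mem)
  have fst_line: "embed2 a b z \<xi> = embed2 a b 0 \<xi> + z *s axis (Inl a) 1" for z \<xi>
    by (auto simp: vec_eq_iff embed2_nth axis_def)
  have snd_line: "embed2 a b z \<xi> = embed2 a b z 0 + \<xi> *s axis (Inr b) 1" for z \<xi>
    by (auto simp: vec_eq_iff embed2_nth axis_def)
  show "(\<lambda>z. f (embed2 a b z \<xi>)) field_differentiable at z"
    if "norm z < 1" "norm \<xi> < fibre_radius p (norm z)" for z \<xi>
  proof -
    have "(\<lambda>z. f (embed2 a b z \<xi>)) = (\<lambda>z. f (embed2 a b 0 \<xi> + z *s axis (Inl a) 1))"
      by (simp only: fst_line[symmetric])
    then show ?thesis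
      using mem[OF that] by (simp only:) (intro holomorphic_several_line[OF f], simp only: fst_line[symmetric])
  qed
  show "(\<lambda>\<xi>. f (embed2 a b z \<xi>)) holomorphic_on ball 0 (fibre_radius p (norm z))" if "norm z < 1" for z
    unfolding holomorphic_on_def
  proof
    fix \<xi> :: complex assume "\<xi> \<in> ball 0 (fibre_radius p (norm z))"
    then have "embed2 a b z \<xi> \<in> E p" using mem that by auto
    moreover have "(\<lambda>\<xi>. f (embed2 a b z \<xi>)) = (\<lambda>\<xi>. f (embed2 a b z 0 + \<xi> *s axis (Inr b) 1))"
      by (simp only: snd_line[symmetric])
    ultimately have "(\<lambda>\<xi>. f (embed2 a b z \<xi>)) field_differentiable at \<xi>"
      by (simp only:) (intro holomorphic_several_line[OF f], simp only: snd_line[symmetric])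
    then show "(\<lambda>\<xi>. f (embed2 a b z \<xi>)) field_differentiable at \<xi> within ball 0 (fibre_radius p (norm z))"
      by (rule field_differentiable_at_within)
  qed
qed

text \<open>Mean value property on the complex line x \<mapsto> u + x v, where u keeps the entries a
  and b of w and v the others; the rotated points are those with x = \<open>cis t\<close>, and the
  centre x = 0 is u.\<close>

lemma average_other_coords:
  fixes f :: "complex^('n::finite + 'k::finite) \<Rightarrow> complex"
  assumes p: "p > 0" and f: "holomorphic_several f (E p)" and w: "w \<in> E p"
  shows "((\<lambda>t. f (rotate_coords (- {Inl a, Inr b}) t w)) has_integral
    2 * pi * f (embed2 a b (w $ Inl a) (w $ Inr b))) {0..2 * pi}"
proof -
  define u where "u = embed2 a b (w $ Inl a) (w $ Inr b)"
  define v where "v = w - u"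
  have u_nth: "u $ i = (if i \<in> {Inl a, Inr b} then w $ i else 0)" for i
    by (auto simp: u_def embed2_nth)
  \<comment> \<open>The unit circle must lie inside a disc of holomorphy: openness gives a real
    parameter R > 1 with u + R v still in \<open>E p\<close>, and \<open>E_mono\<close> fills the
    disc |x| < R.\<close>
  have "open ((\<lambda>x::real. u + of_real x *s v) -` E p)"
  proof (rule open_vimage[OF open_E[OF p]])
    show "continuous_on UNIV (\<lambda>x::real. u + of_real x *s v)"
      unfolding vector_scalar_mult_def by (intro continuous_intros)
  qed
  moreover have "1 \<in> (\<lambda>x::real. u + of_real x *s v) -` E p"
    using w by (simp add: v_def)
  ultimately obtain e where e: "e > 0" "ball 1 e \<subseteq> (\<lambda>x::real. u + of_real x *s v) -` E p"
    by (meson open_contains_ball)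
  define R where "R = 1 + e / 2"
  have "R \<in> ball 1 e" using e(1) by (simp add: R_def dist_real_def)
  then have R: "R > 1" "u + of_real R *s v \<in> E p"
    using e by (auto simp: R_def)
  have mem: "u + x *s v \<in> E p" if "x \<in> ball 0 R" for x
  proof (rule E_mono[OF p R(2)])
    fix i
    show "norm ((u + x *s v) $ i) \<le> norm ((u + of_real R *s v) $ i)"
      using that by (auto simp: u_nth v_def norm_mult intro!: mult_right_mono)
  qed
  have hol: "(\<lambda>x. f (u + x *s v)) holomorphic_on ball 0 R"
    unfolding holomorphic_on_def
    by (rule ballI, rule field_differentiable_at_within, rule holomorphic_several_line[OF f], rule mem)
  have "u + cis t *s v = rotate_coords (- {Inl a, Inr b}) t w" for t
    by (simp add: vec_eq_iff u_nth v_def)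
  then show ?thesis
    using taylor_coeff_average[OF hol, of 1 0] R(1) by (simp add: taylor_coeff_def u_def)
qed

text \<open>Three averages: over the coordinates other than a and b, where the monomial is fixed;
  over entry b, which extracts the j-th coefficient; over entry a, which extracts the i-th. Entry b
  precedes entry a because its coefficients are functions on the whole unit disc, whereas the range
  of \<xi> depends on z.\<close>

lemma integral_against_monomial:
  fixes f :: "complex^('n::finite + 'k::finite) \<Rightarrow> complex" and a :: 'n and b :: 'k
  assumes p: "p > 0" and f: "f \<in> bergman_space (E p)"
  shows "(LINT w:E p|lborel. f w * cnj (w $ Inl a ^ i * w $ Inr b ^ j)) =
    two_variable_holomorphic.coeff2 (\<lambda>z \<xi>. f (embed2 a b z \<xi>)) i j *
    of_real (LINT w:E p|lborel. mono2 a b i j w)"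
proof -
  have hol: "holomorphic_several f (E p)" using f by (simp add: bergman_space_def)
  define \<phi> where "\<phi> = (\<lambda>z \<xi>. f (embed2 a b z \<xi>))"
  interpret two_variable_holomorphic \<phi> "fibre_radius p"
    unfolding \<phi>_def by (rule E_two_variable_holomorphic[OF p hol])
  have contf: "continuous_on (E p) f" by (rule holomorphic_several_continuous[OF hol])
  define m where "m w = cnj (w $ Inl a ^ i * w $ Inr b ^ j)" for w :: "complex^('n + 'k)"
  have m_cont: "continuous_on (E p) m" unfolding m_def by (intro continuous_intros)
  have coord: "norm (w $ l) < 1" if "w \<in> E p" for w :: "complex^('n + 'k)" and l
    using E_bounds(3)[OF p that] .
  have m_bound: "norm (m w) \<le> 1" if "w \<in> E p" for w
  proof -
    have "norm (w $ Inl a) ^ i \<le> 1" "norm (w $ Inr b) ^ j \<le> 1"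
      using coord[OF that] by (intro power_le_one less_imp_le norm_ge_zero; simp)+
    then show ?thesis
      unfolding m_def complex_mod_cnj norm_mult norm_power by (intro mult_le_one) auto
  qed
  have mem: "embed2 a b (w $ Inl a) (w $ Inr b) \<in> E p" if "w \<in> E p" for w
    by (rule E_mono[OF p that]) (auto simp: embed2_nth)
  have mem': "norm (w $ Inl a) < 1" "norm (w $ Inr b) < fibre_radius p (norm (w $ Inl a))" if "w \<in> E p" for w
    using mem[OF that] p by (simp_all add: embed2_in_E)
  define F1 where "F1 w = f w * m w" for w
  define F2 where "F2 w = \<phi> (w $ Inl a) (w $ Inr b) * m w" for w
  define F3 where "F3 w = taylor_coeff (\<phi> (w $ Inl a)) j * w $ Inr b ^ j * m w" for w
  define F4 where "F4 w = coeff2 i j * of_real (mono2 a b i j w)" for w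
  note avg = average_over_rotations[OF open_E[OF p] rotate_coords_orthogonal rotate_coords_continuous rotate_coords_E[OF p]]
  have c1: "continuous_on (E p) F1" unfolding F1_def by (intro continuous_intros contf m_cont)
  have i1: "set_integrable lborel (E p) F1"
    unfolding F1_def
    by (rule set_integrable_bounded_mult[OF open_E[OF p] contf bergman_space_integrable[OF p f] m_cont m_bound])
  have r1: "((\<lambda>t. F1 (rotate_coords (- {Inl a, Inr b}) t w)) has_integral 2 * pi * F2 w) {0..2 * pi}"
    if "w \<in> E p" for w
    using has_integral_mult_left[OF average_other_coords[OF p hol that, of a b], of "m w"]
    by (simp add: F1_def F2_def m_def \<phi>_def mult.assoc)
  note 1 = avg[OF c1 i1 r1]
  have c2: "continuous_on (E p) F2"
    unfolding F2_def by (intro continuous_intros m_cont cont_compose mem')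
  have r2: "((\<lambda>t. F2 (rotate_coords {Inr b} t w)) has_integral 2 * pi * F3 w) {0..2 * pi}"
    if w: "w \<in> E p" for w
  proof -
    have "((\<lambda>t. \<phi> (w $ Inl a) (cis t * w $ Inr b) * cnj (cis t) ^ j) has_integral
        2 * pi * (taylor_coeff (\<phi> (w $ Inl a)) j * w $ Inr b ^ j)) {0..2 * pi}"
      using mem'[OF w] by (intro taylor_coeff_average[OF hol_snd]) auto
    from has_integral_mult_left[OF this, of "m w"] show ?thesis
      by (simp add: F2_def F3_def m_def power_mult_distrib mult_ac)
  qed
  note 2 = avg[OF c2 1(1) r2]
  have c3: "continuous_on (E p) F3"
    unfolding F3_def
    by (intro continuous_intros m_cont continuous_on_compose2[OF holomorphic_on_imp_continuous_on[OF coeff_holomorphic]])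
       (use mem'(1) in auto)
  have r3: "((\<lambda>t. F3 (rotate_coords {Inl a} t w)) has_integral 2 * pi * F4 w) {0..2 * pi}"
    if w: "w \<in> E p" for w
  proof -
    have "((\<lambda>t. taylor_coeff (\<phi> (cis t * w $ Inl a)) j * cnj (cis t) ^ i) has_integral
        2 * pi * (coeff2 i j * w $ Inl a ^ i)) {0..2 * pi}"
      unfolding coeff2_def using mem'(1)[OF w] by (intro taylor_coeff_average[OF coeff_holomorphic]) auto
    moreover have "w $ Inl a ^ i * w $ Inr b ^ j * m w = of_real (mono2 a b i j w)"
    proof -
      have "of_real (mono2 a b i j w) = (of_real ((cmod (w $ Inl a))\<^sup>2)) ^ i * (of_real ((cmod (w $ Inr b))\<^sup>2) :: complex) ^ j"
        by (simp add: mono2_def power_mult)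
      then show ?thesis
        unfolding complex_norm_square by (simp add: m_def power_mult_distrib mult_ac)
    qed
    then have "2 * pi * (coeff2 i j * w $ Inl a ^ i) * (w $ Inr b ^ j * m w) = 2 * pi * F4 w"
      by (simp add: F4_def mult_ac)
    ultimately show ?thesis
      using has_integral_mult_left[of "\<lambda>t. taylor_coeff (\<phi> (cis t * w $ Inl a)) j * cnj (cis t) ^ i"
          "2 * pi * (coeff2 i j * w $ Inl a ^ i)" "{0..2 * pi}" "w $ Inr b ^ j * m w"]
      by (simp add: F3_def m_def power_mult_distrib mult_ac)
  qed
  note 3 = avg[OF c3 2(1) r3]
  have "(LINT w:E p|lborel. F4 w) = coeff2 i j * of_real (LINT w:E p|lborel. mono2 a b i j w)"
    unfolding F4_def by (simp add: set_lebesgue_integral_def scaleR_conv_of_real mult.left_commute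
        flip: of_real_mult)
  with 1 2 3 show ?thesis
    by (simp add: F1_def m_def \<phi>_def)
qed

lemma binomial_series_powr:
  assumes "norm (x::complex) < 1"
  shows "(\<lambda>i. of_real (pochhammer B i / fact i) * x ^ i) sums (1 - x) powr (- of_real B)"
proof -
  have "(\<lambda>i. ((- of_real B) gchoose i) * (- x) ^ i) sums (1 + - x) powr (- of_real B)"
    using assms by (intro gen_binomial_complex) simp
  moreover have "((- of_real B) gchoose i) * (- x) ^ i = of_real (pochhammer B i / fact i) * x ^ i" for i
  proof -
    have "((- of_real B) gchoose i) * (- x) ^ i = ((-1) ^ i * (-1) ^ i) * (pochhammer (of_real B) i / fact i) * x ^ i"
      unfolding power_minus[of x] by (simp add: gbinomial_pochhammer)
    also have "(-1) ^ i * (-1) ^ i = (1::complex)" by (simp flip: power_mult_distrib)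
    finally show ?thesis by (simp add: pochhammer_of_real)
  qed
  ultimately show ?thesis by simp
qed

text \<open>Says that the coefficient of X^i Y^j in the kernel is the reciprocal of the squared norm
  of the monomial with exponents i and j in one coordinate of each block, for all i and j at once.
  The type tokens carry the dimensions.\<close>

definition is_kernel_constant :: "real \<Rightarrow> 'n::finite itself \<Rightarrow> 'k::finite itself \<Rightarrow> real \<Rightarrow> bool"
  where "is_kernel_constant p N K \<kappa> \<longleftrightarrow> \<kappa> > 0 \<and>
    (\<forall>(a::'n) (b::'k) i j. \<kappa> * ecoeff p CARD('n) CARD('k) j *
      (pochhammer (real CARD('n) + 1 + (real j + real CARD('k)) / p) i / fact i) *
      (LINT w:E p|lborel. mono2 a b i j w) = 1)"

text \<open>With x = (j + k)/p, both Pochhammer symbols are quotients of Gamma values: Gamma (x + 1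
  + n) cancels between them, and the other two cancel against the moment.\<close>

lemma kernel_constant_exists:
  assumes p: "p > 0"
  shows "\<exists>\<kappa>. is_kernel_constant p TYPE('n::finite) TYPE('k::finite) \<kappa>"
proof -
  obtain \<kappa> where \<kappa>: "\<kappa> > 0"
    "\<And>(a::'n) (b::'k) i j. (LINT w:E p|lborel. mono2 a b i j w) =
       fact i * fact j * Gamma ((real j + real CARD('k)) / p + 1) /
       (\<kappa> * fact (j + CARD('k)) * Gamma (real i + real CARD('n) + (real j + real CARD('k)) / p + 1))"
    using moments_E[OF p] by metis
  have "\<kappa> * ecoeff p CARD('n) CARD('k) j *
      (pochhammer (real CARD('n) + 1 + (real j + real CARD('k)) / p) i / fact i) *
      (LINT w:E p|lborel. mono2 a b i j w) = 1" for a :: 'n and b :: 'k and i j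
  proof -
    define x where "x = (real j + real CARD('k)) / p"
    have x: "x > 0" using p by (auto simp: x_def intro!: divide_pos_pos add_nonneg_pos)
    have nn: "y \<notin> \<int>\<^sub>\<le>\<^sub>0" if "y > 0" for y :: real
      using that by (auto elim!: nonpos_Ints_cases)
    have G: "Gamma (x + 1) > 0" "Gamma (x + 1 + real CARD('n)) > 0" "Gamma (real i + real CARD('n) + x + 1) > 0"
      using x by (auto intro!: Gamma_real_pos add_nonneg_pos)
    have "pochhammer (x + 1) CARD('n) = Gamma (x + 1 + real CARD('n)) / Gamma (x + 1)"
      using x by (intro pochhammer_Gamma nn) auto
    moreover have "pochhammer (real CARD('n) + 1 + x) i = Gamma (real i + real CARD('n) + x + 1) / Gamma (x + 1 + real CARD('n))"
      using x pochhammer_Gamma[OF nn, of "real CARD('n) + 1 + x" i] by (simp add: add_ac)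
    ultimately show ?thesis
      unfolding \<kappa>(2) ecoeff_def x_def[symmetric] using G \<kappa>(1) by simp
  qed
  with \<kappa>(1) show ?thesis unfolding is_kernel_constant_def by blast
qed

text \<open>At such a point X and Y involve only the entries a and b. Termwise integration of the
  series in j and, within each term, of the binomial series in i turns the integral into the
  iterated Taylor series of f.\<close>

lemma reproducing_axis:
  fixes f :: "complex^('n::finite + 'k::finite) \<Rightarrow> complex" and a :: 'n and b :: 'k
  assumes p: "p > 0" and f: "f \<in> bergman_space (E p)"
    and \<kappa>: "is_kernel_constant p TYPE('n) TYPE('k) \<kappa>"
    and w: "embed2 a b \<rho> \<tau> \<in> E p"
  shows "f (embed2 a b \<rho> \<tau>) = (LINT z:E p|lborel. f z * cnj (ekernel \<kappa> p z (embed2 a b \<rho> \<tau>)))"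
proof -
  let ?w = "embed2 a b \<rho> \<tau>" and ?E = "E p :: (complex^('n + 'k)) set"
  have hol: "holomorphic_several f ?E" using f by (simp add: bergman_space_def)
  define \<phi> where "\<phi> = (\<lambda>z \<xi>. f (embed2 a b z \<xi>))"
  interpret two_variable_holomorphic \<phi> "fibre_radius p"
    unfolding \<phi>_def by (rule E_two_variable_holomorphic[OF p hol])
  have contf: "continuous_on ?E f" by (rule holomorphic_several_continuous[OF hol])
  note intf = bergman_space_integrable[OF p f]
  have h: "herm1 z ?w = z $ Inl a * cnj \<rho>" "herm2 z ?w = z $ Inr b * cnj \<tau>" for z
    by (simp_all add: herm1_def herm2_def embed2_def hprod_axis)
  have \<rho>: "norm \<rho> < 1" "norm \<tau> < fibre_radius p (norm \<rho>)" using w p by (simp_all add: embed2_in_E)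
  define B where "B j = real CARD('n) + 1 + (real j + real CARD('k)) / p" for j
  have B: "B j > 0" for j using p by (auto simp: B_def intro!: add_pos_nonneg)
  have zn: "norm (z $ l) < 1" if "z \<in> ?E" for z l using E_bounds(3)[OF p that] .
  have z\<rho>: "norm (z $ Inl a * cnj \<rho>) \<le> norm \<rho>" if "z \<in> ?E" for z
    using zn[OF that, of "Inl a"] by (simp add: norm_mult mult_left_le_one_le less_imp_le)
  have z\<rho>1: "norm (z $ Inl a * cnj \<rho>) < 1" if "z \<in> ?E" for z
    using z\<rho>[OF that] \<rho>(1) by linarith
  define T where "T j z = (1 - z $ Inl a * cnj \<rho>) powr (- of_real (B j)) * (z $ Inr b * cnj \<tau>) ^ j" for j and z :: "complex^('n + 'k)"
  have cont_powr: "continuous_on ?E (\<lambda>z. (1 - z $ Inl a * cnj \<rho>) powr c)" for c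
    using one_minus_herm1_not_nonpos[OF p _ w] unfolding h
    by (intro continuous_on_powr_complex continuous_intros) (auto simp: complex_nonpos_Reals_iff)
  have contT: "continuous_on ?E (T j)" for j
    unfolding T_def by (intro continuous_intros cont_powr)
  define c where "c j = \<kappa> * ecoeff p CARD('n) CARD('k) j" for j
  have c_pos: "c j > 0" for j
    using \<kappa> ecoeff_pos[OF p] by (simp add: c_def is_kernel_constant_def)
  have K_sums: "(\<lambda>j. of_real (c j) * T j z) sums ekernel \<kappa> p z ?w" if "z \<in> ?E" for z
    using ekernel_sums[OF p that w, of \<kappa>] by (simp only: h T_def B_def c_def)
  have inner: "(LINT z:?E|lborel. f z * cnj (of_real (c j) * T j z)) = taylor_coeff (\<phi> \<rho>) j * \<tau> ^ j" for j
  proof -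
    define d where "d i = pochhammer (B j) i / fact i" for i
    have d: "d i > 0" for i using B by (auto simp: d_def intro!: divide_pos_pos pochhammer_pos)
    have ser: "(\<lambda>i. of_real (d i) * x ^ i) sums (1 - x) powr (- of_real (B j))" if "norm x < 1" for x :: complex
      unfolding d_def using that by (rule binomial_series_powr)
    have "summable (\<lambda>i. d i * norm \<rho> ^ i)"
    proof -
      have "summable (\<lambda>i. of_real (d i) * of_real (norm \<rho>) ^ i :: complex)"
        using ser[of "of_real (norm \<rho>)"] \<rho>(1) by (simp add: sums_iff)
      then show ?thesis by (simp flip: of_real_power of_real_mult add: summable_complex_of_real)
    qed
    then have summ: "summable (\<lambda>i. c j * norm \<tau> ^ j * (d i * norm \<rho> ^ i))"
      by (rule summable_mult)
    define U where "U i z = cnj (of_real (c j) * (of_real (d i) * (z $ Inl a * cnj \<rho>) ^ i * (z $ Inr b * cnj \<tau>) ^ j))"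
      for i and z :: "complex^('n + 'k)"
    have U_cont: "continuous_on ?E (U i)" for i unfolding U_def by (intro continuous_intros)
    have U_bound: "norm (U i z) \<le> c j * norm \<tau> ^ j * (d i * norm \<rho> ^ i)" if z: "z \<in> ?E" for i z
    proof -
      have "norm (z $ Inr b * cnj \<tau>) \<le> norm \<tau>"
        using zn[OF z, of "Inr b"] by (simp add: norm_mult mult_left_le_one_le less_imp_le)
      then have "norm (z $ Inr b * cnj \<tau>) ^ j \<le> norm \<tau> ^ j" by (rule power_mono) simp
      moreover have "norm (z $ Inl a * cnj \<rho>) ^ i \<le> norm \<rho> ^ i" using z\<rho>[OF z] by (rule power_mono) simp
      ultimately have "norm (z $ Inr b * cnj \<tau>) ^ j * norm (z $ Inl a * cnj \<rho>) ^ i \<le> norm \<tau> ^ j * norm \<rho> ^ i"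
        by (rule mult_mono) auto
      then have "c j * d i * (norm (z $ Inr b * cnj \<tau>) ^ j * norm (z $ Inl a * cnj \<rho>) ^ i) \<le> c j * d i * (norm \<tau> ^ j * norm \<rho> ^ i)"
        using c_pos[of j] d[of i] by (intro mult_left_mono) auto
      moreover have "norm (U i z) = c j * d i * (norm (z $ Inr b * cnj \<tau>) ^ j * norm (z $ Inl a * cnj \<rho>) ^ i)"
        unfolding U_def complex_mod_cnj norm_mult[of "of_real _"] norm_mult[of _ "_ ^ j"] norm_power norm_of_real
        using c_pos[of j] d[of i] by simp
      ultimately show ?thesis
        by (simp only: mult_ac)
    qed
    have U_sums: "(\<lambda>i. U i z) sums cnj (of_real (c j) * T j z)" if z: "z \<in> ?E" for z
        unfolding U_def T_def by (rule sums_cnj[THEN iffD2], rule sums_mult, rule sums_mult2, rule ser, rule z\<rho>1[OF z])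
    have "(\<lambda>i. LINT z:?E|lborel. f z * U i z) sums (LINT z:?E|lborel. f z * cnj (of_real (c j) * T j z))"
      by (rule set_integral_sums_bounded[OF open_E[OF p] contf intf U_cont U_bound summ U_sums])
    moreover have "(LINT z:?E|lborel. f z * U i z) = taylor_coeff (\<lambda>z. taylor_coeff (\<phi> z) j) i * \<rho> ^ i * \<tau> ^ j" for i
    proof -
      have "(LINT z:?E|lborel. f z * U i z)
        = (LINT z:?E|lborel. of_real (c j * d i) * \<rho> ^ i * \<tau> ^ j * (f z * cnj (z $ Inl a ^ i * z $ Inr b ^ j)))"
        by (simp add: U_def power_mult_distrib mult_ac)
      also have "\<dots> = of_real (c j * d i) * \<rho> ^ i * \<tau> ^ j * (coeff2 i j * of_real (LINT w:?E|lborel. mono2 a b i j w))"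
        using integral_against_monomial[OF p f, of a i b j] by (simp add: \<phi>_def)
      also have "\<dots> = of_real (c j * d i * (LINT w:?E|lborel. mono2 a b i j w)) * (coeff2 i j * \<rho> ^ i * \<tau> ^ j)"
        by simp
      also have "c j * d i * (LINT w:?E|lborel. mono2 a b i j w) = 1"
        using \<kappa> by (simp add: is_kernel_constant_def c_def d_def B_def)
      finally show ?thesis by (simp add: coeff2_def)
    qed
    ultimately have "(\<lambda>i. taylor_coeff (\<lambda>z. taylor_coeff (\<phi> z) j) i * \<rho> ^ i * \<tau> ^ j) sums
        (LINT z:?E|lborel. f z * cnj (of_real (c j) * T j z))" by simp
    moreover have "(\<lambda>i. taylor_coeff (\<lambda>z. taylor_coeff (\<phi> z) j) i * \<rho> ^ i * \<tau> ^ j) sums (taylor_coeff (\<phi> \<rho>) j * \<tau> ^ j)"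
      using \<rho>(1) by (intro sums_mult2 taylor_coeff_sums[OF coeff_holomorphic]) auto
    ultimately show ?thesis by (rule sums_unique2)
  qed
  define q where "q = contraction p ?w"
  have q: "0 \<le> q" "q < 1" using contraction_bounds[OF p w] by (simp_all add: q_def)
  \<comment> \<open>M collects \<kappa> and a bound for the leading power of 1 - X, valid since |1 -
    X| \<ge> 1 - |\<rho>|; what remains of the j-th term is at most its coefficient times q^j,
    uniformly in z.\<close>
  define M where "M = (1 - norm \<rho>) powr (- (real CARD('n) + 1 + real CARD('k) / p)) * \<kappa>"
  have summ: "summable (\<lambda>j. M * (ecoeff p CARD('n) CARD('k) j * q ^ j))"
    by (intro summable_mult ecoeff_summable p q)
  have V_cont: "continuous_on ?E (\<lambda>z. cnj (of_real (c j) * T j z))" for j by (intro continuous_intros contT)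
  have V_sums: "(\<lambda>j. cnj (of_real (c j) * T j z)) sums cnj (ekernel \<kappa> p z ?w)" if "z \<in> ?E" for z
      using K_sums[OF that] by (rule sums_cnj[THEN iffD2])
  have V_bound: "norm (cnj (of_real (c j) * T j z)) \<le> M * (ecoeff p CARD('n) CARD('k) j * q ^ j)"
    if z: "z \<in> ?E" for j z
  proof -
    define y where "y = norm (1 - z $ Inl a * cnj \<rho>)"
    have y: "1 - norm \<rho> \<le> y"
      using norm_triangle_ineq2[of 1 "z $ Inl a * cnj \<rho>"] z\<rho>[OF z] by (simp add: y_def)
    then have y0: "y > 0" using \<rho>(1) by linarith
    have "norm (T j z) = y powr (- B j) * norm (z $ Inr b * cnj \<tau>) ^ j"
      unfolding T_def norm_mult[of "_ powr _"] norm_power y_def by (subst norm_powr_real_powr') auto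
    also have "y powr (- B j) = y powr (- (real CARD('n) + 1 + real CARD('k) / p)) * (y powr (- (1 / p))) ^ j"
      using y0 by (simp add: B_def powr_power powr_add[symmetric] add_divide_distrib algebra_simps)
    also have "\<dots> * norm (z $ Inr b * cnj \<tau>) ^ j
      = y powr (- (real CARD('n) + 1 + real CARD('k) / p)) * (norm (z $ Inr b * cnj \<tau>) * y powr (- (1 / p))) ^ j"
      by (simp only: power_mult_distrib mult_ac)
    also have "\<dots> \<le> (1 - norm \<rho>) powr (- (real CARD('n) + 1 + real CARD('k) / p)) * q ^ j"
    proof (intro mult_mono power_mono)
      show "y powr (- (real CARD('n) + 1 + real CARD('k) / p)) \<le> (1 - norm \<rho>) powr (- (real CARD('n) + 1 + real CARD('k) / p))"
      proof (rule powr_mono2')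
        have "0 \<le> real CARD('k) / p" using p by simp
        then show "- (real CARD('n) + 1 + real CARD('k) / p) \<le> 0" by linarith
      qed (use y \<rho>(1) in auto)
      show "norm (z $ Inr b * cnj \<tau>) * y powr (- (1 / p)) \<le> q"
        using kernel_argument_bound(3)[OF p z w] by (simp only: h y_def q_def)
    qed (auto simp: q)
    finally have "norm (T j z) \<le> (1 - norm \<rho>) powr (- (real CARD('n) + 1 + real CARD('k) / p)) * q ^ j" .
    then have "c j * norm (T j z) \<le> c j * ((1 - norm \<rho>) powr (- (real CARD('n) + 1 + real CARD('k) / p)) * q ^ j)"
      using c_pos[of j] by (intro mult_left_mono) auto
    moreover have "norm (cnj (of_real (c j) * T j z)) = c j * norm (T j z)"
      using c_pos[of j] by (simp add: norm_mult)
    ultimately show ?thesis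
      by (simp only: M_def c_def mult_ac)
  qed
  have "(\<lambda>j. LINT z:?E|lborel. f z * cnj (of_real (c j) * T j z)) sums
      (LINT z:?E|lborel. f z * cnj (ekernel \<kappa> p z ?w))"
    by (rule set_integral_sums_bounded[OF open_E[OF p] contf intf V_cont V_bound summ V_sums])
  then have int_sums: "(\<lambda>j. taylor_coeff (\<phi> \<rho>) j * \<tau> ^ j) sums (LINT z:?E|lborel. f z * cnj (ekernel \<kappa> p z ?w))"
    by (simp only: inner)
  have "(\<lambda>j. taylor_coeff (\<phi> \<rho>) j * \<tau> ^ j) sums \<phi> \<rho> \<tau>"
    using \<rho> by (intro taylor_coeff_sums[OF hol_snd]) auto
  from sums_unique2[OF this int_sums] show ?thesis by (simp add: \<phi>_def)
qed

section \<open>The kernel as an element of the Bergman space\<close>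

lemma holomorphic_several_cong:
  assumes "open D" "holomorphic_several f D" "\<And>w. w \<in> D \<Longrightarrow> f w = g w"
  shows "holomorphic_several g D"
  unfolding holomorphic_several_def
proof
  fix w assume w: "w \<in> D"
  then obtain f' where "(f has_derivative f') (at w)" "\<forall>c v. f' (c *s v) = c * f' v"
    using assms(2) unfolding holomorphic_several_def by blast
  moreover from this(1) have "(g has_derivative f') (at w)"
    by (rule has_derivative_transform_within_open[OF _ assms(1) w assms(3)])
  ultimately show "\<exists>f'. (g has_derivative f') (at w) \<and> (\<forall>c v. f' (c *s v) = c * f' v)"
    by blast
qed

lemma holomorphic_several_linear:
  assumes "bounded_linear L" "\<And>c v. L (c *s v) = c * L v"
  shows "holomorphic_several L D"
  unfolding holomorphic_several_def
  using bounded_linear_imp_has_derivative[OF assms(1)] assms(2) by blast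

lemma holomorphic_several_compose:
  assumes "holomorphic_several f D" "\<And>w. w \<in> D \<Longrightarrow> g field_differentiable at (f w)"
  shows "holomorphic_several (\<lambda>w. g (f w)) D"
  unfolding holomorphic_several_def
proof
  fix w assume w: "w \<in> D"
  obtain f' where f': "(f has_derivative f') (at w)" "\<And>c v. f' (c *s v) = c * f' v"
    using assms(1) w unfolding holomorphic_several_def by blast
  obtain d where "(g has_field_derivative d) (at (f w))"
    using assms(2)[OF w] by (auto simp: field_differentiable_def)
  then have "(g has_derivative (\<lambda>h. d * h)) (at (f w))" by (simp add: has_field_derivative_def)
  from has_derivative_compose[OF f'(1) this] f'(2)
  show "\<exists>f'. ((\<lambda>w. g (f w)) has_derivative f') (at w) \<and> (\<forall>c v. f' (c *s v) = c * f' v)"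
    by (intro exI[of _ "\<lambda>v. d * f' v"]) (simp add: mult.left_commute)
qed

lemma holomorphic_several_mult:
  assumes "holomorphic_several f D" "holomorphic_several g D"
  shows "holomorphic_several (\<lambda>w. f w * g w) D"
  unfolding holomorphic_several_def
proof
  fix w assume w: "w \<in> D"
  obtain f' where f': "(f has_derivative f') (at w)" "\<And>c v. f' (c *s v) = c * f' v"
    using assms(1) w unfolding holomorphic_several_def by blast
  obtain g' where g': "(g has_derivative g') (at w)" "\<And>c v. g' (c *s v) = c * g' v"
    using assms(2) w unfolding holomorphic_several_def by blast
  from has_derivative_mult[OF f'(1) g'(1)] f'(2) g'(2)
  show "\<exists>f'. ((\<lambda>w. f w * g w) has_derivative f') (at w) \<and> (\<forall>c v. f' (c *s v) = c * f' v)"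
    by (intro exI[of _ "\<lambda>h. f w * g' h + f' h * g w"]) (simp add: algebra_simps)
qed

lemma holomorphic_several_diff:
  assumes "holomorphic_several f D" "holomorphic_several g D"
  shows "holomorphic_several (\<lambda>w. f w - g w) D"
  unfolding holomorphic_several_def
proof
  fix w assume w: "w \<in> D"
  obtain f' where f': "(f has_derivative f') (at w)" "\<And>c v. f' (c *s v) = c * f' v"
    using assms(1) w unfolding holomorphic_several_def by blast
  obtain g' where g': "(g has_derivative g') (at w)" "\<And>c v. g' (c *s v) = c * g' v"
    using assms(2) w unfolding holomorphic_several_def by blast
  from has_derivative_diff[OF f'(1) g'(1)] f'(2) g'(2)
  show "\<exists>f'. ((\<lambda>w. f w - g w) has_derivative f') (at w) \<and> (\<forall>c v. f' (c *s v) = c * f' v)"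
    by (intro exI[of _ "\<lambda>h. f' h - g' h"]) (simp add: algebra_simps)
qed

lemma herm_add_left: "herm1 (x + y) w = herm1 x w + herm1 y w" "herm2 (x + y) w = herm2 x w + herm2 y w"
  by (simp_all add: herm1_def herm2_def hprod_def sum.distrib distrib_right)

lemma herm_scale_left: "herm1 (c *s x) w = c * herm1 x w" "herm2 (c *s x) w = c * herm2 x w"
  by (simp_all add: herm1_def herm2_def hprod_def sum_distrib_left mult.assoc)

lemma bounded_linear_herm: "bounded_linear (\<lambda>z. herm1 z w)" "bounded_linear (\<lambda>z. herm2 z w)"
proof -
  have s: "r *\<^sub>R x = complex_of_real r *s x" for r and x :: "complex^('a + 'b)"
    unfolding vec_eq_iff vector_scaleR_component by (simp add: scaleR_conv_of_real)
  have "linear (\<lambda>z. herm1 z w)" "linear (\<lambda>z. herm2 z w)"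
    by (intro linearI; simp add: herm_add_left herm_scale_left s scaleR_conv_of_real)+
  then show "bounded_linear (\<lambda>z. herm1 z w)" "bounded_linear (\<lambda>z. herm2 z w)"
    by (simp_all add: linear_conv_bounded_linear)
qed

lemma eseries_field_differentiable:
  assumes "p > 0" "norm x < 1" shows "eseries p n k field_differentiable at x"
  using eseries_holomorphic[OF assms(1), of n k] assms(2)
  by (auto simp: holomorphic_on_def at_within_open[of _ "ball 0 1"])

lemma ekernel_holomorphic:
  fixes w :: "complex^('n::finite + 'k::finite)"
  assumes p: "p > 0" and w: "w \<in> E p"
  shows "holomorphic_several (\<lambda>z. ekernel \<kappa> p z w) (E p)"
proof -
  have h: "holomorphic_several (\<lambda>z. herm1 z w) (E p)" "holomorphic_several (\<lambda>z. herm2 z w) (E p)"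
    by (intro holomorphic_several_linear bounded_linear_herm; simp add: herm_scale_left)+
  have pw: "holomorphic_several (\<lambda>z. (1 - herm1 z w) powr c) (E p)" for c
  proof (rule holomorphic_several_compose[OF h(1)])
    fix z :: "complex^('n + 'k)" assume z: "z \<in> E p"
    have "((\<lambda>x. (1 - x) powr c) has_field_derivative (c * (1 - herm1 z w) powr (c - 1) * - 1)) (at (herm1 z w))"
      by (rule DERIV_chain2[of "\<lambda>x. x powr c"])
         (use one_minus_herm1_not_nonpos[OF p z w] in \<open>auto intro!: has_field_derivative_powr derivative_eq_intros\<close>)
    then show "(\<lambda>x. (1 - x) powr c) field_differentiable at (herm1 z w)"
      by (auto simp: field_differentiable_def)
  qed
  have es: "holomorphic_several (\<lambda>z. eseries p CARD('n) CARD('k) (herm2 z w * (1 - herm1 z w) powr (- of_real (1 / p)))) (E p)"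
  proof (rule holomorphic_several_compose[OF holomorphic_several_mult[OF h(2) pw]])
    fix z :: "complex^('n + 'k)" assume z: "z \<in> E p"
    show "eseries p CARD('n) CARD('k) field_differentiable at (herm2 z w * (1 - herm1 z w) powr (- of_real (1 / p)))"
      using ekernel_argument_less_1[OF p z w] contraction_bounds(2)[OF p w]
      by (intro eseries_field_differentiable p) linarith
  qed
  have "holomorphic_several (\<lambda>z. of_real \<kappa> * (1 - herm1 z w) powr (- of_real (real CARD('n) + 1 + real CARD('k) / p))) (E p)"
    by (rule holomorphic_several_compose[OF pw, of "\<lambda>x. of_real \<kappa> * x"]) (auto intro!: derivative_intros)
  from holomorphic_several_mult[OF this es] show ?thesis
    unfolding ekernel_def .
qed

text \<open>For fixed w the argument of the series stays in a closed disc of radius q < 1, and |1 -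
  X| stays away from 0. As the volume is finite, such a bound yields square integrability.\<close>

lemma ekernel_bounded:
  fixes w :: "complex^('n::finite + 'k::finite)"
  assumes p: "p > 0" and w: "w \<in> E p"
  obtains B where "\<And>z. z \<in> E p \<Longrightarrow> norm (ekernel \<kappa> p z w) \<le> B"
proof -
  define q where "q = contraction p w"
  have q: "0 \<le> q" "q < 1" using contraction_bounds[OF p w] by (simp_all add: q_def)
  have "continuous_on (cball 0 q) (eseries p CARD('n) CARD('k))"
    using q by (intro continuous_on_subset[OF holomorphic_on_imp_continuous_on[OF eseries_holomorphic[OF p]]]) auto
  then have "bounded (eseries p CARD('n) CARD('k) ` cball 0 q)"
    by (intro compact_imp_bounded compact_continuous_image) auto
  then obtain S where "\<forall>x\<in>cball 0 q. norm (eseries p CARD('n) CARD('k) x) \<le> S"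
    by (auto simp: bounded_iff)
  then have S: "norm (eseries p CARD('n) CARD('k) x) \<le> S" if "norm x \<le> q" for x
    using that by simp
  define A where "A = real CARD('n) + 1 + real CARD('k) / p"
  have A: "A \<ge> 0" using p by (simp add: A_def)
  show thesis
  proof (rule that)
    fix z :: "complex^('n + 'k)" assume z: "z \<in> E p"
    note kb = kernel_argument_bound[OF p z w]
    have "1 - sqrt (nsq1 w) \<le> norm (1 - herm1 z w)"
      using kb(1) norm_triangle_ineq2[of 1 "herm1 z w"] by simp
    then have "norm ((1 - herm1 z w) powr (- of_real A)) \<le> (1 - sqrt (nsq1 w)) powr (- A)"
      using kb(2) A by (subst norm_powr_real_powr') (auto intro!: powr_mono2')
    moreover have "norm (eseries p CARD('n) CARD('k) (herm2 z w * (1 - herm1 z w) powr (- of_real (1 / p)))) \<le> S"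
      using ekernel_argument_less_1[OF p z w] by (intro S) (simp only: q_def)
    ultimately show "norm (ekernel \<kappa> p z w) \<le> \<bar>\<kappa>\<bar> * (1 - sqrt (nsq1 w)) powr (- A) * S"
      unfolding ekernel_def norm_mult norm_of_real A_def[symmetric]
      by (intro mult_mono) auto
  qed
qed

lemma ekernel_in_bergman_space:
  fixes w :: "complex^('n::finite + 'k::finite)"
  assumes p: "p > 0" and w: "w \<in> E p"
  shows "(\<lambda>z. ekernel \<kappa> p z w) \<in> bergman_space (E p)"
proof -
  let ?E = "E p :: (complex^('n + 'k)) set"
  have hol: "holomorphic_several (\<lambda>z. ekernel \<kappa> p z w) ?E" by (rule ekernel_holomorphic[OF p w])
  note cont = holomorphic_several_continuous[OF hol]
  obtain B where B: "\<And>z. z \<in> ?E \<Longrightarrow> norm (ekernel \<kappa> p z w) \<le> B"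
    using ekernel_bounded[OF p w] by blast
  have "set_integrable lborel ?E (\<lambda>z. (1::complex))"
    unfolding set_integrable_def
    using borel_open[OF open_E[OF p]] emeasure_bounded_finite[OF bounded_E[OF p]]
    by (intro integrable_scaleR_left integrable_real_indicator) auto
  then have "set_integrable lborel ?E (\<lambda>z. 1 * of_real ((cmod (ekernel \<kappa> p z w))\<^sup>2) :: complex)"
  proof (rule set_integrable_bounded_mult[OF open_E[OF p] continuous_on_const])
    show "continuous_on ?E (\<lambda>z. of_real ((cmod (ekernel \<kappa> p z w))\<^sup>2) :: complex)"
      by (intro continuous_intros cont)
    show "norm (of_real ((cmod (ekernel \<kappa> p z w))\<^sup>2) :: complex) \<le> B\<^sup>2" if "z \<in> ?E" for z
      using power_mono[OF B[OF that], of 2] by (simp only: norm_of_real) simp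
  qed
  then have "integrable lborel (\<lambda>z. Re (indicator ?E z *\<^sub>R (1 * of_real ((cmod (ekernel \<kappa> p z w))\<^sup>2) :: complex)))"
    unfolding set_integrable_def by (rule integrable_Re)
  then have "set_integrable lborel ?E (\<lambda>z. (cmod (ekernel \<kappa> p z w))\<^sup>2)"
    unfolding set_integrable_def by simp
  with hol show ?thesis by (simp add: bergman_space_def)
qed

section \<open>From points with two nonzero coordinates to all points\<close>

definition reflect2 :: "complex^'n \<Rightarrow> complex^'k \<Rightarrow> complex^('n::finite + 'k::finite) \<Rightarrow> complex^('n + 'k)"
  where "reflect2 x y z = join (reflect x (lpart z)) (reflect y (rpart z))"

lemma herm_reflect2:
  "herm1 (reflect2 x y z) (reflect2 x y w) = herm1 z w"
  "herm2 (reflect2 x y z) (reflect2 x y w) = herm2 z w"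
  by (simp_all add: herm1_def herm2_def reflect2_def hprod_reflect)

lemma reflect2_reflect2 [simp]: "reflect2 x y (reflect2 x y z) = z"
  by (simp add: reflect2_def reflect_reflect)

lemma reflect2_add: "reflect2 x y (z + w) = reflect2 x y z + reflect2 x y w"
proof -
  have "lpart (z + w) = lpart z + lpart w" "rpart (z + w) = rpart z + rpart w" by (simp_all add: vec_eq_iff)
  then show ?thesis unfolding reflect2_def
    by (simp only: reflect_add) (simp add: vec_eq_iff join_def split: sum.split)
qed

lemma reflect2_scale: "reflect2 x y (c *s z) = c *s reflect2 x y z"
proof -
  have "lpart (c *s z) = c *s lpart z" "rpart (c *s z) = c *s rpart z" by (simp_all add: vec_eq_iff)
  then show ?thesis unfolding reflect2_def
    by (simp only: reflect_scale) (simp add: vec_eq_iff join_def split: sum.split)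
qed

lemma nsq_reflect2: "nsq1 (reflect2 x y z) = nsq1 z" "nsq2 (reflect2 x y z) = nsq2 z"
  using herm_reflect2[of x y z z] unfolding herm_self of_real_eq_iff by blast+

lemma reflect2_orthogonal: "orthogonal_transformation (reflect2 x y)"
  unfolding orthogonal_transformation
proof (intro conjI allI linearI reflect2_add)
  show "reflect2 x y (r *\<^sub>R z) = r *\<^sub>R reflect2 x y z" for r z
  proof -
    have s: "r *\<^sub>R v = complex_of_real r *s v" for v :: "complex^('a + 'b)"
      unfolding vec_eq_iff vector_scaleR_component by (simp add: scaleR_conv_of_real)
    show ?thesis unfolding s by (rule reflect2_scale)
  qed
  show "norm (reflect2 x y z) = norm z" for z
  proof -
    have "(norm (reflect2 x y z))\<^sup>2 = (norm z)\<^sup>2" by (simp add: norm_square_eq_nsq nsq_reflect2)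
    then show ?thesis by simp
  qed
qed

lemma reflect2_in_E [simp]: "reflect2 x y z \<in> E p \<longleftrightarrow> z \<in> E p"
  by (simp add: E_iff nsq_reflect2)

text \<open>A map that preserves both Hermitian products and is its own inverse is self-adjoint, so
  it moves across the kernel.\<close>

lemma ekernel_reflect2: "ekernel \<kappa> p (reflect2 x y z) w = ekernel \<kappa> p z (reflect2 x y w)"
proof -
  have "herm1 (reflect2 x y z) w = herm1 z (reflect2 x y w)" "herm2 (reflect2 x y z) w = herm2 z (reflect2 x y w)"
    using herm_reflect2[of x y z "reflect2 x y w"] by simp_all
  then show ?thesis by (simp add: ekernel_def)
qed

lemma bergman_space_reflect2:
  fixes f :: "complex^('a::finite + 'b::finite) \<Rightarrow> complex"
  assumes p: "p > 0" and f: "f \<in> bergman_space (E p)"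
  shows "(\<lambda>z. f (reflect2 x y z)) \<in> bergman_space (E p)"
proof -
  have hol: "holomorphic_several f (E p)" using f by (simp add: bergman_space_def)
  have "holomorphic_several (\<lambda>z. f (reflect2 x y z)) (E p)"
    unfolding holomorphic_several_def
  proof
    fix w :: "complex^('a + 'b)" assume "w \<in> E p"
    then have "reflect2 x y w \<in> E p" by simp
    then obtain f' where f': "(f has_derivative f') (at (reflect2 x y w))" "\<And>c v. f' (c *s v) = c * f' v"
      using hol unfolding holomorphic_several_def by blast
    have "bounded_linear (reflect2 x y)"
      using orthogonal_transformation_linear[OF reflect2_orthogonal] by (simp add: linear_conv_bounded_linear)
    then have "(reflect2 x y has_derivative reflect2 x y) (at w)"
      by (rule bounded_linear_imp_has_derivative)
    from has_derivative_compose[OF this f'(1)]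
    show "\<exists>f'. ((\<lambda>z. f (reflect2 x y z)) has_derivative f') (at w) \<and> (\<forall>c v. f' (c *s v) = c * f' v)"
      by (intro exI[of _ "\<lambda>v. f' (reflect2 x y v)"]) (simp add: reflect2_scale f'(2))
  qed
  moreover have "set_integrable lborel (E p) (\<lambda>z. (cmod (f (reflect2 x y z)))\<^sup>2)"
    by (subst set_integral_orthogonal(1)[OF open_E[OF p] reflect2_orthogonal, where F = "\<lambda>z. (cmod (f z))\<^sup>2"])
       (use f in \<open>auto simp: bergman_space_def intro!: continuous_intros holomorphic_several_continuous\<close>)
  ultimately show ?thesis by (simp add: bergman_space_def)
qed

lemma ekernel_reproducing:
  fixes f :: "complex^('n::finite + 'k::finite) \<Rightarrow> complex"
  assumes p: "p > 0" and f: "f \<in> bergman_space (E p)"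
    and \<kappa>: "is_kernel_constant p TYPE('n) TYPE('k) \<kappa>" and w: "w \<in> E p"
  shows "f w = (LINT z:E p|lborel. f z * cnj (ekernel \<kappa> p z w))"
proof -
  \<comment> \<open>A target axis is chosen arbitrarily in each block; the index types are
    nonempty.\<close>
  fix a :: 'n and b :: 'k
  obtain x where x: "\<And>i. i \<noteq> a \<Longrightarrow> reflect x (lpart w) $ i = 0" using reflect_to_axis by metis
  obtain y where y: "\<And>i. i \<noteq> b \<Longrightarrow> reflect y (rpart w) $ i = 0" using reflect_to_axis by metis
  let ?T = "reflect2 x y"
  define \<rho> \<tau> where "\<rho> = reflect x (lpart w) $ a" and "\<tau> = reflect y (rpart w) $ b"
  have Tw: "?T w = embed2 a b \<rho> \<tau>"
    by (auto simp: vec_eq_iff embed2_nth reflect2_def join_def \<rho>_def \<tau>_def x y split: sum.split)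
  have TwE: "?T w \<in> E p" using w by simp
  have contf: "continuous_on (E p) f"
    using f by (auto simp: bergman_space_def intro: holomorphic_several_continuous)
  have contK: "continuous_on (E p) (\<lambda>z. ekernel \<kappa> p z w)"
    by (rule holomorphic_several_continuous[OF ekernel_holomorphic[OF p w]])
  have "f w = f (?T (?T w))" by simp
  also have "\<dots> = (LINT z:E p|lborel. f (?T z) * cnj (ekernel \<kappa> p z (?T w)))"
    using reproducing_axis[OF p bergman_space_reflect2[OF p f, of x y] \<kappa>, of a b \<rho> \<tau>] TwE
    unfolding Tw by simp
  also have "\<dots> = (LINT z:E p|lborel. f (?T z) * cnj (ekernel \<kappa> p (?T z) w))"
    unfolding ekernel_reflect2 ..
  also have "\<dots> = (LINT z:E p|lborel. f z * cnj (ekernel \<kappa> p z w))"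
    by (rule set_integral_orthogonal(2)[OF open_E[OF p] reflect2_orthogonal, where F = "\<lambda>z. f z * cnj (ekernel \<kappa> p z w)"])
       (auto intro!: continuous_intros contf contK)
  finally show ?thesis .
qed

section \<open>Uniqueness of the Bergman kernel\<close>

lemma bergman_space_diff:
  assumes D: "open D" and f: "f \<in> bergman_space D" and g: "g \<in> bergman_space D"
  shows "(\<lambda>z. f z - g z) \<in> bergman_space D"
proof -
  have hol: "holomorphic_several f D" "holomorphic_several g D" using f g by (auto simp: bergman_space_def)
  note cont = hol[THEN holomorphic_several_continuous]
  have "integrable lborel (\<lambda>z. 2 * (indicator D z *\<^sub>R (cmod (f z))\<^sup>2) + 2 * (indicator D z *\<^sub>R (cmod (g z))\<^sup>2))"
    using f g unfolding bergman_space_def set_integrable_def by (intro Bochner_Integration.integrable_add integrable_mult_right) auto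
  then have "integrable lborel (\<lambda>z. indicator D z *\<^sub>R (cmod (f z - g z))\<^sup>2)"
  proof (rule Bochner_Integration.integrable_bound)
    have "(\<lambda>z. indicator D z *\<^sub>R (cmod (f z - g z))\<^sup>2) \<in> borel_measurable borel"
      using D cont by (intro borel_measurable_continuous_on_indicator continuous_intros) auto
    then show "(\<lambda>z. indicator D z *\<^sub>R (cmod (f z - g z))\<^sup>2) \<in> borel_measurable lborel"
      by simp
    have "(cmod (f z - g z))\<^sup>2 \<le> 2 * (cmod (f z))\<^sup>2 + 2 * (cmod (g z))\<^sup>2" for z
    proof -
      have "(cmod (f z - g z))\<^sup>2 \<le> (cmod (f z) + cmod (g z))\<^sup>2" by (intro power_mono norm_triangle_ineq4) auto
      also have "\<dots> \<le> 2 * (cmod (f z))\<^sup>2 + 2 * (cmod (g z))\<^sup>2"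
        using sum_squares_bound[of "cmod (f z)" "cmod (g z)"] by (simp add: power2_sum)
      finally show ?thesis .
    qed
    then show "AE z in lborel. norm (indicator D z *\<^sub>R (cmod (f z - g z))\<^sup>2) \<le>
        norm (2 * (indicator D z *\<^sub>R (cmod (f z))\<^sup>2) + 2 * (indicator D z *\<^sub>R (cmod (g z))\<^sup>2))"
      by (auto simp: indicator_def)
  qed
  with holomorphic_several_diff[OF hol] show ?thesis
    by (simp add: bergman_space_def set_integrable_def)
qed

text \<open>The set where g does not vanish is open and of measure zero, hence empty.\<close>

lemma bergman_space_eq_0:
  assumes D: "open D" and g: "g \<in> bergman_space D" and zero: "(LINT z:D|lborel. (cmod (g z))\<^sup>2) = 0" and w: "w \<in> D"
  shows "g w = 0"
proof (rule ccontr)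
  assume ne: "g w \<noteq> 0"
  have cont: "continuous_on D g"
    using g by (auto simp: bergman_space_def intro: holomorphic_several_continuous)
  have int: "integrable lborel (\<lambda>z. indicator D z *\<^sub>R (cmod (g z))\<^sup>2)"
    using g by (simp add: bergman_space_def set_integrable_def)
  have "AE z in lborel. indicator D z *\<^sub>R (cmod (g z))\<^sup>2 = 0"
    using zero integral_nonneg_eq_0_iff_AE[OF int] by (simp add: set_lebesgue_integral_def)
  then have "AE z in lborel. z \<notin> D \<inter> g -` (- {0})"
    by eventually_elim (auto simp: indicator_def split: if_splits)
  moreover have opn: "open (D \<inter> g -` (- {0}))"
    using continuous_open_preimage[OF cont D, of "- {0}"] by (simp add: Int_commute open_Compl)
  ultimately have null: "emeasure lborel (D \<inter> g -` (- {0})) = 0"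
    using AE_iff_null_sets[of "D \<inter> g -` (- {0})" lborel] by (auto dest: null_setsD1)
  obtain e where e: "e > 0" "ball w e \<subseteq> D \<inter> g -` (- {0})"
    using opn w ne by (metis IntI ComplI singletonD vimageI2 open_contains_ball)
  have "emeasure lborel (ball w e) \<le> emeasure lborel (D \<inter> g -` (- {0}))"
    using e(2) opn by (intro emeasure_mono) auto
  moreover have "0 < emeasure lborel (ball w e)"
    using content_ball_pos[OF e(1), of w] by (simp add: measure_def enn2real_positive_iff)
  ultimately show False using null by simp
qed

text \<open>For a second kernel K1, the difference g of the two sections at w lies in the space
  itself and is reproduced by both kernels; subtracting the two formulas shows that the squared norm
  of g is 0.\<close>

lemma bergman_kernel_eq:
  fixes D :: "(complex^'m::finite) set"
  assumes D: "open D"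
    and K: "\<And>w. w \<in> D \<Longrightarrow> (\<lambda>z. K z w) \<in> bergman_space D"
      "\<And>w f. w \<in> D \<Longrightarrow> f \<in> bergman_space D \<Longrightarrow> f w = (LINT z:D|lborel. f z * cnj (K z w))"
    and zw: "z \<in> D" "w \<in> D"
    and integrable_prod: "\<And>f g. f \<in> bergman_space D \<Longrightarrow> g \<in> bergman_space D \<Longrightarrow>
      set_integrable lborel D (\<lambda>z. f z * cnj (g z))"
  shows "bergman_kernel D z w = K z w"
proof -
  \<comment> \<open>The description of the kernel demands the value 0 off D, so the candidate is cut
    off before uniqueness is argued.\<close>
  define K0 where "K0 z w = (if z \<in> D \<and> w \<in> D then K z w else 0)" for z w
  let ?P = "\<lambda>K. (\<forall>w\<in>D. (\<lambda>z. K z w) \<in> bergman_space D) \<and>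
    (\<forall>w\<in>D. \<forall>f\<in>bergman_space D. f w = (LINT z:D|lborel. f z * cnj (K z w))) \<and>
    (\<forall>z w. z \<notin> D \<or> w \<notin> D \<longrightarrow> K z w = 0)"
  have P0: "?P K0"
  proof (intro conjI ballI allI impI)
    fix w assume w: "w \<in> D"
    have "holomorphic_several (\<lambda>z. K z w) D" "set_integrable lborel D (\<lambda>z. (cmod (K z w))\<^sup>2)"
      using K(1)[OF w] by (auto simp: bergman_space_def)
    moreover have "holomorphic_several (\<lambda>z. K0 z w) D"
      using calculation(1) by (rule holomorphic_several_cong[OF D]) (simp add: K0_def w)
    moreover have "(\<lambda>z. indicator D z *\<^sub>R (cmod (K0 z w))\<^sup>2) = (\<lambda>z. indicator D z *\<^sub>R (cmod (K z w))\<^sup>2)"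
      by (auto simp: K0_def w indicator_def)
    ultimately show "(\<lambda>z. K0 z w) \<in> bergman_space D"
      by (simp add: bergman_space_def set_integrable_def)
    fix f assume f: "f \<in> bergman_space D"
    have "(LINT z:D|lborel. f z * cnj (K0 z w)) = (LINT z:D|lborel. f z * cnj (K z w))"
      unfolding set_lebesgue_integral_def
      by (intro Bochner_Integration.integral_cong) (auto simp: K0_def w indicator_def)
    then show "f w = (LINT z:D|lborel. f z * cnj (K0 z w))" using K(2)[OF w f] by simp
  qed (auto simp: K0_def)
  have unique: "K1 = K0" if P1: "?P K1" for K1
  proof (intro ext)
    fix z w
    show "K1 z w = K0 z w"
    proof (cases "z \<in> D \<and> w \<in> D")
      case True
      then have z: "z \<in> D" and w: "w \<in> D" by auto
      define g where "g z = K1 z w - K0 z w" for z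
      have K1w: "(\<lambda>z. K1 z w) \<in> bergman_space D" and K0w: "(\<lambda>z. K0 z w) \<in> bergman_space D"
        using P0 P1 w by auto
      have g: "g \<in> bergman_space D"
        unfolding g_def by (rule bergman_space_diff[OF D K1w K0w])
      have "g w = (LINT z:D|lborel. g z * cnj (K1 z w))" "g w = (LINT z:D|lborel. g z * cnj (K0 z w))"
        using P0 P1 w g by blast+
      then have "0 = (LINT z:D|lborel. g z * cnj (K1 z w)) - (LINT z:D|lborel. g z * cnj (K0 z w))" by simp
      also have "\<dots> = (LINT z:D|lborel. g z * cnj (K1 z w) - g z * cnj (K0 z w))"
        by (rule set_integral_diff(2)[symmetric]) (intro integrable_prod g K1w K0w)+
      also have "\<dots> = (LINT z:D|lborel. of_real ((cmod (g z))\<^sup>2))"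
        unfolding complex_norm_square by (simp add: g_def right_diff_distrib)
      also have "\<dots> = of_real (LINT z:D|lborel. (cmod (g z))\<^sup>2)"
        by (rule set_integral_complex_of_real)
      finally have "(LINT z:D|lborel. (cmod (g z))\<^sup>2) = 0" by simp
      from bergman_space_eq_0[OF D g this z] show ?thesis by (simp add: g_def)
    qed (use P0 P1 in auto)
  qed
  have "bergman_kernel D = K0"
    unfolding bergman_kernel_def by (rule the_equality) (use P0 unique in blast)+
  then show ?thesis using zw by (simp add: K0_def)
qed

lemma bergman_space_integrable_prod:
  assumes D: "open D" and f: "f \<in> bergman_space D" and g: "g \<in> bergman_space D"
  shows "set_integrable lborel D (\<lambda>z. f z * cnj (g z))"
proof -
  have hol: "holomorphic_several f D" "holomorphic_several g D" using f g by (auto simp: bergman_space_def)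
  note cont = hol[THEN holomorphic_several_continuous]
  have "integrable lborel (\<lambda>z. indicator D z *\<^sub>R (cmod (f z))\<^sup>2 + indicator D z *\<^sub>R (cmod (g z))\<^sup>2)"
    using f g unfolding bergman_space_def set_integrable_def by (intro Bochner_Integration.integrable_add) auto
  then have "integrable lborel (\<lambda>z. indicator D z *\<^sub>R (f z * cnj (g z)))"
  proof (rule Bochner_Integration.integrable_bound)
    show "(\<lambda>z. indicator D z *\<^sub>R (f z * cnj (g z))) \<in> borel_measurable lborel"
      using D cont by (auto intro!: borel_measurable_continuous_on_indicator continuous_intros)
    have "cmod (f z) * cmod (g z) \<le> (cmod (f z))\<^sup>2 + (cmod (g z))\<^sup>2" for z
    proof -
      have "0 \<le> cmod (f z) * cmod (g z)" by simp
      then show ?thesis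
        using sum_squares_bound[of "cmod (f z)" "cmod (g z)"] by linarith
    qed
    then show "AE z in lborel. norm (indicator D z *\<^sub>R (f z * cnj (g z))) \<le>
        norm (indicator D z *\<^sub>R (cmod (f z))\<^sup>2 + indicator D z *\<^sub>R (cmod (g z))\<^sup>2)"
      by (auto simp: indicator_def norm_mult)
  qed
  then show ?thesis by (simp add: set_integrable_def)
qed

lemma bergman_kernel_E:
  assumes p: "p > 0"
  obtains \<kappa> :: real where "\<kappa> > 0"
    "\<And>z w :: complex^('n::finite + 'k::finite). z \<in> E p \<Longrightarrow> w \<in> E p \<Longrightarrow> bergman_kernel (E p) z w = ekernel \<kappa> p z w"
proof -
  obtain \<kappa> where \<kappa>: "is_kernel_constant p TYPE('n) TYPE('k) \<kappa>"
    using kernel_constant_exists[OF p] by blast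
  show thesis
  proof (rule that[of \<kappa>])
    show "\<kappa> > 0" using \<kappa> by (simp add: is_kernel_constant_def)
    fix z w :: "complex^('n + 'k)" assume zw: "z \<in> E p" "w \<in> E p"
    show "bergman_kernel (E p) z w = ekernel \<kappa> p z w"
      by (rule bergman_kernel_eq[OF open_E[OF p] _ _ zw])
         (auto intro: ekernel_in_bergman_space p ekernel_reproducing \<kappa> bergman_space_integrable_prod open_E)
  qed
qed

section \<open>Wirtinger calculus\<close>

lemma wirtinger_eqI:
  assumes "(f has_derivative f') (at w)"
  shows "wirtinger s f w = (f' (axis s 1) - \<i> * f' (axis s \<i>)) / 2"
    "wirtinger_bar s f w = (f' (axis s 1) + \<i> * f' (axis s \<i>)) / 2"
  using frechet_derivative_at[OF assms] by (simp_all add: wirtinger_def wirtinger_bar_def)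

text \<open>\<open>frechet_derivative\<close> is a choice among all derivatives at w, and locally
  equal functions have the same derivatives, so the choices agree whether or not one exists.\<close>

lemma frechet_derivative_cong_open:
  assumes "open D" "w \<in> D" "\<And>x. x \<in> D \<Longrightarrow> f x = g x"
  shows "frechet_derivative f (at w) = frechet_derivative g (at w)"
proof -
  have "(f has_derivative f') (at w) \<longleftrightarrow> (g has_derivative f') (at w)" for f'
    using has_derivative_transform_within_open[OF _ assms(1,2), of f f' UNIV g]
      has_derivative_transform_within_open[OF _ assms(1,2), of g f' UNIV f] assms(3) by auto
  then show ?thesis unfolding frechet_derivative_def by simp
qed

lemma wirtinger_cong_open:
  assumes "open D" "w \<in> D" "\<And>x. x \<in> D \<Longrightarrow> f x = g x"
  shows "wirtinger s f w = wirtinger s g w" "wirtinger_bar s f w = wirtinger_bar s g w"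
  using frechet_derivative_cong_open[OF assms] by (simp_all add: wirtinger_def wirtinger_bar_def)

lemma wirtinger_mult:
  assumes "f differentiable at w" "g differentiable at w"
  shows "wirtinger s (\<lambda>w. f w * g w) w = f w * wirtinger s g w + wirtinger s f w * g w"
proof -
  obtain f' g' where f': "(f has_derivative f') (at w)" and g': "(g has_derivative g') (at w)"
    using assms by (auto simp: differentiable_def)
  show ?thesis
    unfolding wirtinger_eqI(1)[OF has_derivative_mult[OF f' g']] wirtinger_eqI(1)[OF f'] wirtinger_eqI(1)[OF g']
    by (simp add: field_simps)
qed

lemma wirtinger_add:
  assumes "f differentiable at w" "g differentiable at w"
  shows "wirtinger s (\<lambda>w. f w + g w) w = wirtinger s f w + wirtinger s g w"
proof -
  obtain f' g' where f': "(f has_derivative f') (at w)" and g': "(g has_derivative g') (at w)"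
    using assms by (auto simp: differentiable_def)
  show ?thesis
    unfolding wirtinger_eqI(1)[OF has_derivative_add[OF f' g']] wirtinger_eqI(1)[OF f'] wirtinger_eqI(1)[OF g']
    by (simp add: field_simps)
qed

lemma has_derivative_coord:
  "((\<lambda>w. w $ t) has_derivative (\<lambda>v. v $ t)) (at (w :: complex^'m::finite))"
  "((\<lambda>w. cnj (w $ t)) has_derivative (\<lambda>v. cnj (v $ t))) (at (w :: complex^'m::finite))"
proof -
  have "bounded_linear (\<lambda>w :: complex^'m. w $ t)" by (rule bounded_linear_vec_nth)
  from bounded_linear_imp_has_derivative[OF this] bounded_linear_imp_has_derivative[OF bounded_linear_compose[OF bounded_linear_cnj this]]
  show "((\<lambda>w. w $ t) has_derivative (\<lambda>v. v $ t)) (at (w :: complex^'m))"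
    "((\<lambda>w. cnj (w $ t)) has_derivative (\<lambda>v. cnj (v $ t))) (at (w :: complex^'m))" by auto
qed

lemma wirtinger_coord:
  "wirtinger s (\<lambda>w. w $ t) w = (if s = t then 1 else 0)"
  "wirtinger s (\<lambda>w. cnj (w $ t)) w = 0"
  unfolding wirtinger_eqI(1)[OF has_derivative_coord(1)] wirtinger_eqI(1)[OF has_derivative_coord(2)]
  by (simp_all add: axis_def)

lemma differentiable_coord:
  "(\<lambda>w. w $ t) differentiable at (w :: complex^'m::finite)"
  "(\<lambda>w. cnj (w $ t)) differentiable at (w :: complex^'m::finite)"
  unfolding differentiable_def using has_derivative_coord(1) has_derivative_coord(2) by blast+

text \<open>
  \<open>has_block_derivative f w \<alpha> \<beta>\<close> says that to first order \<open>f\<close> depends on \<open>w = (z, \<xi>)\<close> only through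
  \<open>x = |z|\<^sup>2\<close> and \<open>y = |\<xi>|\<^sup>2\<close>, with \<open>\<partial>f/\<partial>x = \<alpha>\<close> and \<open>\<partial>f/\<partial>y = \<beta>\<close>.
\<close>

definition has_block_derivative ::
    "(complex^('n::finite + 'k::finite) \<Rightarrow> complex) \<Rightarrow> complex^('n + 'k) \<Rightarrow> complex \<Rightarrow> complex \<Rightarrow> bool"
  where "has_block_derivative f w \<alpha> \<beta> \<longleftrightarrow>
    (f has_derivative (\<lambda>v. \<alpha> * (herm1 v w + herm1 w v) + \<beta> * (herm2 v w + herm2 w v))) (at w)"

lemma has_block_derivative_const: "has_block_derivative (\<lambda>w. c) w 0 0"
  by (simp add: has_block_derivative_def)

lemma has_block_derivative_herm:
  "has_block_derivative (\<lambda>w. herm1 w w) w 1 0" "has_block_derivative (\<lambda>w. herm2 w w) w 0 1"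
proof -
  have "((\<lambda>w. herm1 w w) has_derivative (\<lambda>v. \<Sum>a\<in>UNIV. w $ Inl a * cnj (v $ Inl a) + v $ Inl a * cnj (w $ Inl a))) (at w)"
    unfolding herm1_def hprod_def lpart_nth
    by (intro has_derivative_sum has_derivative_mult has_derivative_coord)
  then show "has_block_derivative (\<lambda>w. herm1 w w) w 1 0"
    by (simp add: has_block_derivative_def herm1_def hprod_def sum.distrib add.commute)
  have "((\<lambda>w. herm2 w w) has_derivative (\<lambda>v. \<Sum>a\<in>UNIV. w $ Inr a * cnj (v $ Inr a) + v $ Inr a * cnj (w $ Inr a))) (at w)"
    unfolding herm2_def hprod_def rpart_nth
    by (intro has_derivative_sum has_derivative_mult has_derivative_coord)
  then show "has_block_derivative (\<lambda>w. herm2 w w) w 0 1"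
    by (simp add: has_block_derivative_def herm2_def hprod_def sum.distrib add.commute)
qed

lemma has_block_derivative_add:
  assumes "has_block_derivative f w \<alpha> \<beta>" "has_block_derivative g w \<gamma> \<delta>"
  shows "has_block_derivative (\<lambda>w. f w + g w) w (\<alpha> + \<gamma>) (\<beta> + \<delta>)"
  using has_derivative_add[OF assms[unfolded has_block_derivative_def]]
  by (simp add: has_block_derivative_def algebra_simps)

lemma has_block_derivative_mult:
  assumes "has_block_derivative f w \<alpha> \<beta>" "has_block_derivative g w \<gamma> \<delta>"
  shows "has_block_derivative (\<lambda>w. f w * g w) w (\<alpha> * g w + f w * \<gamma>) (\<beta> * g w + f w * \<delta>)"
  using has_derivative_mult[OF assms[unfolded has_block_derivative_def]]
  by (simp add: has_block_derivative_def algebra_simps)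

lemma has_block_derivative_compose:
  assumes "has_block_derivative f w \<alpha> \<beta>" "(g has_field_derivative d) (at (f w))"
  shows "has_block_derivative (\<lambda>w. g (f w)) w (d * \<alpha>) (d * \<beta>)"
  using has_derivative_compose[OF assms(1)[unfolded has_block_derivative_def] assms(2)[unfolded has_field_derivative_def]]
  by (simp add: has_block_derivative_def algebra_simps)

lemma has_block_derivative_transform:
  assumes "has_block_derivative f w \<alpha> \<beta>" "open D" "w \<in> D" "\<And>x. x \<in> D \<Longrightarrow> f x = g x"
  shows "has_block_derivative g w \<alpha> \<beta>"
  using has_derivative_transform_within_open[OF assms(1)[unfolded has_block_derivative_def] assms(2,3)] assms(4)
  unfolding has_block_derivative_def by simp

lemma has_block_derivative_differentiable:
  "has_block_derivative f w \<alpha> \<beta> \<Longrightarrow> f differentiable at w"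
  by (auto simp: has_block_derivative_def differentiable_def)

lemma herm_axis:
  "herm1 (axis (Inl a) c) w = c * cnj (w $ Inl a)" "herm1 w (axis (Inl a) c) = w $ Inl a * cnj c"
  "herm1 (axis (Inr b) c) w = 0" "herm1 w (axis (Inr b) c) = 0"
  "herm2 (axis (Inr b) c) w = c * cnj (w $ Inr b)" "herm2 w (axis (Inr b) c) = w $ Inr b * cnj c"
  "herm2 (axis (Inl a) c) w = 0" "herm2 w (axis (Inl a) c) = 0"
proof -
  have 1: "lpart (axis (Inl a) c) = axis a c" "rpart (axis (Inr b) c) = axis b c" for a b
    by (auto simp: vec_eq_iff axis_def)
  have 2: "lpart (axis (Inr b) c) = 0" "rpart (axis (Inl a) c) = 0" for a b
    by (auto simp: vec_eq_iff axis_def)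
  have 3: "hprod (axis a c) x = c * cnj (x $ a)" for a x
    using hprod_axis[of x a c] hprod_cnj[of x "axis a c"] by (metis complex_cnj_cnj complex_cnj_mult mult.commute)
  show "herm1 (axis (Inl a) c) w = c * cnj (w $ Inl a)" "herm1 w (axis (Inl a) c) = w $ Inl a * cnj c"
    "herm1 (axis (Inr b) c) w = 0" "herm1 w (axis (Inr b) c) = 0"
    "herm2 (axis (Inr b) c) w = c * cnj (w $ Inr b)" "herm2 w (axis (Inr b) c) = w $ Inr b * cnj c"
    "herm2 (axis (Inl a) c) w = 0" "herm2 w (axis (Inl a) c) = 0"
    unfolding herm1_def herm2_def 1 2 by (simp_all add: hprod_axis 3) (simp_all add: hprod_def)
qed

definition blockwise :: "'b \<Rightarrow> 'b \<Rightarrow> 'n + 'k \<Rightarrow> 'b"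
  where "blockwise x y t = (case t of Inl a \<Rightarrow> x | Inr b \<Rightarrow> y)"

lemma blockwise_simps [simp]: "blockwise x y (Inl a) = x" "blockwise x y (Inr b) = y"
  by (simp_all add: blockwise_def)

lemma wirtinger_block_derivative:
  assumes "has_block_derivative f w \<alpha> \<beta>"
  shows "wirtinger s f w = blockwise \<alpha> \<beta> s * cnj (w $ s)"
    "wirtinger_bar s f w = blockwise \<alpha> \<beta> s * (w $ s)"
  using wirtinger_eqI[OF assms[unfolded has_block_derivative_def], of s]
  by (cases s; simp add: herm_axis algebra_simps)+

text \<open>The conjugate derivative in direction t is the coordinate t times P or Q, and the
  product rule then gives the Kronecker term and the second derivatives. The block of t selects P or
  Q, the block of s the variable in which it is differentiated.\<close>

lemma complex_hessian_block:
  assumes D: "open D" and L: "\<And>w. w \<in> D \<Longrightarrow> has_block_derivative L w (P w) (Q w)"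
    and w: "w \<in> D" and P: "has_block_derivative P w P1 P2" and Q: "has_block_derivative Q w Q1 Q2"
  shows "complex_hessian L w $ s $ t = (if s = t then blockwise (P w) (Q w) t else 0) +
    w $ t * (blockwise (blockwise P1 P2 s) (blockwise Q1 Q2 s) t * cnj (w $ s))"
proof -
  define R where "R = (blockwise P Q t)"
  have R: "has_block_derivative R w (blockwise P1 Q1 t) (blockwise P2 Q2 t)"
    using P Q by (cases t) (auto simp: R_def)
  have "complex_hessian L w $ s $ t = wirtinger s (wirtinger_bar t L) w"
    by (simp add: complex_hessian_def)
  also have "\<dots> = wirtinger s (\<lambda>w. w $ t * R w) w"
  proof (rule wirtinger_cong_open(1)[OF D w])
    fix x assume "x \<in> D"
    then show "wirtinger_bar t L x = x $ t * R x"
      by (cases t) (simp_all add: wirtinger_block_derivative(2)[OF L] R_def mult.commute)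
  qed
  also have "\<dots> = w $ t * wirtinger s R w + wirtinger s (\<lambda>w. w $ t) w * R w"
    by (rule wirtinger_mult[OF differentiable_coord(1) has_block_derivative_differentiable[OF R]])
  finally show ?thesis
    unfolding wirtinger_block_derivative(1)[OF R] wirtinger_coord
    by (cases t; cases s) (simp_all add: R_def)
qed

section \<open>The classes C^k under algebraic operations and logarithms\<close>

lemma Ck_on_cong:
  assumes "open D" "\<And>w. w \<in> D \<Longrightarrow> f w = g w"
  shows "Ck_on k D f \<longleftrightarrow> Ck_on k D g"
  using assms(2)
proof (induction k arbitrary: f g)
  case 0
  then show ?case by (simp cong: continuous_on_cong)
next
  case (Suc k)
  have fd: "frechet_derivative f (at w) = frechet_derivative g (at w)" if "w \<in> D" for w
    using frechet_derivative_cong_open[OF assms(1) that Suc.prems] .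
  have "f differentiable at w \<longleftrightarrow> g differentiable at w" if "w \<in> D" for w
    using has_derivative_transform_within_open[OF _ assms(1) that, of f _ UNIV g]
      has_derivative_transform_within_open[OF _ assms(1) that, of g _ UNIV f] Suc.prems
    unfolding differentiable_def by metis
  moreover have "Ck_on k D (\<lambda>w. frechet_derivative f (at w) v) \<longleftrightarrow> Ck_on k D (\<lambda>w. frechet_derivative g (at w) v)" for v
    by (rule Suc.IH) (simp add: fd)
  ultimately show ?case by simp
qed

lemma Ck_on_continuous: "Ck_on k D f \<Longrightarrow> continuous_on D f"
  by (cases k) (auto intro!: continuous_at_imp_continuous_on differentiable_imp_continuous_within)

lemma Ck_on_pred: "Ck_on (Suc k) D f \<Longrightarrow> Ck_on k D f"
proof (induction k arbitrary: f)
  case 0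
  then show ?case using Ck_on_continuous[OF 0] by simp
qed auto

lemma Ck_on_subset: "Ck_on k D f \<Longrightarrow> U \<subseteq> D \<Longrightarrow> Ck_on k U f"
  by (induction k arbitrary: f) (auto intro: continuous_on_subset)

lemma Ck_on_const: "Ck_on k D (\<lambda>w. c)"
proof (induction k arbitrary: c)
  case (Suc k)
  have "frechet_derivative (\<lambda>w. c) (at w) = (\<lambda>v. 0)" for w
    using frechet_derivative_at[OF has_derivative_const] by metis
  then show ?case using Suc by simp
qed simp

lemma Ck_on_SucI:
  assumes "open D" "\<And>w. w \<in> D \<Longrightarrow> (f has_derivative f' w) (at w)" "\<And>v. Ck_on k D (\<lambda>w. f' w v)"
  shows "Ck_on (Suc k) D f"
proof -
  have "Ck_on k D (\<lambda>w. frechet_derivative f (at w) v)" for v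
    using assms(3)[of v] frechet_derivative_at[OF assms(2)]
    by (subst Ck_on_cong[OF assms(1), of _ "\<lambda>w. f' w v"]) auto
  then show ?thesis using assms(2) by (auto simp: differentiable_def)
qed

lemma Ck_on_bounded_linear:
  assumes "open D" "bounded_linear f" shows "Ck_on k D f"
proof (cases k)
  case 0
  then show ?thesis using assms(2) by (simp add: linear_continuous_on)
next
  case (Suc k')
  show ?thesis unfolding Suc
    by (rule Ck_on_SucI[OF assms(1) bounded_linear_imp_has_derivative[OF assms(2)] Ck_on_const])
qed

lemma Ck_on_Suc_has_derivative:
  "Ck_on (Suc k) D f \<Longrightarrow> w \<in> D \<Longrightarrow> (f has_derivative frechet_derivative f (at w)) (at w)"
  by (simp add: frechet_derivative_works)

lemma Ck_on_add:
  assumes "open D" "Ck_on k D f" "Ck_on k D g" shows "Ck_on k D (\<lambda>w. f w + g w)"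
  using assms(2,3)
proof (induction k arbitrary: f g)
  case 0
  then show ?case by (simp add: continuous_on_add)
next
  case (Suc k)
  show ?case
    using Suc.prems
    by (intro Ck_on_SucI[OF assms(1) has_derivative_add[OF Ck_on_Suc_has_derivative Ck_on_Suc_has_derivative]] Suc.IH) auto
qed

lemma Ck_on_mult:
  fixes f g :: "'a::real_normed_vector \<Rightarrow> complex"
  assumes "open D" "Ck_on k D f" "Ck_on k D g" shows "Ck_on k D (\<lambda>w. f w * g w)"
  using assms(2,3)
proof (induction k arbitrary: f g)
  case 0
  then show ?case by (simp add: continuous_on_mult)
next
  case (Suc k)
  show ?case
    using Suc.prems Ck_on_pred[OF Suc.prems(1)] Ck_on_pred[OF Suc.prems(2)]
    by (intro Ck_on_SucI[OF assms(1) has_derivative_mult[OF Ck_on_Suc_has_derivative Ck_on_Suc_has_derivative]]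
        Ck_on_add[OF assms(1)] Suc.IH) auto
qed

lemma Ck_on_sum:
  assumes "open D" "\<And>i. i \<in> I \<Longrightarrow> Ck_on k D (f i)" shows "Ck_on k D (\<lambda>w. \<Sum>i\<in>I. f i w)"
  using assms(2)
  by (induction I rule: infinite_finite_induct) (auto intro: Ck_on_const Ck_on_add[OF assms(1)])

lemma Ck_on_prod:
  fixes f :: "'i \<Rightarrow> 'a::real_normed_vector \<Rightarrow> complex"
  assumes "open D" "\<And>i. i \<in> I \<Longrightarrow> Ck_on k D (f i)" shows "Ck_on k D (\<lambda>w. \<Prod>i\<in>I. f i w)"
  using assms(2)
  by (induction I rule: infinite_finite_induct) (auto intro: Ck_on_const Ck_on_mult[OF assms(1)])

text \<open>The derivative of 1/f is built from the derivative of f and 1/f itself, so the induction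
  gains one order at a time.\<close>

lemma Ck_on_inverse:
  fixes f :: "'a::real_normed_vector \<Rightarrow> complex"
  assumes "open D" "Ck_on k D f" "\<And>w. w \<in> D \<Longrightarrow> f w \<noteq> 0" shows "Ck_on k D (\<lambda>w. inverse (f w))"
  using assms(2)
proof (induction k)
  case 0
  then show ?case using assms(3) by (simp add: continuous_on_inverse)
next
  case (Suc k)
  have "Ck_on k D (\<lambda>w. inverse (f w))" by (rule Suc.IH[OF Ck_on_pred[OF Suc.prems]])
  then have "Ck_on k D (\<lambda>w. - 1 * (inverse (f w) * frechet_derivative f (at w) v * inverse (f w)))" for v
    using Suc.prems by (intro Ck_on_mult[OF assms(1)] Ck_on_const) auto
  then have "Ck_on k D (\<lambda>w. - (inverse (f w) * frechet_derivative f (at w) v * inverse (f w)))" for v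
    by simp
  moreover have "((\<lambda>w. inverse (f w)) has_derivative
      (\<lambda>v. - (inverse (f w) * frechet_derivative f (at w) v * inverse (f w)))) (at w)" if "w \<in> D" for w
    using Ck_on_Suc_has_derivative[OF Suc.prems that] assms(3)[OF that]
    by (intro Deriv.has_derivative_inverse)
  ultimately show ?case by (intro Ck_on_SucI[OF assms(1)])
qed

lemma Ck_on_Ln:
  fixes f :: "'a::real_normed_vector \<Rightarrow> complex"
  assumes "open D" "Ck_on (Suc k) D f" "\<And>w. w \<in> D \<Longrightarrow> f w \<notin> \<real>\<^sub>\<le>\<^sub>0"
  shows "Ck_on (Suc k) D (\<lambda>w. ln (f w))"
proof (rule Ck_on_SucI[OF assms(1)])
  have ne: "f w \<noteq> 0" if "w \<in> D" for w using assms(3)[OF that] by auto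
  show "((\<lambda>w. ln (f w)) has_derivative (\<lambda>v. inverse (f w) * frechet_derivative f (at w) v)) (at w)" if "w \<in> D" for w
    using has_derivative_compose[OF Ck_on_Suc_has_derivative[OF assms(2) that]
        has_field_derivative_Ln[OF assms(3)[OF that], unfolded has_field_derivative_def]] .
  show "Ck_on k D (\<lambda>w. inverse (f w) * frechet_derivative f (at w) v)" for v
    using assms(2) ne Ck_on_pred[OF assms(2)]
    by (intro Ck_on_mult[OF assms(1)] Ck_on_inverse[OF assms(1)]) auto
qed

lemma Ck_on_det:
  fixes g :: "'a::real_normed_vector \<Rightarrow> complex^'m::finite^'m"
  assumes "open D" "\<And>s t. Ck_on k D (\<lambda>w. g w $ s $ t)"
  shows "Ck_on k D (\<lambda>w. det (g w))"
  unfolding det_def by (intro Ck_on_sum[OF assms(1)] Ck_on_mult[OF assms(1)] Ck_on_const Ck_on_prod[OF assms(1)] assms(2))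

section \<open>Complex Hessians along coordinate lines\<close>

lemma norm_axis_complex: "norm (axis s \<zeta> :: complex^'m::finite) = norm \<zeta>"
proof -
  have "of_real ((norm (axis s \<zeta> :: complex^'m))\<^sup>2) = (of_real ((norm \<zeta>)\<^sup>2) :: complex)"
    unfolding hprod_self[symmetric] complex_norm_square by (simp add: hprod_axis)
  then show ?thesis unfolding of_real_eq_iff by simp
qed

lemma has_vector_derivative_along_line:
  assumes "(F has_derivative F') (at (axis s \<zeta> :: complex^'m::finite))"
  shows "((\<lambda>t::real. F (axis s (\<zeta> + of_real t * c))) has_vector_derivative F' (axis s c)) (at 0)"
proof -
  have eq: "axis s (\<zeta> + of_real t * c) = axis s \<zeta> + t *\<^sub>R axis s c" for t
    unfolding vec_eq_iff vector_add_component vector_scaleR_component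
    by (simp add: axis_def scaleR_conv_of_real)
  have "((\<lambda>t::real. axis s \<zeta> + t *\<^sub>R axis s c) has_derivative (\<lambda>t. t *\<^sub>R axis s c)) (at 0)"
    by (auto intro!: derivative_eq_intros)
  moreover have "(F has_derivative F') (at (axis s \<zeta> + 0 *\<^sub>R axis s c))" using assms by simp
  ultimately have "((\<lambda>t::real. F (axis s \<zeta> + t *\<^sub>R axis s c)) has_derivative (\<lambda>t. F' (t *\<^sub>R axis s c))) (at 0)"
    by (rule has_derivative_compose)
  then show ?thesis
    unfolding has_vector_derivative_def eq
    using linear_cmul[OF has_derivative_linear[OF assms]] by simp
qed

text \<open>The mixed derivative of G (|\<zeta>|^2) at 0 is the derivative of G at 0. Only values on
  the line are known, while the Hessian is made of Frechet derivatives in the full space; the C^2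
  assumption identifies those with derivatives along the line.\<close>

lemma complex_hessian_radial_on_line:
  fixes F :: "complex^'m::finite \<Rightarrow> complex"
  assumes U: "open U" "0 \<in> U" and F: "Ck_on 2 U F"
    and G: "G holomorphic_on ball 0 e" "e > 0"
    and line: "\<And>\<zeta>. norm \<zeta> < d \<Longrightarrow> F (axis s \<zeta>) = G (\<zeta> * cnj \<zeta>)" and d: "d > 0"
  shows "complex_hessian F 0 $ s $ s = deriv G 0"
proof -
  obtain d1 where d1: "d1 > 0" "ball 0 d1 \<subseteq> U" using U by (meson open_contains_ball)
  \<comment> \<open>The bound 1 gives |\<zeta>|^2 \<le> |\<zeta>|, so that |\<zeta>|^2 stays in the
    disc where G is holomorphic.\<close>
  define d2 where "d2 = Min {d, d1, e, 1}"
  have d2: "d2 > 0" "d2 \<le> d" "d2 \<le> d1" "d2 \<le> e" "d2 \<le> 1" using d d1 G(2) by (auto simp: d2_def)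
  have inU: "axis s \<zeta> \<in> U" if "norm \<zeta> < d2" for \<zeta>
  proof -
    have "norm (axis s \<zeta> :: complex^'m) = norm \<zeta>" by (rule norm_axis_complex)
    then show ?thesis using that d2 d1(2) by auto
  qed
  have in_ball: "\<zeta> * cnj \<zeta> \<in> ball 0 e" if "norm \<zeta> < d2" for \<zeta>
  proof -
    have "norm \<zeta> * norm \<zeta> \<le> norm \<zeta> * 1" using that d2 by (intro mult_left_mono) auto
    then show ?thesis using that d2 by (simp add: norm_mult)
  qed
  have F1: "Ck_on (Suc (Suc 0)) U F" using F by (simp add: numeral_2_eq_2)
  note F_deriv = Ck_on_Suc_has_derivative[OF F1]
  have G_deriv: "(G has_field_derivative deriv G x) (at x)" if "x \<in> ball 0 e" for x
    using G(1) that holomorphic_derivI[OF _ open_ball] by blast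
  have near: "\<forall>\<^sub>F t in nhds 0. norm (\<zeta> + of_real t * c) < d2" if "norm \<zeta> < d2" for \<zeta> c :: complex
  proof -
    have "((\<lambda>t::real. norm (\<zeta> + of_real t * c)) \<longlongrightarrow> norm (\<zeta> + of_real 0 * c)) (nhds 0)"
      by (intro tendsto_intros filterlim_ident)
    with that show ?thesis by (auto dest: order_tendstoD(2))
  qed
  \<comment> \<open>Curves that agree near 0 have the same velocity there; this carries derivatives
    from G over to F.\<close>
  have transfer: "D1 = D2" if "(f has_vector_derivative D1) (at 0)" "(g has_vector_derivative D2) (at (0::real))"
    "\<forall>\<^sub>F t in nhds 0. f t = g t" for f g :: "real \<Rightarrow> complex" and D1 D2
  proof -
    have "(f has_vector_derivative D2) (at 0)"
      using that(2) eventually_nhds_x_imp_x[OF that(3)] eventually_mono[OF that(3)]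
        has_vector_derivative_cong_ev[where f = f and g = g and x = 0 and S = UNIV] by auto
    with that(1) show ?thesis by (rule vector_derivative_unique_at)
  qed
  have bar: "wirtinger_bar s F (axis s \<zeta>) = deriv G (\<zeta> * cnj \<zeta>) * \<zeta>" if \<zeta>: "norm \<zeta> < d2" for \<zeta>
  proof -
    let ?F' = "frechet_derivative F (at (axis s \<zeta>))"
    have "?F' (axis s c) = (c * cnj \<zeta> + \<zeta> * cnj c) * deriv G (\<zeta> * cnj \<zeta>)" for c
    proof (rule transfer)
      show "((\<lambda>t::real. F (axis s (\<zeta> + of_real t * c))) has_vector_derivative ?F' (axis s c)) (at 0)"
        by (rule has_vector_derivative_along_line[OF F_deriv[OF inU[OF \<zeta>]]])
      have "((\<lambda>t::real. (\<zeta> + of_real t * c) * cnj (\<zeta> + of_real t * c)) has_vector_derivative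
          (c * cnj \<zeta> + \<zeta> * cnj c)) (at 0)"
        by (auto intro!: derivative_eq_intros simp: has_vector_derivative_def scaleR_conv_of_real algebra_simps)
      from field_vector_diff_chain_at[OF this, of G] G_deriv[OF in_ball[OF \<zeta>]]
      show "((\<lambda>t::real. G ((\<zeta> + of_real t * c) * cnj (\<zeta> + of_real t * c))) has_vector_derivative
          (c * cnj \<zeta> + \<zeta> * cnj c) * deriv G (\<zeta> * cnj \<zeta>)) (at 0)"
        by (simp add: o_def)
      show "\<forall>\<^sub>F t in nhds 0. F (axis s (\<zeta> + of_real t * c)) = G ((\<zeta> + of_real t * c) * cnj (\<zeta> + of_real t * c))"
        using near[OF \<zeta>, of c] by eventually_elim (use line d2 in auto)
    qed
    then show ?thesis by (simp add: wirtinger_bar_def algebra_simps)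
  qed
  define H where "H = wirtinger_bar s F"
  have "Ck_on (Suc 0) U (\<lambda>w. frechet_derivative F (at w) v)" for v using F1 by simp
  then have "(\<lambda>w. frechet_derivative F (at w) v) differentiable at 0" for v
    using U(2) by simp
  then have "H differentiable at 0"
    unfolding H_def wirtinger_bar_def[abs_def] by (auto intro!: derivative_intros)
  then obtain H' where H': "(H has_derivative H') (at 0)" by (auto simp: differentiable_def)
  have "H' (axis s c) = deriv G 0 * c" for c
  proof (rule transfer)
    have "axis s 0 = (0 :: complex^'m)" by (simp add: vec_eq_iff axis_def)
    with H' have "(H has_derivative H') (at (axis s 0))" by (simp only:)
    from has_vector_derivative_along_line[OF this, of c]
    show "((\<lambda>t::real. H (axis s (of_real t * c))) has_vector_derivative H' (axis s c)) (at 0)" by simp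
    have "deriv G holomorphic_on ball 0 e" by (rule holomorphic_deriv[OF G(1) open_ball])
    then have "(deriv G has_field_derivative deriv (deriv G) 0) (at 0)"
      using G(2) by (intro holomorphic_derivI[OF _ open_ball]) auto
    \<comment> \<open>The curve |t c|^2 has velocity 0 at t = 0, so the second derivative of G
      contributes nothing.\<close>
    moreover have "((\<lambda>t::real. (of_real t * c) * cnj (of_real t * c)) has_vector_derivative 0) (at 0)"
      by (auto intro!: derivative_eq_intros simp: has_vector_derivative_def)
    ultimately have "((\<lambda>t::real. deriv G ((of_real t * c) * cnj (of_real t * c))) has_vector_derivative 0 * deriv (deriv G) 0) (at 0)"
      using field_vector_diff_chain_at[of "\<lambda>t::real. (of_real t * c) * cnj (of_real t * c)" 0 0 "deriv G"] by (simp add: o_def)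
    moreover have "((\<lambda>t::real. of_real t * c) has_vector_derivative c) (at 0)"
      by (auto intro!: derivative_eq_intros simp: has_vector_derivative_def scaleR_conv_of_real)
    ultimately have "((\<lambda>t::real. deriv G ((of_real t * c) * cnj (of_real t * c)) * (of_real t * c)) has_vector_derivative
        deriv G ((of_real 0 * c) * cnj (of_real 0 * c)) * c + 0 * deriv (deriv G) 0 * (of_real 0 * c)) (at 0)"
      by (rule has_vector_derivative_mult)
    then show "((\<lambda>t::real. deriv G ((of_real t * c) * cnj (of_real t * c)) * (of_real t * c)) has_vector_derivative
        deriv G 0 * c) (at 0)" by simp
    show "\<forall>\<^sub>F t in nhds 0. H (axis s (of_real t * c)) = deriv G ((of_real t * c) * cnj (of_real t * c)) * (of_real t * c)"
      using near[of 0 c] d2 unfolding H_def by (auto elim!: eventually_mono simp: bar)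
  qed
  then have "wirtinger s H 0 = deriv G 0"
    by (simp add: wirtinger_eqI(1)[OF H'] algebra_simps)
  then show ?thesis by (simp add: complex_hessian_def H_def)
qed

section \<open>The logarithm of the kernel on the diagonal\<close>

definition log_deriv :: "real \<Rightarrow> nat \<Rightarrow> nat \<Rightarrow> complex \<Rightarrow> complex"
  where "log_deriv p n k x = deriv (eseries p n k) x / eseries p n k x"

lemma eseries_pos:
  assumes "p > 0" "0 \<le> x" "x < 1"
  obtains y where "y > 0" "eseries p n k (of_real x) = of_real y"
proof (rule that)
  show "eseries p n k (of_real x) = of_real (\<Sum>j. ecoeff p n k j * x ^ j)"
    unfolding eseries_def using suminf_of_real[OF ecoeff_summable[OF assms], where 'a = complex, of n k] by simp
  have "(\<Sum>j\<in>{0}. ecoeff p n k j * x ^ j) \<le> (\<Sum>j. ecoeff p n k j * x ^ j)"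
    using assms
    by (intro sum_le_suminf ecoeff_summable) (auto intro!: mult_nonneg_nonneg simp: less_imp_le[OF ecoeff_pos])
  then show "0 < (\<Sum>j. ecoeff p n k j * x ^ j)"
    using ecoeff_pos[OF assms(1), of n k 0] by simp
qed

definition diag_arg :: "real \<Rightarrow> complex^('n::finite + 'k::finite) \<Rightarrow> complex"
  where "diag_arg p w = herm2 w w * (1 - herm1 w w) powr (- of_real (1 / p))"

lemma diag_arg_real:
  assumes p: "p > 0" and w: "w \<in> E p"
  obtains x where "0 \<le> x" "x < 1" "diag_arg p w = of_real x"
proof (rule that)
  have x1: "nsq1 w < 1" using E_bounds[OF p w] by simp
  have "of_real (1 - nsq1 w) powr (- of_real (1 / p)) = (of_real ((1 - nsq1 w) powr (- (1 / p))) :: complex)"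
    using x1 by (subst powr_of_real[symmetric]) auto
  then show eq: "diag_arg p w = of_real (nsq2 w * (1 - nsq1 w) powr (- (1 / p)))"
    by (simp add: diag_arg_def herm_self)
  show "0 \<le> nsq2 w * (1 - nsq1 w) powr (- (1 / p))" by simp
  have "norm (diag_arg p w) < 1"
    unfolding diag_arg_def using ekernel_argument_less_1[OF p w w] contraction_bounds(2)[OF p w] by linarith
  then show "nsq2 w * (1 - nsq1 w) powr (- (1 / p)) < 1"
    unfolding eq norm_of_real by linarith
qed

lemma eseries_diag_pos:
  assumes "p > 0" "w \<in> E p"
  obtains y where "y > 0" "eseries p n k (diag_arg p w) = of_real y"
  using diag_arg_real[OF assms] eseries_pos[OF assms(1)] by metis

lemma norm_diag_arg_less_1: "p > 0 \<Longrightarrow> w \<in> E p \<Longrightarrow> norm (diag_arg p w) < 1"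
  by (rule diag_arg_real) (auto simp: norm_of_real)

lemma ekernel_diag_pos:
  fixes w :: "complex^('n::finite + 'k::finite)"
  assumes p: "p > 0" and w: "w \<in> E p" and \<kappa>: "\<kappa> > 0"
  obtains y where "y > 0" "ekernel \<kappa> p w w = of_real y"
proof -
  obtain y where y: "y > 0" "eseries p CARD('n) CARD('k) (diag_arg p w) = of_real y"
    using eseries_diag_pos[OF p w] by blast
  have x1: "nsq1 w < 1" using E_bounds[OF p w] by simp
  define A where "A = real CARD('n) + 1 + real CARD('k) / p"
  have "of_real (1 - nsq1 w) powr (- of_real A) = (of_real ((1 - nsq1 w) powr (- A)) :: complex)"
    using x1 by (subst powr_of_real[symmetric]) auto
  then have "ekernel \<kappa> p w w = of_real (\<kappa> * (1 - nsq1 w) powr (- A) * y)"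
    using y(2) unfolding ekernel_def A_def[symmetric] diag_arg_def[symmetric] by (simp add: herm_self)
  moreover have "\<kappa> * (1 - nsq1 w) powr (- A) * y > 0" using \<kappa> y x1 by simp
  ultimately show thesis by (rule that[rotated])
qed

lemma has_block_derivative_powr:
  assumes p: "p > 0" and w: "w \<in> E p"
  shows "has_block_derivative (\<lambda>w. (1 - herm1 w w) powr c) w (- c * (1 - herm1 w w) powr c / (1 - herm1 w w)) 0"
proof -
  have "((\<lambda>x. (1 - x) powr c) has_field_derivative (c * (1 - herm1 w w) powr (c - 1) * - 1)) (at (herm1 w w))"
    by (rule DERIV_chain2[of "\<lambda>x. x powr c"])
       (use one_minus_herm1_not_nonpos[OF p w w] in \<open>auto intro!: has_field_derivative_powr derivative_eq_intros\<close>)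
  from has_block_derivative_compose[OF has_block_derivative_herm(1) this]
  show ?thesis
    using one_minus_herm1_not_nonpos(2)[OF p w w] by (simp add: powr_diff)
qed

lemma has_block_derivative_diag_arg:
  assumes p: "p > 0" and w: "w \<in> E p"
  shows "has_block_derivative (diag_arg p) w (of_real (1 / p) * diag_arg p w / (1 - herm1 w w))
    ((1 - herm1 w w) powr (- of_real (1 / p)))"
  using has_block_derivative_mult[OF has_block_derivative_herm(2) has_block_derivative_powr[OF p w, of "- of_real (1 / p)"]]
  unfolding diag_arg_def[abs_def] by (simp add: algebra_simps)

text \<open>Up to a constant the logarithm is -A log (1 - x) + log \<Phi> (y (1 - x)^(-s)), with x =
  |z|^2, y = |\<xi>|^2 and s = 1/p; these are its two partial derivatives.\<close>

lemma has_block_derivative_log_ekernel: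
  fixes w :: "complex^('n::finite + 'k::finite)"
  assumes p: "p > 0" and w: "w \<in> E p" and \<kappa>: "\<kappa> > 0"
  defines "H \<equiv> log_deriv p CARD('n) CARD('k)" and "A \<equiv> real CARD('n) + 1 + real CARD('k) / p"
  shows "has_block_derivative (\<lambda>w. ln (ekernel \<kappa> p w w)) w
    ((of_real A + of_real (1 / p) * diag_arg p w * H (diag_arg p w)) / (1 - herm1 w w))
    ((1 - herm1 w w) powr (- of_real (1 / p)) * H (diag_arg p w))"
proof -
  let ?\<Phi> = "eseries p CARD('n) CARD('k)" and ?R = "diag_arg p w" and ?x = "1 - herm1 w w"
  define f1 where "f1 = ?x powr (- of_real A)"
  have x0: "?x \<noteq> 0" using one_minus_herm1_not_nonpos(2)[OF p w w] .
  obtain y where y: "y > 0" "?\<Phi> ?R = of_real y" using eseries_diag_pos[OF p w] by blast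
  then have \<Phi>0: "?\<Phi> ?R \<noteq> 0" by auto
  have f10: "f1 \<noteq> 0" using x0 by (simp add: f1_def powr_def)
  have K: "(\<lambda>w. ekernel \<kappa> p w w) = (\<lambda>w :: complex^('n + 'k). (of_real \<kappa> * (1 - herm1 w w) powr (- of_real A)) * ?\<Phi> (diag_arg p w))"
    unfolding ekernel_def diag_arg_def A_def ..
  have K_eq: "ekernel \<kappa> p w w = of_real \<kappa> * f1 * ?\<Phi> ?R"
    unfolding f1_def using fun_cong[OF K, of w] .
  have d\<Phi>: "(?\<Phi> has_field_derivative deriv ?\<Phi> ?R) (at ?R)"
    by (rule field_differentiable_derivI) (rule eseries_field_differentiable[OF p norm_diag_arg_less_1[OF p w]])
  have "has_block_derivative (\<lambda>w. ekernel \<kappa> p w w) w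
    ((0 * f1 + of_real \<kappa> * (- (- of_real A) * f1 / ?x)) * ?\<Phi> ?R + (of_real \<kappa> * f1) * (deriv ?\<Phi> ?R * (of_real (1 / p) * ?R / ?x)))
    ((0 * f1 + of_real \<kappa> * 0) * ?\<Phi> ?R + (of_real \<kappa> * f1) * (deriv ?\<Phi> ?R * ?x powr (- of_real (1 / p))))"
    unfolding K f1_def
    by (intro has_block_derivative_mult has_block_derivative_const has_block_derivative_powr[OF p w]
        has_block_derivative_compose[OF has_block_derivative_diag_arg[OF p w] d\<Phi>])
  moreover have "(ln has_field_derivative inverse (ekernel \<kappa> p w w)) (at (ekernel \<kappa> p w w))"
  proof (rule has_field_derivative_Ln)
    obtain y where "y > 0" "ekernel \<kappa> p w w = of_real y" using ekernel_diag_pos[OF p w \<kappa>] by blast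
    then show "ekernel \<kappa> p w w \<notin> \<real>\<^sub>\<le>\<^sub>0" by simp
  qed
  ultimately have D: "has_block_derivative (\<lambda>w. ln (ekernel \<kappa> p w w)) w
    (inverse (ekernel \<kappa> p w w) * ((0 * f1 + of_real \<kappa> * (- (- of_real A) * f1 / ?x)) * ?\<Phi> ?R + (of_real \<kappa> * f1) * (deriv ?\<Phi> ?R * (of_real (1 / p) * ?R / ?x))))
    (inverse (ekernel \<kappa> p w w) * ((0 * f1 + of_real \<kappa> * 0) * ?\<Phi> ?R + (of_real \<kappa> * f1) * (deriv ?\<Phi> ?R * ?x powr (- of_real (1 / p)))))"
    by (rule has_block_derivative_compose)
  define u v a d where "u = ?\<Phi> ?R" and "v = deriv ?\<Phi> ?R" and "a = (of_real A :: complex)" and "d = (of_real (1 / p) * ?R :: complex)"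
  have k0: "of_real \<kappa> \<noteq> (0::complex)" using \<kappa> by simp
  have "inverse (of_real \<kappa> * f1 * u) * ((0 * f1 + of_real \<kappa> * (- (- a) * f1 / ?x)) * u + (of_real \<kappa> * f1) * (v * (d / ?x)))
    = (a + d * (v / u)) / ?x"
  proof -
    have "inverse (k * f * u) * ((0 * f + k * (- (- a) * f / X)) * u + (k * f) * (v * (d / X))) = (a + d * (v / u)) / X"
      if "k \<noteq> 0" "f \<noteq> 0" "u \<noteq> 0" "X \<noteq> 0" for k f u X :: complex
      using that by (simp add: field_simps)
    then show ?thesis using k0 f10 \<Phi>0 x0 unfolding u_def[symmetric] by blast
  qed
  moreover have "inverse (of_real \<kappa> * f1 * u) * ((0 * f1 + of_real \<kappa> * 0) * u + (of_real \<kappa> * f1) * (v * ?x powr (- of_real (1 / p))))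
    = ?x powr (- of_real (1 / p)) * (v / u)"
    using k0 f10 \<Phi>0 unfolding u_def[symmetric] by (simp add: field_simps)
  ultimately show ?thesis
    using D unfolding K_eq H_def log_deriv_def u_def[symmetric] v_def[symmetric] a_def[symmetric] d_def[symmetric]
    by (simp only:)
qed

text \<open>\<kappa> contributes an additive constant to the logarithm and has disappeared from the
  derivatives.\<close>

lemma has_block_derivative_log_bergman_kernel:
  assumes p: "p > 0"
  shows "\<forall>w\<in>(E p :: (complex^('n::finite + 'k::finite)) set).
    has_block_derivative (\<lambda>w. ln (bergman_kernel (E p) w w)) w
    ((of_real (real CARD('n) + 1 + real CARD('k) / p) + of_real (1 / p) * diag_arg p w * log_deriv p CARD('n) CARD('k) (diag_arg p w)) / (1 - herm1 w w))
    ((1 - herm1 w w) powr (- of_real (1 / p)) * log_deriv p CARD('n) CARD('k) (diag_arg p w))"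
proof
  fix w :: "complex^('n + 'k)" assume w: "w \<in> E p"
  obtain \<kappa> where \<kappa>: "\<kappa> > 0"
    "\<And>z w :: complex^('n + 'k). z \<in> E p \<Longrightarrow> w \<in> E p \<Longrightarrow> bergman_kernel (E p) z w = ekernel \<kappa> p z w"
    using bergman_kernel_E[OF p] by metis
  show "has_block_derivative (\<lambda>w. ln (bergman_kernel (E p) w w)) w
    ((of_real (real CARD('n) + 1 + real CARD('k) / p) + of_real (1 / p) * diag_arg p w * log_deriv p CARD('n) CARD('k) (diag_arg p w)) / (1 - herm1 w w))
    ((1 - herm1 w w) powr (- of_real (1 / p)) * log_deriv p CARD('n) CARD('k) (diag_arg p w))"
    by (rule has_block_derivative_transform[OF has_block_derivative_log_ekernel[OF p w \<kappa>(1)] open_E[OF p] w])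
       (simp add: \<kappa>(2))
qed

text \<open>Identity rows are turned into perturbed rows one at a time. By linearity in the new row,
  each turn adds u k times a determinant in which row k is v.\<close>

lemma det_identity_plus_rank_one:
  fixes u :: "'m::finite \<Rightarrow> 'a::field" and v :: "'a^'m"
  shows "det (\<chi> i. axis i 1 + u i *s v) = 1 + (\<Sum>i\<in>UNIV. u i * v $ i)"
proof -
  define B where "B S i = (if i \<in> S then axis i 1 + u i *s v else axis i 1)" for S i
  have id: "(\<chi> i. axis i 1) = (mat 1 :: 'a^'m^'m)"
    by (simp add: vec_eq_iff mat_def axis_def)
  \<comment> \<open>Once row k equals v, splitting any other perturbed row yields a summand with two
    rows equal to v, which vanishes.\<close>
  have replaced: "det (\<chi> i. if i = k then v else B S i) = v $ k" if "finite S" "k \<notin> S" for S k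
    using that
  proof (induction S)
    case empty
    have row: "row i (mat 1) = (axis i 1 :: 'a^'m)" for i
      by (simp add: vec_eq_iff row_def mat_def axis_def)
    have "det (\<chi> i. if i = k then (\<Sum>i\<in>UNIV. v $ i *s row i (mat 1)) else row i (mat 1)) = v $ k * det (mat 1 :: 'a^'m^'m)"
      by (rule cramer_lemma_transpose)
    then have "det (\<chi> i. if i = k then v else axis i 1) = v $ k * det (mat 1 :: 'a^'m^'m)"
      unfolding row basis_expansion .
    then show ?case by (simp add: B_def cong: if_cong)
  next
    case (insert j S)
    then have jk: "j \<noteq> k" by auto
    let ?c = "\<lambda>i. if i = k then v else B S i"
    have "(\<chi> i. if i = k then v else B (insert j S) i) = (\<chi> i. if i = j then axis j 1 + u j *s v else ?c i)"
      using insert.hyps jk by (auto simp: vec_eq_iff B_def)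
    then have "det (\<chi> i. if i = k then v else B (insert j S) i)
      = det (\<chi> i. if i = j then axis j 1 else ?c i) + det (\<chi> i. if i = j then u j *s v else ?c i)"
      by (simp only: det_row_add)
    also have "(\<chi> i. if i = j then axis j 1 else ?c i) = (\<chi> i. ?c i)"
      using insert.hyps jk by (auto simp: vec_eq_iff B_def)
    also have "det (\<chi> i. if i = j then u j *s v else ?c i) = u j * det (\<chi> i. if i = j then v else ?c i)"
      by (rule det_row_mul)
    also have "det (\<chi> i. if i = j then v else ?c i) = 0"
      using jk by (intro det_identical_rows[of j k]) (auto simp: row_def vec_eq_iff)
    finally show ?case using insert by simp
  qed
  have "det (\<chi> i. B S i) = 1 + (\<Sum>i\<in>S. u i * v $ i)" if "finite S" for S
    using that
  proof (induction S)
    case empty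
    then show ?case by (simp add: B_def id)
  next
    case (insert k S)
    have "(\<chi> i. B (insert k S) i) = (\<chi> i. if i = k then axis k 1 + u k *s v else B S i)"
      using insert.hyps by (auto simp: vec_eq_iff B_def)
    then have "det (\<chi> i. B (insert k S) i)
      = det (\<chi> i. if i = k then axis k 1 else B S i) + det (\<chi> i. if i = k then u k *s v else B S i)"
      by (simp only: det_row_add)
    also have "(\<chi> i. if i = k then axis k 1 else B S i) = (\<chi> i. B S i)"
      using insert.hyps by (auto simp: vec_eq_iff B_def)
    also have "det (\<chi> i. if i = k then u k *s v else B S i) = u k * det (\<chi> i. if i = k then v else B S i)"
      by (rule det_row_mul)
    finally show ?case using insert replaced by (simp add: algebra_simps)
  qed
  from this[of UNIV] show ?thesis by (simp add: B_def)
qed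

text \<open>For p = 1 the coefficient is (n + k + j)!/j!, that is (n + k)! times the j-th
  coefficient of (1 - x)^(-(n + k + 1)).\<close>

lemma eseries_1:
  assumes "norm x < 1"
  shows "eseries 1 n k x = fact (n + k) * (1 - x) powr (- of_real (real (n + k + 1)))"
proof -
  have c: "ecoeff 1 n k j = fact (n + k) * (pochhammer (real (n + k + 1)) j / fact j)" for j
  proof -
    have fact_add: "fact (m + l) = (fact m * pochhammer (1 + real m) l :: real)" for m l
      using pochhammer_product'[of "1::real" m l] unfolding pochhammer_fact[symmetric] .
    note fact_add[of "j + k" n]
    moreover note fact_add[of "n + k" j]
    moreover have "j + k + n = n + k + j" by simp
    ultimately show ?thesis by (simp add: ecoeff_def add_ac)
  qed
  have "(\<lambda>j. fact (n + k) * (of_real (pochhammer (real (n + k + 1)) j / fact j) * x ^ j)) sums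
      (fact (n + k) * (1 - x) powr (- of_real (real (n + k + 1))))"
    using assms by (intro sums_mult binomial_series_powr)
  moreover have "(\<lambda>j. of_real (ecoeff 1 n k j) * x ^ j) sums eseries 1 n k x"
    by (rule eseries_sums) (use assms in auto)
  ultimately show ?thesis unfolding c by (simp add: mult.assoc sums_unique2)
qed

lemma log_deriv_1:
  assumes "norm x < 1"
  shows "log_deriv 1 n k x = of_nat (n + k + 1) / (1 - x)"
proof -
  define M where "M = real (n + k + 1)"
  have x: "1 - x \<notin> \<real>\<^sub>\<le>\<^sub>0" "1 - x \<noteq> 0"
    using assms complex_Re_le_cmod[of x] by (auto simp: complex_nonpos_Reals_iff)
  have "((\<lambda>x. fact (n + k) * (1 - x) powr (- of_real M)) has_field_derivative
      fact (n + k) * ((- of_real M) * (1 - x) powr (- of_real M - 1) * - 1)) (at x)"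
    by (rule DERIV_cmult, rule DERIV_chain2[of "\<lambda>x. x powr (- of_real M)"])
       (use x in \<open>auto intro!: has_field_derivative_powr derivative_eq_intros\<close>)
  then have "(eseries 1 n k has_field_derivative
      fact (n + k) * ((- of_real M) * (1 - x) powr (- of_real M - 1) * - 1)) (at x)"
    by (rule has_field_derivative_transform_within_open[OF _ open_ball, of _ _ _ 0 1])
       (use assms in \<open>auto simp: eseries_1 M_def\<close>)
  then have "deriv (eseries 1 n k) x = fact (n + k) * ((- of_real M) * (1 - x) powr (- of_real M - 1) * - 1)"
    by (rule DERIV_imp_deriv)
  then have "log_deriv 1 n k x = of_real M / (1 - x)"
    unfolding log_deriv_def eseries_1[OF assms] M_def[symmetric]
    using x by (simp add: powr_diff)
  then show ?thesis by (simp add: M_def)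
qed

section \<open>The ball\<close>

text \<open>The Hessian is determined by the two block derivatives. They equal M / \<delta> for the
  logarithm of the kernel and again for log det g, so both have the same Hessian and the Ricci form
  is -g.\<close>

lemma kaehler_einstein_ball:
  "kaehler_einstein_on (E 1) (bergman_metric (E 1 :: (complex^('n::finite + 'k::finite)) set))"
proof -
  let ?D = "E 1 :: (complex^('n + 'k)) set" and ?g = "bergman_metric (E 1 :: (complex^('n + 'k)) set)"
  define N where "N = CARD('n) + CARD('k)"
  define M :: complex where "M = of_nat (N + 1)"
  define \<delta> where "\<delta> w = 1 - (herm1 w w + herm2 w w)" for w :: "complex^('n + 'k)"
  have D: "open ?D" by (rule open_E) simp
  have \<delta>_real: "\<delta> w = of_real (1 - (norm w)\<^sup>2)" for w
    by (simp add: \<delta>_def herm_self norm_square_eq_nsq)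
  have \<delta>_pos: "0 < 1 - (norm w)\<^sup>2" if "w \<in> ?D" for w
    using that by (simp add: E_iff norm_square_eq_nsq)
  have \<delta>0: "\<delta> w \<noteq> 0" if "w \<in> ?D" for w
    using \<delta>_pos[OF that] unfolding \<delta>_real of_real_eq_0_iff by linarith
  have cnj_\<delta>: "cnj (\<delta> w) = \<delta> w" for w unfolding \<delta>_real by simp
  have sum_sq: "(\<Sum>i\<in>UNIV. cnj (w $ i) * w $ i) = 1 - \<delta> w" for w
    unfolding \<delta>_def herm1_def herm2_def hprod_def by (simp add: sum_UNIV_Plus mult.commute)
  have \<delta>_deriv: "has_block_derivative \<delta> w (- 1) (- 1)" for w
  proof -
    have "has_block_derivative (\<lambda>w. 1 + - 1 * (herm1 w w + herm2 w w)) w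
      (0 + (0 * (herm1 w w + herm2 w w) + - 1 * (1 + 0))) (0 + (0 * (herm1 w w + herm2 w w) + - 1 * (0 + 1)))"
      by (intro has_block_derivative_add has_block_derivative_mult has_block_derivative_const has_block_derivative_herm)
    moreover have "(\<lambda>w. 1 + - 1 * (herm1 w w + herm2 w w)) = \<delta>" by (simp add: fun_eq_iff \<delta>_def)
    ultimately show ?thesis by simp
  qed
  have P_deriv: "has_block_derivative (\<lambda>w. M / \<delta> w) w (M / (\<delta> w)\<^sup>2) (M / (\<delta> w)\<^sup>2)" if w: "w \<in> ?D" for w
  proof -
    have "((\<lambda>x. M / x) has_field_derivative - M / (\<delta> w)\<^sup>2) (at (\<delta> w))"
      using \<delta>0[OF w] by (auto intro!: derivative_eq_intros simp: power2_eq_square)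
    from has_block_derivative_compose[OF \<delta>_deriv this] show ?thesis by simp
  qed
  have P2_deriv: "has_block_derivative (\<lambda>w. M / (\<delta> w)\<^sup>2) w (2 * M / (\<delta> w) ^ 3) (2 * M / (\<delta> w) ^ 3)" if w: "w \<in> ?D" for w
  proof -
    have "((\<lambda>x. M / x\<^sup>2) has_field_derivative - (2 * M / (\<delta> w) ^ 3)) (at (\<delta> w))"
      using \<delta>0[OF w] by (auto intro!: derivative_eq_intros simp: power2_eq_square power3_eq_cube field_simps)
    from has_block_derivative_compose[OF \<delta>_deriv this] show ?thesis by simp
  qed
  have L_deriv: "has_block_derivative (\<lambda>w. ln (bergman_kernel ?D w w)) w (M / \<delta> w) (M / \<delta> w)" if w: "w \<in> ?D" for w
  proof -
    define X where "X = 1 - herm1 w w"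
    have X0: "X \<noteq> 0" unfolding X_def using one_minus_herm1_not_nonpos(2)[OF _ w w] by simp
    have powr: "X powr (- 1) = 1 / X" using X0 by (simp add: powr_minus divide_inverse)
    have R: "diag_arg 1 w = herm2 w w / X"
      using powr by (simp add: diag_arg_def X_def[symmetric])
    have "1 - herm2 w w / X = \<delta> w / X" using X0 by (simp add: \<delta>_def X_def field_simps)
    then have H: "log_deriv 1 CARD('n) CARD('k) (diag_arg 1 w) = M * X / \<delta> w"
      using log_deriv_1[OF norm_diag_arg_less_1[of 1 w], of "CARD('n)" "CARD('k)"] w \<delta>0[OF w] X0
      by (simp add: R M_def N_def)
    have "(M + (1 - \<delta> w / X) * (M * X / \<delta> w)) / X = M / \<delta> w"
      using X0 \<delta>0[OF w] by (simp add: field_simps)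
    moreover have "1 - \<delta> w / X = herm2 w w / X" using X0 by (simp add: \<delta>_def X_def field_simps)
    ultimately have 1: "(M + herm2 w w / X * (M * X / \<delta> w)) / X = M / \<delta> w" by simp
    have 2: "1 / X * (M * X / \<delta> w) = M / \<delta> w" using X0 by simp
    have MA: "of_real (real CARD('n) + 1 + real CARD('k) / 1) = M" by (simp add: M_def N_def)
    have "has_block_derivative (\<lambda>w. ln (bergman_kernel ?D w w)) w
      ((M + of_real (1 / 1) * diag_arg 1 w * log_deriv 1 CARD('n) CARD('k) (diag_arg 1 w)) / X)
      (X powr (- of_real (1 / 1)) * log_deriv 1 CARD('n) CARD('k) (diag_arg 1 w))"
      unfolding X_def MA[symmetric] using has_block_derivative_log_bergman_kernel[of 1, where 'n = 'n and 'k = 'k] w by simp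
    moreover have "(M + of_real (1 / 1) * diag_arg 1 w * log_deriv 1 CARD('n) CARD('k) (diag_arg 1 w)) / X = M / \<delta> w"
      unfolding H unfolding R using 1 by simp
    moreover have "X powr (- of_real (1 / 1)) * log_deriv 1 CARD('n) CARD('k) (diag_arg 1 w) = M / \<delta> w"
      unfolding H using 2 powr by simp
    ultimately show ?thesis by (simp only:)
  qed
  have hess: "complex_hessian L w $ s $ t = (if s = t then M / \<delta> w else 0) + cnj (w $ s) * w $ t * (M / (\<delta> w)\<^sup>2)"
    if L: "\<And>w. w \<in> ?D \<Longrightarrow> has_block_derivative L w (M / \<delta> w) (M / \<delta> w)" and w: "w \<in> ?D" for L w s t
  proof -
    have "blockwise x x i = x" for x :: complex and i :: "'n + 'k" by (cases i) auto
    then show ?thesis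
      using complex_hessian_block[OF D L w P_deriv[OF w] P_deriv[OF w], of s t] by simp
  qed
  have g: "?g w $ s $ t = (if s = t then M / \<delta> w else 0) + cnj (w $ s) * w $ t * (M / (\<delta> w)\<^sup>2)" if "w \<in> ?D" for w s t
    unfolding bergman_metric_def by (rule hess[OF L_deriv that])
  have \<delta>_Ck: "Ck_on k ?D \<delta>" for k
  proof -
    have "Ck_on k ?D (\<lambda>w. 1 + - 1 * (\<Sum>i\<in>UNIV. cnj (w $ i) * w $ i))"
      by (intro Ck_on_add[OF D] Ck_on_mult[OF D] Ck_on_sum[OF D] Ck_on_const Ck_on_bounded_linear[OF D]
          bounded_linear_vec_nth bounded_linear_compose[OF bounded_linear_cnj])
    then show ?thesis unfolding sum_sq by simp
  qed
  have Ck: "Ck_on k ?D (\<lambda>w. ?g w $ s $ t)" for k s t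
  proof -
    have "Ck_on k ?D (\<lambda>w. (if s = t then M else 0) * inverse (\<delta> w) + cnj (w $ s) * w $ t * (M * (inverse (\<delta> w) * inverse (\<delta> w))))"
      by (intro Ck_on_add[OF D] Ck_on_mult[OF D] Ck_on_const Ck_on_bounded_linear[OF D] Ck_on_inverse[OF D] \<delta>_Ck \<delta>0
          bounded_linear_vec_nth bounded_linear_compose[OF bounded_linear_cnj])
    then show ?thesis
      by (subst Ck_on_cong[OF D, of _ "\<lambda>w. (if s = t then M else 0) * inverse (\<delta> w) + cnj (w $ s) * w $ t * (M * (inverse (\<delta> w) * inverse (\<delta> w)))"])
         (auto simp: g divide_inverse power2_eq_square)
  qed
  have herm: "?g w $ t $ s = cnj (?g w $ s $ t)" if "w \<in> ?D" for w s t
    using that by (simp add: g cnj_\<delta> M_def mult.commute)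
  have pos: "0 < Re (\<Sum>s\<in>UNIV. \<Sum>t\<in>UNIV. ?g w $ s $ t * v $ s * cnj (v $ t))" if w: "w \<in> ?D" and v: "v \<noteq> 0" for w v
  proof -
    define d where "d = 1 - (norm w)\<^sup>2"
    have d: "d > 0" "\<delta> w = of_real d" using \<delta>_pos[OF w] by (simp_all add: d_def \<delta>_real)
    \<comment> \<open>The second term of g has rank one, so it contributes M / \<delta>^2 times
      |S|^2 to the quadratic form.\<close>
    define S where "S = (\<Sum>s\<in>UNIV. cnj (w $ s) * v $ s)"
    have "(\<Sum>s\<in>UNIV. \<Sum>t\<in>UNIV. ?g w $ s $ t * v $ s * cnj (v $ t))
      = (\<Sum>s\<in>UNIV. \<Sum>t\<in>UNIV. (if s = t then M / \<delta> w * (v $ s * cnj (v $ s)) else 0)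
          + M / (\<delta> w)\<^sup>2 * ((cnj (w $ s) * v $ s) * (w $ t * cnj (v $ t))))"
      by (intro sum.cong refl) (auto simp: g[OF w] algebra_simps)
    also have "\<dots> = M / \<delta> w * (\<Sum>s\<in>UNIV. v $ s * cnj (v $ s)) + M / (\<delta> w)\<^sup>2 * (S * cnj S)"
    proof -
      have "S * cnj S = (\<Sum>s\<in>UNIV. \<Sum>t\<in>UNIV. (cnj (w $ s) * v $ s) * (w $ t * cnj (v $ t)))"
        by (simp only: S_def cnj_sum sum_product complex_cnj_mult complex_cnj_cnj)
      then show ?thesis
        by (simp only: sum.distrib sum_distrib_left) (simp add: sum_distrib_left)
    qed
    also have "(\<Sum>s\<in>UNIV. v $ s * cnj (v $ s)) = of_real ((norm v)\<^sup>2)"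
      using hprod_self[of v] by (simp add: hprod_def)
    also have "M / \<delta> w * of_real ((norm v)\<^sup>2) + M / (\<delta> w)\<^sup>2 * (S * cnj S)
      = of_real (real (N + 1) / d * (norm v)\<^sup>2 + real (N + 1) / d\<^sup>2 * (norm S)\<^sup>2)"
      unfolding complex_norm_square[symmetric] by (simp add: M_def d(2))
    finally have "Re (\<Sum>s\<in>UNIV. \<Sum>t\<in>UNIV. ?g w $ s $ t * v $ s * cnj (v $ t))
      = real (N + 1) / d * (norm v)\<^sup>2 + real (N + 1) / d\<^sup>2 * (norm S)\<^sup>2" by (simp only: Re_complex_of_real)
    moreover have "real (N + 1) / d * (norm v)\<^sup>2 > 0" using d v by simp
    moreover have "real (N + 1) / d\<^sup>2 * (norm S)\<^sup>2 \<ge> 0" by simp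
    ultimately show ?thesis by linarith
  qed
  have closed: "wirtinger u (\<lambda>w. ?g w $ s $ t) w = wirtinger s (\<lambda>w. ?g w $ u $ t) w" if w: "w \<in> ?D" for w s t u
  proof -
    have "wirtinger u (\<lambda>w. ?g w $ s $ t) w = (if s = t then cnj (w $ u) else 0) * (M / (\<delta> w)\<^sup>2)
       + cnj (w $ s) * (if u = t then 1 else 0) * (M / (\<delta> w)\<^sup>2)
       + cnj (w $ s) * w $ t * (2 * M / (\<delta> w) ^ 3 * cnj (w $ u))" for s u
    proof -
      have bw: "blockwise x x i = x" for x :: complex and i :: "'n + 'k" by (cases i) auto
      note dP = has_block_derivative_differentiable[OF P_deriv[OF w]]
      note dP2 = has_block_derivative_differentiable[OF P2_deriv[OF w]]
      have "wirtinger u (\<lambda>w. ?g w $ s $ t) w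
        = wirtinger u (\<lambda>w. (if s = t then 1 else 0) * (M / \<delta> w) + cnj (w $ s) * w $ t * (M / (\<delta> w)\<^sup>2)) w"
        by (rule wirtinger_cong_open(1)[OF D w]) (simp add: g)
      also have "\<dots> = wirtinger u (\<lambda>w. (if s = t then 1 else 0) * (M / \<delta> w)) w
        + wirtinger u (\<lambda>w. cnj (w $ s) * w $ t * (M / (\<delta> w)\<^sup>2)) w"
        by (intro wirtinger_add differentiable_mult differentiable_coord dP dP2 differentiable_const)
      also have "wirtinger u (\<lambda>w. (if s = t then 1 else 0) * (M / \<delta> w)) w = (if s = t then cnj (w $ u) else 0) * (M / (\<delta> w)\<^sup>2)"
      proof -
        have "has_block_derivative (\<lambda>w. (if s = t then 1 else 0)) w 0 0" by (rule has_block_derivative_const)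
        from wirtinger_block_derivative(1)[OF has_block_derivative_mult[OF this P_deriv[OF w]], of u]
        show ?thesis by (simp add: bw)
      qed
      also have "wirtinger u (\<lambda>w. cnj (w $ s) * w $ t * (M / (\<delta> w)\<^sup>2)) w
        = cnj (w $ s) * w $ t * wirtinger u (\<lambda>w. M / (\<delta> w)\<^sup>2) w + wirtinger u (\<lambda>w. cnj (w $ s) * w $ t) w * (M / (\<delta> w)\<^sup>2)"
        by (intro wirtinger_mult differentiable_mult differentiable_coord dP2)
      also have "wirtinger u (\<lambda>w. cnj (w $ s) * w $ t) w
        = cnj (w $ s) * wirtinger u (\<lambda>w. w $ t) w + wirtinger u (\<lambda>w. cnj (w $ s)) w * w $ t"
        by (intro wirtinger_mult differentiable_coord)
      finally show ?thesis
        unfolding wirtinger_coord wirtinger_block_derivative(1)[OF P2_deriv[OF w]] bw by simp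
    qed
    then show ?thesis by (simp add: algebra_simps)
  qed
  have det: "det (?g w) = M ^ N / (\<delta> w) ^ (N + 1)" if w: "w \<in> ?D" for w
  proof -
    \<comment> \<open>Taking M / \<delta> out of each row leaves the identity plus a rank-one
      matrix, of determinant 1 + (1 - \<delta>) / \<delta> = 1 / \<delta>.\<close>
    define v where "v = (1 / \<delta> w) *s w"
    have "?g w = (\<chi> s. (M / \<delta> w) *s (axis s 1 + cnj (w $ s) *s v))"
      using \<delta>0[OF w] by (auto simp: vec_eq_iff g[OF w] v_def axis_def field_simps power2_eq_square)
    then have "det (?g w) = (\<Prod>s\<in>(UNIV :: ('n + 'k) set). M / \<delta> w) * det (\<chi> s. axis s 1 + cnj (w $ s) *s v)"
      by (simp only: det_rows_mul)
    also have "det (\<chi> s. axis s 1 + cnj (w $ s) *s v) = 1 + (\<Sum>s\<in>UNIV. cnj (w $ s) * v $ s)"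
      by (rule det_identity_plus_rank_one)
    also have "(\<Sum>s\<in>UNIV. cnj (w $ s) * v $ s) = (1 / \<delta> w) * (\<Sum>s\<in>UNIV. cnj (w $ s) * w $ s)"
      unfolding sum_distrib_left by (intro sum.cong) (auto simp: v_def)
    also have "(\<Prod>s\<in>(UNIV :: ('n + 'k) set). M / \<delta> w) = (M / \<delta> w) ^ N"
      by (simp add: N_def card_UNIV_sum)
    finally show ?thesis
      unfolding sum_sq using \<delta>0[OF w] by (simp add: power_divide field_simps)
  qed
  have ln_det: "has_block_derivative (\<lambda>w. ln (det (?g w))) w (M / \<delta> w) (M / \<delta> w)" if w: "w \<in> ?D" for w
  proof -
    \<comment> \<open>F expresses det g as a function of \<delta>; its value at
      \<open>\<delta> w\<close> is positive, hence off the branch cut of the logarithm.\<close>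
    define F where "F x = M ^ N * inverse (x ^ (N + 1))" for x :: complex
    have F_pos: "\<exists>y>0. F (\<delta> w) = of_real y"
      using \<delta>_pos[OF w] unfolding F_def M_def \<delta>_real
      by (intro exI[of _ "real (N + 1) ^ N * inverse ((1 - (norm w)\<^sup>2) ^ (N + 1))"]) simp
    then have F_ln: "F (\<delta> w) \<notin> \<real>\<^sub>\<le>\<^sub>0" by auto
    have F0: "F (\<delta> w) \<noteq> 0" using F_pos by auto
    have "(F has_field_derivative - (M * F (\<delta> w) / \<delta> w)) (at (\<delta> w))"
    proof -
      have "(F has_field_derivative M ^ N * (- (inverse (\<delta> w ^ (N + 1)) * (of_nat (N + 1) * \<delta> w ^ N) * inverse (\<delta> w ^ (N + 1))))) (at (\<delta> w))"
      proof -
        have "((\<lambda>x. x ^ (N + 1)) has_field_derivative of_nat (N + 1) * (1 * \<delta> w ^ (N + 1 - Suc 0))) (at (\<delta> w))"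
          by (rule DERIV_power[OF DERIV_ident])
        then have "((\<lambda>x. x ^ (N + 1)) has_field_derivative of_nat (N + 1) * \<delta> w ^ N) (at (\<delta> w))"
          by (simp only: add_diff_cancel_right' One_nat_def mult_1)
        then show ?thesis
          unfolding F_def[abs_def] using \<delta>0[OF w] by (intro DERIV_cmult DERIV_inverse') auto
      qed
      moreover have "M ^ N * (- (inverse (\<delta> w ^ (N + 1)) * (of_nat (N + 1) * \<delta> w ^ N) * inverse (\<delta> w ^ (N + 1))))
        = - (M * F (\<delta> w) / \<delta> w)"
      proof -
        have alg: "a * (- (inverse (d * q) * (m * q) * inverse (d * q))) = - (m * (a * inverse (d * q)) / d)"
          if "d \<noteq> 0" "q \<noteq> 0" for a d q m :: complex
          using that by (simp add: field_simps)
        have "\<delta> w ^ (N + 1) = \<delta> w * \<delta> w ^ N" by simp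
        then show ?thesis unfolding M_def[symmetric] F_def using alg \<delta>0[OF w] by (simp only:) simp
      qed
      ultimately show ?thesis by (simp only:)
    qed
    from DERIV_chain2[OF has_field_derivative_Ln[OF F_ln] this]
    have "((\<lambda>x. ln (F x)) has_field_derivative - (M / \<delta> w)) (at (\<delta> w))"
      using F0 by (simp add: field_simps)
    from has_block_derivative_compose[OF \<delta>_deriv this]
    have "has_block_derivative (\<lambda>w. ln (F (\<delta> w))) w (M / \<delta> w) (M / \<delta> w)" by simp
    then show ?thesis
      by (rule has_block_derivative_transform[OF _ D w]) (simp add: det F_def divide_inverse)
  qed
  have "ricci ?g w = (- 1) *\<^sub>R ?g w" if w: "w \<in> ?D" for w
    unfolding ricci_def using hess[OF ln_det w] g[OF w] by (simp add: vec_eq_iff)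
  then have "\<exists>c::real. \<forall>w\<in>?D. ricci ?g w = c *\<^sub>R ?g w" by blast
  with Ck herm pos closed show ?thesis
    unfolding kaehler_einstein_on_def kaehler_metric_on_def by blast
qed

section \<open>The case \<open>p \<noteq> 1\<close>\<close>

text \<open>The remainder \<open>s (n + 1) (1 - s)\<^sup>2\<close> is what singles out \<open>s = 1\<close>.\<close>

lemma pochhammer_ratio_step:
  fixes s k n :: real
  shows "((n + 1 + k * s) + 2 * s) * ((n + 1 + k * s) + 1) * ((k + 2) * (n + 1 + k * s) - n * s)
    = ((k + 2) * (n + 1 + k * s + 1) - (n + 1) * s) * ((n + 1 + k * s) + s)\<^sup>2 + s * (n + 1) * (1 - s)\<^sup>2"
  by (simp add: power2_eq_square algebra_simps)

text \<open>With u = n + 1 + k s, one more step multiplies the three Pochhammer symbols by u, u + s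
  and u + 2 s. Multiplying the hypothesis by (u + 2 s)(u + 1) and applying the identity yields the
  claim; the remainder is kept in the conclusion to produce strictness later.\<close>

lemma pochhammer_log_concavity_step:
  fixes s k :: real
  assumes "s > 0" "k > 0"
    and le: "((k + 2) * (real n + 1 + k * s) - real n * s) * (pochhammer ((k + 1) * s + 1) n)\<^sup>2
      \<le> (k + 2) * (real n + 1 + k * s) * (pochhammer ((k + 2) * s + 1) n * pochhammer (k * s + 1) n)"
  shows "((k + 2) * (real (Suc n) + 1 + k * s) - real (Suc n) * s) * (pochhammer ((k + 1) * s + 1) (Suc n))\<^sup>2
      + s * (real n + 1) * (1 - s)\<^sup>2 * (pochhammer ((k + 1) * s + 1) n)\<^sup>2
    \<le> (k + 2) * (real (Suc n) + 1 + k * s) * (pochhammer ((k + 2) * s + 1) (Suc n) * pochhammer (k * s + 1) (Suc n))"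
proof -
  define u N q0 q1 q2 where "u = real n + 1 + k * s" and "N = (k + 2) * (real n + 1 + k * s) - real n * s"
    and "q0 = pochhammer (k * s + 1) n" and "q1 = pochhammer ((k + 1) * s + 1) n" and "q2 = pochhammer ((k + 2) * s + 1) n"
  have u: "u > 0" using assms by (simp add: u_def add_nonneg_pos)
  have step: "(u + 2 * s) * (u + 1) * N = ((k + 2) * (u + 1) - (real n + 1) * s) * (u + s)\<^sup>2 + s * (real n + 1) * (1 - s)\<^sup>2"
    unfolding u_def N_def by (rule pochhammer_ratio_step)
  have expand: "W * (q * v)\<^sup>2 + e * q\<^sup>2 = (W * v\<^sup>2 + e) * q\<^sup>2" for W v e q :: real
    by (simp add: power_mult_distrib distrib_right)
  have "((k + 2) * (u + 1) - (real n + 1) * s) * (q1 * (u + s))\<^sup>2 + s * (real n + 1) * (1 - s)\<^sup>2 * q1\<^sup>2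
    = (u + 2 * s) * (u + 1) * (N * q1\<^sup>2)"
    unfolding expand step[symmetric] by simp
  also have "\<dots> \<le> (u + 2 * s) * (u + 1) * ((k + 2) * u * (q2 * q0))"
    using le u assms unfolding N_def u_def q0_def q1_def q2_def by (intro mult_left_mono) auto
  also have "\<dots> = (k + 2) * (u + 1) * ((q2 * (u + 2 * s)) * (q0 * u))"
    by (simp add: mult_ac)
  moreover have "pochhammer ((k + 1) * s + 1) (Suc n) = q1 * (u + s)" "pochhammer ((k + 2) * s + 1) (Suc n) = q2 * (u + 2 * s)"
    "pochhammer (k * s + 1) (Suc n) = q0 * u" "real (Suc n) + 1 + k * s = u + 1" "real (Suc n) = real n + 1"
    by (simp_all add: pochhammer_Suc q0_def q1_def q2_def u_def algebra_simps)
  ultimately show ?thesis by (simp only: q1_def[symmetric])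
qed

lemma pochhammer_log_concavity_le:
  fixes s k :: real
  assumes "s > 0" "k > 0"
  shows "((k + 2) * (real n + 1 + k * s) - real n * s) * (pochhammer ((k + 1) * s + 1) n)\<^sup>2
    \<le> (k + 2) * (real n + 1 + k * s) * (pochhammer ((k + 2) * s + 1) n * pochhammer (k * s + 1) n)"
proof (induction n)
  case (Suc n)
  have "0 \<le> s * (real n + 1) * (1 - s)\<^sup>2 * (pochhammer ((k + 1) * s + 1) n)\<^sup>2" using assms by simp
  with pochhammer_log_concavity_step[OF assms Suc.IH] show ?case by linarith
qed (use assms in simp)

text \<open>At n = 0 both sides agree, so strictness comes from the remainder of the last step,
  which is positive for s \<noteq> 1.\<close>

lemma pochhammer_log_concavity_less:
  fixes s k :: real
  assumes "s > 0" "k > 0" "s \<noteq> 1" "n > 0"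
  shows "((k + 2) * (real n + 1 + k * s) - real n * s) * (pochhammer ((k + 1) * s + 1) n)\<^sup>2
    < (k + 2) * (real n + 1 + k * s) * (pochhammer ((k + 2) * s + 1) n * pochhammer (k * s + 1) n)"
proof -
  obtain m where m: "n = Suc m" using assms(4) gr0_implies_Suc by blast
  have "pochhammer ((k + 1) * s + 1) m > 0"
    using assms by (intro pochhammer_pos) (auto intro!: add_nonneg_pos)
  then have "0 < s * (real m + 1) * (1 - s)\<^sup>2 * (pochhammer ((k + 1) * s + 1) m)\<^sup>2"
    using assms by simp
  with pochhammer_log_concavity_step[OF assms(1,2) pochhammer_log_concavity_le[OF assms(1,2), of m]]
  show ?thesis unfolding m by linarith
qed

text \<open>The hypothesis is the Einstein equation at 0 in a \<xi>-direction, with the value and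
  derivative at 0 of the logarithmic derivative of \<Phi> written through Taylor coefficients. Since
  a0, a1, a2 are k! q0, (k + 1)! q1 and (k + 2)!/2 q2, clearing denominators leads to an equality
  that the strict inequality excludes.\<close>

lemma einstein_coefficient_equation:
  fixes p :: real
  assumes p: "p > 0" and n: "n > 0" and k: "k > 0"
  defines "a \<equiv> ecoeff p n k" and "A \<equiv> real n + 1 + real k / p"
  assumes eq: "real n * (1 / p) * (a 1 / a 0) / A + (real k + 1) * (2 * a 2 / a 0 - (a 1 / a 0)\<^sup>2) / (a 1 / a 0) = a 1 / a 0"
  shows "p = 1"
proof (rule ccontr)
  assume p1: "p \<noteq> 1"
  define s where "s = 1 / p"
  have s: "s > 0" "s \<noteq> 1" using p p1 by (auto simp: s_def)
  define K q0 q1 q2 where "K = real k" and "q0 = pochhammer (K * s + 1) n" and "q1 = pochhammer ((K + 1) * s + 1) n"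
    and "q2 = pochhammer ((K + 2) * s + 1) n"
  have K: "K > 0" using k by (simp add: K_def)
  have q: "q0 > 0" "q1 > 0" "q2 > 0"
    unfolding q0_def q1_def q2_def using s K by (auto intro!: pochhammer_pos add_nonneg_pos)
  have a0: "a 0 = fact k * q0"
    by (simp add: a_def ecoeff_def q0_def K_def s_def)
  have a1: "a 1 = (K + 1) * fact k * q1"
    by (simp add: a_def ecoeff_def q1_def K_def s_def add.commute)
  have a2: "a 2 = (K + 2) * (K + 1) / 2 * fact k * q2"
  proof -
    have "fact (2 + k) = (K + 2) * (K + 1) * (fact k :: real)"
      by (simp add: K_def algebra_simps numeral_2_eq_2)
    then show ?thesis by (simp add: a_def ecoeff_def q2_def K_def s_def add.commute)
  qed
  have A: "A = real n + 1 + K * s" "A > 0" using p k by (simp_all add: A_def K_def s_def add_pos_nonneg)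
  have f: "(fact k :: real) \<noteq> 0" by simp
  have h: "a 1 / a 0 = (K + 1) * q1 / q0" unfolding a0 a1 using q f by simp
  have h2: "2 * a 2 / a 0 = (K + 2) * (K + 1) * q2 / q0" unfolding a0 a2 using q f by simp
  have "real n * s * ((K + 1) * q1 / q0) / A + (K + 1) * ((K + 2) * (K + 1) * q2 / q0 - ((K + 1) * q1 / q0)\<^sup>2) / ((K + 1) * q1 / q0)
    = (K + 1) * q1 / q0"
    using eq unfolding h h2 s_def K_def .
  then have "real n * s * q1 / (q0 * A) + ((K + 2) * q2 / q1 - (K + 1) * q1 / q0) = q1 / q0"
  proof -
    assume *: "real n * s * ((K + 1) * q1 / q0) / A + (K + 1) * ((K + 2) * (K + 1) * q2 / q0 - ((K + 1) * q1 / q0)\<^sup>2) / ((K + 1) * q1 / q0)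
      = (K + 1) * q1 / q0"
    have K1: "K + 1 > 0" using K by simp
    have "real n * s * ((K + 1) * q1 / q0) / A + (K + 1) * ((K + 2) * (K + 1) * q2 / q0 - ((K + 1) * q1 / q0)\<^sup>2) / ((K + 1) * q1 / q0)
      = (K + 1) * (real n * s * q1 / (q0 * A) + ((K + 2) * q2 / q1 - (K + 1) * q1 / q0))"
    proof -
      have key: "m * (b * e / d) / A + b * (y * b * c / d - (b * e / d)\<^sup>2) / (b * e / d) = b * (m * e / (d * A) + (y * c / e - b * e / d))"
        if "b > 0" "e > 0" "d > 0" for m y b c d e :: real
        using that A(2) by (simp add: field_simps power2_eq_square)
      show ?thesis by (rule key[OF K1 q(2) q(1)])
    qed
    with * have "(K + 1) * (real n * s * q1 / (q0 * A) + ((K + 2) * q2 / q1 - (K + 1) * q1 / q0)) = (K + 1) * (q1 / q0)" by simp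
    then show ?thesis using K1 by (subst (asm) mult_cancel_left) simp
  qed
  then have "(real n * s * q1 / (q0 * A) + ((K + 2) * q2 / q1 - (K + 1) * q1 / q0)) * (q0 * q1 * A) = q1 / q0 * (q0 * q1 * A)"
    by (simp only:)
  moreover have "(x * q1 / (q0 * A) + (y * q2 / q1 - z * q1 / q0)) * (q0 * q1 * A) = x * q1\<^sup>2 + y * A * (q2 * q0) - z * A * q1\<^sup>2" for x y z
    using q A(2) by (simp add: field_simps power2_eq_square)
  moreover have "q1 / q0 * (q0 * q1 * A) = A * q1\<^sup>2"
    using q by (simp add: power2_eq_square)
  ultimately have "(K + 2) * A * (q2 * q0) = ((K + 2) * A - real n * s) * q1\<^sup>2"
    by (simp only: left_diff_distrib) (simp add: algebra_simps)
  moreover have "((K + 2) * A - real n * s) * q1\<^sup>2 < (K + 2) * A * (q2 * q0)"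
    unfolding A(1) q0_def q1_def q2_def by (rule pochhammer_log_concavity_less[OF s(1) K s(2) n])
  ultimately show False by simp
qed

section \<open>Logarithmic derivatives at the origin\<close>

lemma eseries_derivs_0:
  assumes p: "p > 0"
  shows "eseries p n k 0 = of_real (ecoeff p n k 0)" "deriv (eseries p n k) 0 = of_real (ecoeff p n k 1)"
    "deriv (deriv (eseries p n k)) 0 = 2 * of_real (ecoeff p n k 2)"
proof -
  define c where "c j = (of_real (ecoeff p n k j) :: complex)" for j
  have rc: "conv_radius c = 1" unfolding c_def by (rule ecoeff_conv_radius[OF p])
  have E: "eseries p n k = (\<lambda>x. \<Sum>j. c j * x ^ j)" by (simp add: eseries_def c_def fun_eq_iff)
  have d1: "deriv (eseries p n k) x = (\<Sum>j. diffs c j * x ^ j)" if "norm x < 1" for x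
    unfolding E by (rule DERIV_imp_deriv, rule has_field_derivative_powser) (use that in \<open>simp add: rc one_ereal_def\<close>)
  have "((\<lambda>x. \<Sum>j. diffs c j * x ^ j) has_field_derivative (\<Sum>j. diffs (diffs c) j * 0 ^ j)) (at 0)"
  proof (rule has_field_derivative_powser)
    \<comment> \<open>At 0 any positive radius of convergence suffices; the point 1/2 witnesses
      one.\<close>
    have "summable (\<lambda>j. diffs c j * (1 / 2) ^ j)"
      by (rule termdiff_converges[where K = 1]) (auto intro!: summable_in_conv_radius simp: rc one_ereal_def norm_divide)
    then have "ereal (norm (1 / 2 :: complex)) \<le> conv_radius (diffs c)" by (rule conv_radius_geI)
    then show "ereal (norm (0 :: complex)) < conv_radius (diffs c)"
      by (rule less_le_trans[rotated]) (simp add: norm_divide)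
  qed
  then have "(deriv (eseries p n k) has_field_derivative (\<Sum>j. diffs (diffs c) j * 0 ^ j)) (at 0)"
    by (rule has_field_derivative_transform_within_open[OF _ open_ball, of _ _ _ 0 1]) (auto simp: d1)
  then have "deriv (deriv (eseries p n k)) 0 = (\<Sum>j. diffs (diffs c) j * 0 ^ j)"
    by (rule DERIV_imp_deriv)
  then show "deriv (deriv (eseries p n k)) 0 = 2 * of_real (ecoeff p n k 2)"
    by (simp add: diffs_def c_def numeral_2_eq_2)
  show "deriv (eseries p n k) 0 = of_real (ecoeff p n k 1)"
    using d1[of 0] by (simp add: diffs_def c_def)
  show "eseries p n k 0 = of_real (ecoeff p n k 0)"
    by (simp add: E c_def)
qed

lemma log_deriv_holomorphic:
  assumes p: "p > 0"
  shows "log_deriv p n k holomorphic_on {x \<in> ball 0 1. eseries p n k x \<noteq> 0}"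
proof -
  note hol = eseries_holomorphic[OF p, of n k]
  have "deriv (eseries p n k) holomorphic_on {x \<in> ball 0 1. eseries p n k x \<noteq> 0}"
    by (rule holomorphic_on_subset[OF holomorphic_deriv[OF hol open_ball]]) auto
  then show ?thesis
    unfolding log_deriv_def[abs_def]
    by (rule holomorphic_on_divide) (auto intro: holomorphic_on_subset[OF hol])
qed

lemma open_eseries_nonzero:
  assumes "p > 0" shows "open {x \<in> ball 0 1. eseries p n k x \<noteq> 0}"
proof -
  have "{x \<in> ball 0 1. eseries p n k x \<noteq> 0} = ball 0 1 \<inter> eseries p n k -` (- {0})" by auto
  also have "open \<dots>"
    using holomorphic_on_imp_continuous_on[OF eseries_holomorphic[OF assms, of n k]]
    by (intro continuous_open_preimage) auto
  finally show ?thesis .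
qed

lemma log_deriv_0:
  assumes p: "p > 0"
  shows "log_deriv p n k 0 = of_real (ecoeff p n k 1 / ecoeff p n k 0)"
    "deriv (log_deriv p n k) 0 = of_real (2 * ecoeff p n k 2 / ecoeff p n k 0 - (ecoeff p n k 1 / ecoeff p n k 0)\<^sup>2)"
proof -
  note e = eseries_derivs_0[OF p, of n k]
  have a0: "ecoeff p n k 0 > 0" by (rule ecoeff_pos[OF p])
  show "log_deriv p n k 0 = of_real (ecoeff p n k 1 / ecoeff p n k 0)"
    by (simp add: log_deriv_def e)
  have 1: "(eseries p n k has_field_derivative deriv (eseries p n k) 0) (at 0)"
    by (rule field_differentiable_derivI) (rule eseries_field_differentiable[OF p], simp)
  have 2: "(deriv (eseries p n k) has_field_derivative deriv (deriv (eseries p n k)) 0) (at 0)"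
    by (rule holomorphic_derivI[OF holomorphic_deriv[OF eseries_holomorphic[OF p] open_ball] open_ball]) simp
  have "eseries p n k 0 \<noteq> 0" using a0 e(1) by simp
  from DERIV_divide[OF 2 1 this]
  have "deriv (log_deriv p n k) 0 = (deriv (deriv (eseries p n k)) 0 * eseries p n k 0 - deriv (eseries p n k) 0 * deriv (eseries p n k) 0)
      / (eseries p n k 0 * eseries p n k 0)"
    unfolding log_deriv_def[abs_def] by (rule DERIV_imp_deriv)
  also have "\<dots> = of_real (2 * ecoeff p n k 2 / ecoeff p n k 0 - (ecoeff p n k 1 / ecoeff p n k 0)\<^sup>2)"
    unfolding e using a0 by (simp add: field_simps power2_eq_square)
  finally show "deriv (log_deriv p n k) 0 = of_real (2 * ecoeff p n k 2 / ecoeff p n k 0 - (ecoeff p n k 1 / ecoeff p n k 0)\<^sup>2)" .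
qed

text \<open>The logarithmic derivative without a logarithm: products and powers become sums and
  multiples, so the derivative of log det g is read off factor by factor and a branch is needed only
  at the end.\<close>

definition has_log_derivative :: "(complex \<Rightarrow> complex) \<Rightarrow> complex \<Rightarrow> complex \<Rightarrow> bool"
  where "has_log_derivative f d x \<longleftrightarrow> f x \<noteq> 0 \<and> (f has_field_derivative d * f x) (at x)"

lemma has_log_derivativeI:
  "(f has_field_derivative D) (at x) \<Longrightarrow> f x \<noteq> 0 \<Longrightarrow> has_log_derivative f (D / f x) x"
  by (simp add: has_log_derivative_def)

lemma has_log_derivative_mult:
  assumes "has_log_derivative f d x" "has_log_derivative g e x"
  shows "has_log_derivative (\<lambda>x. f x * g x) (d + e) x"
proof -
  have "((\<lambda>x. f x * g x) has_field_derivative d * f x * g x + e * g x * f x) (at x)"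
    using assms by (intro DERIV_mult) (auto simp: has_log_derivative_def)
  then show ?thesis using assms by (simp add: has_log_derivative_def algebra_simps)
qed

lemma has_log_derivative_power:
  assumes "has_log_derivative f d x"
  shows "has_log_derivative (\<lambda>x. f x ^ m) (of_nat m * d) x"
proof (induction m)
  case 0
  then show ?case by (simp add: has_log_derivative_def)
next
  case (Suc m)
  from has_log_derivative_mult[OF assms Suc] show ?case by (simp add: algebra_simps)
qed

text \<open>Since \<open>f 0\<close> is off the branch cut, continuity provides a ball on which the
  principal logarithm of f is holomorphic.\<close>

lemma has_log_derivative_ln:
  assumes f: "f holomorphic_on S" "open S" "0 \<in> S" "f 0 \<notin> \<real>\<^sub>\<le>\<^sub>0" and d: "has_log_derivative f d 0"
  obtains e where "e > 0" "ball 0 e \<subseteq> S" "(\<lambda>x. ln (f x)) holomorphic_on ball 0 e" "deriv (\<lambda>x. ln (f x)) 0 = d"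
proof -
  have "open (S \<inter> f -` (- \<real>\<^sub>\<le>\<^sub>0))"
    using holomorphic_on_imp_continuous_on[OF f(1)] f(2)
    by (intro continuous_open_preimage) (auto simp: open_Compl)
  moreover have "0 \<in> S \<inter> f -` (- \<real>\<^sub>\<le>\<^sub>0)" using f by auto
  ultimately obtain e where e: "e > 0" "ball 0 e \<subseteq> S \<inter> f -` (- \<real>\<^sub>\<le>\<^sub>0)"
    by (meson open_contains_ball)
  show thesis
  proof (rule that[OF e(1)])
    show "ball 0 e \<subseteq> S" using e by auto
    show "(\<lambda>x. ln (f x)) holomorphic_on ball 0 e"
      using e(2) by (intro holomorphic_on_Ln' holomorphic_on_subset[OF f(1)]) blast+
    have "((\<lambda>x. ln (f x)) has_field_derivative inverse (f 0) * (d * f 0)) (at 0)"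
      using d by (intro DERIV_chain2[where f = Ln and g = f, OF has_field_derivative_Ln[OF f(4)]]) (simp add: has_log_derivative_def)
    moreover have "inverse (f 0) * (d * f 0) = d"
      using d by (simp add: has_log_derivative_def)
    ultimately have "((\<lambda>x. ln (f x)) has_field_derivative d) (at 0)"
      by (simp only:)
    then show "deriv (\<lambda>x. ln (f x)) 0 = d" by (rule DERIV_imp_deriv)
  qed
qed

section \<open>The determinant of the metric on coordinate lines\<close>

lemma det_diagonal_one_special:
  fixes B :: "complex^'m::finite^'m"
  assumes diag: "\<And>s t. s \<noteq> t \<Longrightarrow> B $ s $ t = 0" and l: "B $ l $ l = x"
    and others: "\<And>t. t \<noteq> l \<Longrightarrow> B $ t $ t = y t"
  shows "det B = x * (\<Prod>t\<in>UNIV - {l}. y t)"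
proof -
  have "det B = (\<Prod>t\<in>UNIV. B $ t $ t)" by (rule det_diagonal[OF diag])
  also have "\<dots> = B $ l $ l * (\<Prod>t\<in>UNIV - {l}. B $ t $ t)" by (rule prod.remove) auto
  also have "(\<Prod>t\<in>UNIV - {l}. B $ t $ t) = (\<Prod>t\<in>UNIV - {l}. y t)"
    by (intro prod.cong) (auto simp: others)
  finally show ?thesis by (simp add: l)
qed

lemma prod_blockwise_remove:
  fixes x y :: complex
  shows "(\<Prod>t\<in>UNIV - {Inl a :: 'n::finite + 'k::finite}. blockwise x y t) = x ^ (CARD('n) - 1) * y ^ CARD('k)"
    "(\<Prod>t\<in>UNIV - {Inr b :: 'n::finite + 'k::finite}. blockwise x y t) = x ^ CARD('n) * y ^ (CARD('k) - 1)"
proof -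
  have 1: "(UNIV :: ('n + 'k) set) - {Inl a} = (UNIV - {a}) <+> UNIV"
  proof (rule set_eqI)
    show "x \<in> UNIV - {Inl a} \<longleftrightarrow> x \<in> (UNIV - {a}) <+> UNIV" for x :: "'n + 'k" by (cases x) auto
  qed
  have 2: "(UNIV :: ('n + 'k) set) - {Inr b} = UNIV <+> (UNIV - {b})"
  proof (rule set_eqI)
    show "x \<in> UNIV - {Inr b} \<longleftrightarrow> x \<in> UNIV <+> (UNIV - {b})" for x :: "'n + 'k" by (cases x) auto
  qed
  show "(\<Prod>t\<in>UNIV - {Inl a :: 'n + 'k}. blockwise x y t) = x ^ (CARD('n) - 1) * y ^ CARD('k)"
    unfolding 1 by (subst prod.Plus) (auto simp: card_Diff_singleton)
  show "(\<Prod>t\<in>UNIV - {Inr b :: 'n + 'k}. blockwise x y t) = x ^ CARD('n) * y ^ (CARD('k) - 1)"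
    unfolding 2 by (subst prod.Plus) (auto simp: card_Diff_singleton)
qed

lemma axis_in_E:
  assumes p: "p > 0" and "norm \<zeta> < 1"
  shows "axis s \<zeta> \<in> (E p :: (complex^('n::finite + 'k::finite)) set)"
proof (cases s)
  case (Inl a)
  \<comment> \<open>The index in the other block is arbitrary, since the entry there is 0.\<close>
  have "axis s \<zeta> = embed2 a undefined \<zeta> 0" unfolding Inl by (auto simp: vec_eq_iff embed2_nth axis_def)
  then show ?thesis using assms fibre_radius_pos[of "norm \<zeta>" p] by (simp add: embed2_in_E)
next
  case (Inr b)
  have "axis s \<zeta> = embed2 undefined b 0 \<zeta>" unfolding Inr by (auto simp: vec_eq_iff embed2_nth axis_def)
  then show ?thesis using assms by (simp add: embed2_in_E fibre_radius_def)
qed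

lemma kaehler_einstein_imp_p_eq_1:
  fixes p :: real
  assumes p: "p > 0"
    and KE: "kaehler_einstein_on (E p) (bergman_metric (E p :: (complex^('n::finite + 'k::finite)) set))"
  shows "p = 1"
proof -
  let ?D = "E p :: (complex^('n + 'k)) set" and ?g = "bergman_metric (E p :: (complex^('n + 'k)) set)"
  define n k where "n = CARD('n)" and "k = CARD('k)"
  have nk: "n > 0" "k > 0" by (simp_all add: n_def k_def)
  define s :: complex where "s = of_real (1 / p)"
  define A :: complex where "A = of_real (real n + 1 + real k / p)"
  define Ar where "Ar = real n + 1 + real k / p"
  have Ar: "Ar > 0" "A = of_real Ar" using p by (simp_all add: Ar_def A_def add_pos_nonneg)
  then have A0: "A \<noteq> 0" by simp
  define H where "H = log_deriv p n k"
  define h h1 where "h = ecoeff p n k 1 / ecoeff p n k 0"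
    and "h1 = 2 * ecoeff p n k 2 / ecoeff p n k 0 - (ecoeff p n k 1 / ecoeff p n k 0)\<^sup>2"
  have h: "h > 0" using ecoeff_pos[OF p] by (simp add: h_def)
  have H0: "H 0 = of_real h" "deriv H 0 = of_real h1"
    using log_deriv_0[OF p, of n k] by (simp_all add: H_def h_def h1_def)
  \<comment> \<open>\<Phi> is positive on [0, 1) but may vanish elsewhere in the disc; H is
    holomorphic on S, and S contains every value of \<open>diag_arg p\<close> on the domain.\<close>
  define S where "S = {x \<in> ball 0 1. eseries p n k x \<noteq> 0}"
  have S: "open S" "0 \<in> S"
    using open_eseries_nonzero[OF p, of n k] eseries_derivs_0(1)[OF p, of n k] ecoeff_pos[OF p, of n k 0]
    by (auto simp: S_def)
  have H_hol: "H holomorphic_on S" unfolding H_def S_def by (rule log_deriv_holomorphic[OF p])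
  have H_deriv: "(H has_field_derivative deriv H x) (at x)" if "x \<in> S" for x
    by (rule holomorphic_derivI[OF H_hol S(1) that])
  have D: "open ?D" by (rule open_E[OF p])
  have R_in_S: "diag_arg p w \<in> S" if w: "w \<in> ?D" for w
  proof -
    obtain y where "y > 0" "eseries p n k (diag_arg p w) = of_real y" using eseries_diag_pos[OF p w] by blast
    then show ?thesis using norm_diag_arg_less_1[OF p w] by (simp add: S_def)
  qed
  define X :: "complex^('n + 'k) \<Rightarrow> complex" where "X w = 1 - herm1 w w" for w
  define P where "P w = (A + s * diag_arg p w * H (diag_arg p w)) / X w" for w :: "complex^('n + 'k)"
  define Q where "Q w = X w powr (- s) * H (diag_arg p w)" for w :: "complex^('n + 'k)"
  have L: "has_block_derivative (\<lambda>w. ln (bergman_kernel ?D w w)) w (P w) (Q w)" if "w \<in> ?D" for w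
    using has_block_derivative_log_bergman_kernel[OF p, where 'n = 'n and 'k = 'k] that
    unfolding P_def Q_def X_def A_def s_def H_def n_def k_def by blast
  define num where "num w = A + s * (diag_arg p w * H (diag_arg p w))" for w :: "complex^('n + 'k)"
  have X0: "X w \<noteq> 0" if "w \<in> ?D" for w
    unfolding X_def by (rule one_minus_herm1_not_nonpos(2)[OF p that that])
  have P_block: "has_block_derivative P w
      ((s * (s * diag_arg p w / X w * H (diag_arg p w) + diag_arg p w * (deriv H (diag_arg p w) * (s * diag_arg p w / X w)))) / X w
         + num w * (1 / (X w)\<^sup>2))
      (s * (X w powr (- s) * H (diag_arg p w) + diag_arg p w * (deriv H (diag_arg p w) * (X w powr (- s)))) / X w)"
    (is "has_block_derivative P w ?P1 ?P2")
    and Q_block: "has_block_derivative Q w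
      (s * X w powr (- s) / X w * H (diag_arg p w) + X w powr (- s) * (deriv H (diag_arg p w) * (s * diag_arg p w / X w)))
      (X w powr (- s) * (deriv H (diag_arg p w) * (X w powr (- s))))"
    (is "has_block_derivative Q w ?Q1 ?Q2")
    if w: "w \<in> ?D" for w
  proof -
    let ?R = "diag_arg p w"
    have R: "has_block_derivative (diag_arg p) w (s * ?R / X w) (X w powr (- s))"
      using has_block_derivative_diag_arg[OF p w] by (simp only: s_def X_def)
    have HR: "has_block_derivative (\<lambda>w. H (diag_arg p w)) w (deriv H ?R * (s * ?R / X w)) (deriv H ?R * (X w powr (- s)))"
      by (rule has_block_derivative_compose[OF R H_deriv[OF R_in_S[OF w]]])
    have pw: "has_block_derivative (\<lambda>w. X w powr (- s)) w (s * X w powr (- s) / X w) 0"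
      using has_block_derivative_powr[OF p w, of "- s"] by (simp add: X_def)
    have inv: "has_block_derivative (\<lambda>w. inverse (X w)) w (1 / (X w)\<^sup>2) 0"
    proof -
      have "((\<lambda>x. inverse (1 - x)) has_field_derivative 1 / (1 - herm1 w w)\<^sup>2) (at (herm1 w w))"
        using X0[OF w] unfolding X_def by (auto intro!: derivative_eq_intros simp: power2_eq_square divide_inverse)
      from has_block_derivative_compose[OF has_block_derivative_herm(1) this] show ?thesis by (simp add: X_def)
    qed
    have "has_block_derivative num w
       (0 + (0 * (?R * H ?R) + s * (s * ?R / X w * H ?R + ?R * (deriv H ?R * (s * ?R / X w)))))
       (0 + (0 * (?R * H ?R) + s * (X w powr (- s) * H ?R + ?R * (deriv H ?R * (X w powr (- s))))))"
      unfolding num_def by (intro has_block_derivative_add has_block_derivative_mult has_block_derivative_const R HR)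
    from has_block_derivative_mult[OF this inv]
    have "has_block_derivative (\<lambda>w. num w * inverse (X w)) w ?P1 ?P2"
      by (simp add: divide_inverse)
    moreover have "(\<lambda>w. num w * inverse (X w)) = P" by (simp add: P_def num_def fun_eq_iff divide_inverse mult.assoc)
    ultimately show "has_block_derivative P w ?P1 ?P2" by simp
    show "has_block_derivative Q w ?Q1 ?Q2"
      using has_block_derivative_mult[OF pw HR] unfolding Q_def[abs_def] by simp
  qed
  have g: "?g w $ u $ t = (if u = t then blockwise (P w) (Q w) t else 0) +
      w $ t * (blockwise (blockwise P1 P2 u) (blockwise Q1 Q2 u) t * cnj (w $ u))"
    if "w \<in> ?D" "has_block_derivative P w P1 P2" "has_block_derivative Q w Q1 Q2" for w u t P1 P2 Q1 Q2
    unfolding bergman_metric_def by (rule complex_hessian_block[OF D L that])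
  \<comment> \<open>Only entry l of the point can be nonzero, so g is diagonal there and the second
    derivatives enter only its entry l.\<close>
  have on_axis: "?g (axis l \<zeta>) $ u $ t = (if u = t then blockwise (P (axis l \<zeta>)) (Q (axis l \<zeta>)) t +
      (if t = l then \<zeta> * cnj \<zeta> * blockwise P1 Q2 l else 0) else 0)"
    if "axis l \<zeta> \<in> ?D" "has_block_derivative P (axis l \<zeta>) P1 P2" "has_block_derivative Q (axis l \<zeta>) Q1 Q2" for l \<zeta> u t P1 P2 Q1 Q2
    using g[OF that, of u t] by (cases l) (auto simp: axis_def)
  have herm_ax: "herm1 (axis (Inl a) \<zeta>) (axis (Inl a) \<zeta>) = \<zeta> * cnj \<zeta>" "herm2 (axis (Inl a) \<zeta>) (axis (Inl a) \<zeta>) = 0"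
    "herm1 (axis (Inr b) \<zeta>) (axis (Inr b) \<zeta>) = 0" "herm2 (axis (Inr b) \<zeta>) (axis (Inr b) \<zeta>) = \<zeta> * cnj \<zeta>"
    for a :: 'n and b :: 'k and \<zeta>
    by (simp_all add: herm_axis)
  \<comment> \<open>The determinants on the two kinds of lines as functions of x = |\<zeta>|^2: the
    entry along the line occurs once, the other entries of its block n - 1 or k - 1 times. In
    \<open>Dx\<close> the entry along the line is the derivative of x H(x).\<close>
  define Dz where "Dz x = (A / (1 - x)) ^ (n - 1) * (A / (1 - x)\<^sup>2) * ((1 - x) powr (- s) * of_real h) ^ k" for x
  define Dx where "Dx x = (A + s * (x * H x)) ^ n * H x ^ (k - 1) * (H x + x * deriv H x)" for x
  have det_z: "det (?g (axis (Inl a) \<zeta>)) = Dz (\<zeta> * cnj \<zeta>)" if \<zeta>: "norm \<zeta> < 1" for a :: 'n and \<zeta>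
  proof -
    let ?w = "axis (Inl a) \<zeta> :: complex^('n + 'k)" and ?x = "\<zeta> * cnj \<zeta>"
    have w: "?w \<in> ?D" by (rule axis_in_E[OF p \<zeta>])
    have R: "diag_arg p ?w = 0" by (simp add: diag_arg_def herm_ax)
    have X: "X ?w = 1 - ?x" by (simp add: X_def herm_ax)
    have x0: "1 - ?x \<noteq> 0" using X0[OF w] X by simp
    have Pw: "P ?w = A / (1 - ?x)" and Qw: "Q ?w = (1 - ?x) powr (- s) * of_real h"
      by (simp_all add: P_def Q_def R X H0)
    have num: "num ?w = A" by (simp add: num_def R)
    have sum_eq: "A / (1 - ?x) + ?x * (A / (1 - ?x)\<^sup>2) = A / (1 - ?x)\<^sup>2"
    proof -
      have "A / y + (1 - y) * (A / y\<^sup>2) = A / y\<^sup>2" if "y \<noteq> 0" for y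
        using that by (simp add: field_simps power2_eq_square)
      from this[OF x0] show ?thesis by simp
    qed
    have "det (?g ?w) = A / (1 - ?x)\<^sup>2 * (\<Prod>t\<in>UNIV - {Inl a :: 'n + 'k}. blockwise (A / (1 - ?x)) ((1 - ?x) powr (- s) * of_real h) t)"
      by (rule det_diagonal_one_special)
         (use sum_eq in \<open>simp_all add: on_axis[OF w P_block[OF w] Q_block[OF w]] Pw Qw R X num\<close>)
    then show ?thesis
      unfolding prod_blockwise_remove Dz_def n_def k_def by (simp only: mult_ac)
  qed
  have det_x: "det (?g (axis (Inr b) \<zeta>)) = Dx (\<zeta> * cnj \<zeta>)" if \<zeta>: "norm \<zeta> < 1" for b :: 'k and \<zeta>
  proof -
    let ?w = "axis (Inr b) \<zeta> :: complex^('n + 'k)" and ?x = "\<zeta> * cnj \<zeta>"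
    have w: "?w \<in> ?D" by (rule axis_in_E[OF p \<zeta>])
    have X: "X ?w = 1" by (simp add: X_def herm_ax)
    have R: "diag_arg p ?w = ?x" by (simp add: diag_arg_def herm_ax)
    have Pw: "P ?w = A + s * (?x * H ?x)" and Qw: "Q ?w = H ?x"
      by (simp_all add: P_def Q_def R X mult.assoc)
    have "det (?g ?w) = (H ?x + ?x * deriv H ?x) * (\<Prod>t\<in>UNIV - {Inr b :: 'n + 'k}. blockwise (A + s * (?x * H ?x)) (H ?x) t)"
      by (rule det_diagonal_one_special) (simp_all add: on_axis[OF w P_block[OF w] Q_block[OF w]] Pw Qw R X)
    then show ?thesis
      unfolding prod_blockwise_remove Dx_def n_def k_def by (simp only: mult_ac)
  qed
  have D0: "0 \<in> ?D" by (rule zero_in_E[OF p])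
  have ax0: "axis l 0 = (0 :: complex^('n + 'k))" for l by (simp add: vec_eq_iff axis_def)
  have Dx0: "Dx 0 = of_real (Ar ^ n * h ^ (k - 1) * h)" by (simp add: Dx_def H0 Ar)
  have Dx0_ln: "Dx 0 \<notin> \<real>\<^sub>\<le>\<^sub>0" unfolding Dx0 nonpos_Reals_of_real_iff not_le using Ar h by simp
  have Dz0: "Dz 0 = of_real (Ar ^ (n - 1) * Ar * h ^ k)" by (simp add: Dz_def Ar)
  have Dz0_ln: "Dz 0 \<notin> \<real>\<^sub>\<le>\<^sub>0" unfolding Dz0 nonpos_Reals_of_real_iff not_le using Ar h by simp
  define F where "F w = ln (det (?g w))" for w
  have Ck_g: "\<And>u t m. Ck_on m ?D (\<lambda>w. ?g w $ u $ t)"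
    using KE unfolding kaehler_einstein_on_def kaehler_metric_on_def by blast
  note Ck_det = Ck_on_det[OF D Ck_g]
  \<comment> \<open>On U the determinant avoids the branch cut, so log det g is of class C^2 there,
    as the computation of its Hessian along a line requires.\<close>
  define U where "U = ?D \<inter> (\<lambda>w. det (?g w)) -` (- \<real>\<^sub>\<le>\<^sub>0)"
  have "open U" unfolding U_def
    by (rule continuous_open_preimage[OF Ck_on_continuous[OF Ck_det] D]) (simp add: open_Compl)
  have "0 \<in> U"
    using D0 Dz0_ln det_z[of 0 undefined] by (simp add: U_def ax0)
  have "U \<subseteq> ?D" by (auto simp: U_def)
  have CkF: "Ck_on 2 U F"
    unfolding F_def numeral_2_eq_2
    by (rule Ck_on_Ln[OF \<open>open U\<close> Ck_on_subset[OF Ck_det \<open>U \<subseteq> ?D\<close>]]) (auto simp: U_def)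
  obtain c :: real where c: "\<And>w. w \<in> ?D \<Longrightarrow> ricci ?g w = c *\<^sub>R ?g w"
    using KE unfolding kaehler_einstein_on_def by blast
  have ricci: "- (complex_hessian F 0 $ l $ l) = of_real c * (?g 0 $ l $ l)" for l
    using arg_cong[OF c[OF D0], of "\<lambda>B. B $ l $ l"] unfolding ricci_def F_def[abs_def] vector_scaleR_component
    by (simp add: scaleR_conv_of_real)
  have g0: "?g 0 $ Inl a $ Inl a = A" "?g 0 $ Inr b $ Inr b = of_real h" for a b
  proof -
    have R0: "diag_arg p (0 :: complex^('n + 'k)) = 0" "X 0 = 1"
      by (simp_all add: diag_arg_def X_def herm1_def herm2_def hprod_def)
    show "?g 0 $ Inl a $ Inl a = A" "?g 0 $ Inr b $ Inr b = of_real h"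
      using g[OF D0 P_block[OF D0] Q_block[OF D0]] by (simp_all add: P_def Q_def R0 H0)
  qed
  have log_base: "has_log_derivative (\<lambda>x. A / (1 - x)) 1 0" "has_log_derivative (\<lambda>x. A / (1 - x)\<^sup>2) 2 0"
    "has_log_derivative (\<lambda>x. (1 - x) powr (- s) * of_real h) s 0"
  proof -
    have "((\<lambda>x. A / (1 - x)) has_field_derivative A) (at 0)"
      by (auto intro!: derivative_eq_intros)
    from has_log_derivativeI[OF this] A0 show 1: "has_log_derivative (\<lambda>x. A / (1 - x)) 1 0" by simp
    have "((\<lambda>x. A / (1 - x)\<^sup>2) has_field_derivative 2 * A) (at 0)"
      by (auto intro!: derivative_eq_intros)
    from has_log_derivativeI[OF this] A0 show "has_log_derivative (\<lambda>x. A / (1 - x)\<^sup>2) 2 0" by simp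
    have "((\<lambda>x. (1 - x) powr (- s)) has_field_derivative (- s * (1 - 0) powr (- s - 1) * - 1)) (at 0)"
      by (rule DERIV_chain2[of "\<lambda>x. x powr (- s)"]) (auto intro!: has_field_derivative_powr derivative_eq_intros)
    then have "((\<lambda>x. (1 - x) powr (- s) * of_real h) has_field_derivative s * of_real h) (at 0)"
      using DERIV_cmult_right[of "\<lambda>x. (1 - x) powr (- s)" s 0 UNIV "of_real h"] by simp
    from has_log_derivativeI[OF this] h show "has_log_derivative (\<lambda>x. (1 - x) powr (- s) * of_real h) s 0" by simp
  qed
  \<comment> \<open>The contributions n - 1, 2 and k s add up to n + 1 + k s = A, which is also the
    z-entry of g at 0; this is what forces c = -1.\<close>
  have "has_log_derivative Dz (of_nat (n - 1) * 1 + 2 + of_nat k * s) 0"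
    unfolding Dz_def by (intro has_log_derivative_mult has_log_derivative_power log_base)
  moreover have "of_nat (n - 1) * 1 + 2 + of_nat k * s = A"
    using nk(1) by (simp add: A_def s_def of_nat_diff)
  ultimately have Dz_log: "has_log_derivative Dz A 0" by simp
  have "Dz holomorphic_on ball 0 1"
  proof -
    have "1 - x \<notin> \<real>\<^sub>\<le>\<^sub>0" if "x \<in> ball 0 1" for x :: complex
      using that complex_Re_le_cmod[of x] by (auto simp: complex_nonpos_Reals_iff)
    then show ?thesis unfolding Dz_def by (auto intro!: holomorphic_intros)
  qed
  from has_log_derivative_ln[OF this open_ball _ Dz0_ln Dz_log]
  obtain e where e: "e > 0" "(\<lambda>x. ln (Dz x)) holomorphic_on ball 0 e" "deriv (\<lambda>x. ln (Dz x)) 0 = A" by auto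
  have hess_z: "complex_hessian F 0 $ Inl a $ Inl a = A" for a
    using complex_hessian_radial_on_line[OF \<open>open U\<close> \<open>0 \<in> U\<close> CkF e(2,1), of 1 "Inl a"] det_z
    by (simp add: F_def e(3))
  have c1: "c = - 1"
  proof -
    have "- A = of_real c * A" using ricci[of "Inl undefined"] by (simp add: hess_z g0)
    then have "of_real (- Ar) = (of_real (c * Ar) :: complex)" by (simp add: Ar)
    then have "- Ar = c * Ar" unfolding of_real_eq_iff .
    then have "(c + 1) * Ar = 0" by (simp add: distrib_right)
    then have "c + 1 = 0" using Ar(1) by simp
    then show ?thesis by linarith
  qed
  have H'_deriv: "(deriv H has_field_derivative deriv (deriv H) 0) (at 0)"
    by (rule holomorphic_derivI[OF holomorphic_deriv[OF H_hol S(1)] S])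
  have log_base_x: "has_log_derivative (\<lambda>x. A + s * (x * H x)) (s * of_real h / A) 0"
    "has_log_derivative H (of_real h1 / of_real h) 0" "has_log_derivative (\<lambda>x. H x + x * deriv H x) (2 * of_real h1 / of_real h) 0"
  proof -
    note dH = H_deriv[OF S(2)]
    have "((\<lambda>x. A + s * (x * H x)) has_field_derivative 0 + s * (1 * H 0 + deriv H 0 * 0)) (at 0)"
      by (intro DERIV_add DERIV_cmult DERIV_mult DERIV_const DERIV_ident dH)
    from has_log_derivativeI[OF this] A0 show "has_log_derivative (\<lambda>x. A + s * (x * H x)) (s * of_real h / A) 0"
      by (simp add: H0)
    from has_log_derivativeI[OF dH] h show "has_log_derivative H (of_real h1 / of_real h) 0" by (simp add: H0)
    have "((\<lambda>x. H x + x * deriv H x) has_field_derivative deriv H 0 + (1 * deriv H 0 + deriv (deriv H) 0 * 0)) (at 0)"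
      by (intro DERIV_add DERIV_mult DERIV_ident dH H'_deriv)
    from has_log_derivativeI[OF this] h show "has_log_derivative (\<lambda>x. H x + x * deriv H x) (2 * of_real h1 / of_real h) 0"
      by (simp add: H0)
  qed
  have Dx_log: "has_log_derivative Dx (of_nat n * (s * of_real h / A) + of_nat (k - 1) * (of_real h1 / of_real h) + 2 * of_real h1 / of_real h) 0"
    unfolding Dx_def by (intro has_log_derivative_mult has_log_derivative_power log_base_x)
  define ld where "ld = real n * (1 / p) * h / Ar + (real k + 1) * h1 / h"
  have ld: "of_nat n * (s * of_real h / A) + of_nat (k - 1) * (of_real h1 / of_real h) + 2 * of_real h1 / of_real h = of_real ld"
    using nk(2) h by (simp add: ld_def Ar(2) s_def of_nat_diff field_simps)
  have "Dx holomorphic_on S"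
    unfolding Dx_def by (intro holomorphic_intros H_hol S(1))
  from has_log_derivative_ln[OF this S Dx0_ln Dx_log]
  obtain e' where e': "e' > 0" "(\<lambda>x. ln (Dx x)) holomorphic_on ball 0 e'" "deriv (\<lambda>x. ln (Dx x)) 0 = of_real ld" unfolding ld by auto
  have hess_x: "complex_hessian F 0 $ Inr b $ Inr b = of_real ld" for b
    using complex_hessian_radial_on_line[OF \<open>open U\<close> \<open>0 \<in> U\<close> CkF e'(2,1), of 1 "Inr b"] det_x
    by (simp add: F_def e'(3))
  \<comment> \<open>With c = -1 the Einstein equation in a \<xi>-direction reads ld = h, which is
    the hypothesis of \<open>einstein_coefficient_equation\<close>.\<close>
  have "of_real ld = (of_real h :: complex)"
    using ricci[of "Inr undefined"] by (simp add: hess_x g0 c1)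
  then have "ld = h" unfolding of_real_eq_iff .
  then show "p = 1"
    using einstein_coefficient_equation[OF p nk] unfolding ld_def h_def h1_def Ar_def by blast
qed

theorem proposition1p10:
  fixes p :: real
  assumes "p > 0"
  shows "kaehler_einstein_on (E p) (bergman_metric (E p :: (complex^('n::finite + 'k::finite)) set))
    \<longleftrightarrow> p = 1"
  using kaehler_einstein_ball kaehler_einstein_imp_p_eq_1[OF assms] by blast

end
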